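(* Let $\mathcal A$ be a finite alphabet with $|\mathcal A|=d\ge 2$, let $\mathbf p=(p_a)_{a\in\mathcal A}$ satisfy $p_a>0$ for all $a$ and $\sum_a p_a=1$, and for each $N$ let $W_N$ be a random word in $\mathcal A^N$ with law $\mathbb P_{\mathrm{src}}\{W_N=w\}=\prod_{i=1}^N p_{w_i}$. Let $c_{\mathrm T}$ be the canonical T-complexity, $h(\mathbf p)=-\sum_a p_a\log p_a$, $H_2(\mathbf p)=h(\mathbf p)/\log 2$, and let $\gamma$ be the Euler--Mascheroni constant. Then, as $N\to\infty$, $$\frac{c_{\mathrm T}(W_N)}{e^{-\gamma}h(\mathbf p)\,N/\log N}\longrightarrow 1\quad\text{in probability under }\mathbb P_{\mathrm{src}}.$$ Moreover, for every fixed $1\le r<\infty$, $$\mathbb E_{\mathrm{src}}\left|\frac{c_{\mathrm T}(W_N)}{e^{-\gamma}h(\mathbf p)\,N/\log N}-1\right|^r\longrightarrow 0;$$ equivalently, $c_{\mathrm T}(W_N)=e^{-\gamma}H_2(\mathbf p)\frac{N}{\log_2 N}\bigl(1+o_{L^r}(1)\bigr)$, where $o_{L^r}(1)$ denotes a random sequence tending to $0$ in $L^r(\mathbb P_{\mathrm{src}})$.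
   Context: All unsubscripted logarithms are natural. $\mathcal A^+$ is the set of nonempty finite words over $\mathcal A$; $u^j$ is the $j$-fold concatenation of $u$ ($u^0$ is the empty word). $\mathbb E_{\mathrm{src}}$ is expectation under the product law $\mathbb P_{\mathrm{src}}$. T-augmentation: for a finite prefix code $C\subset\mathcal A^+$, $u\in C$ and an integer $k\ge1$, $$C[u,k]:=\{u^js: s\in C\setminus\{u\},\ 0\le j\le k\}\cup\{u^{k+1}\}.$$ Canonical recovery and T-complexity: let $w\in\mathcal A^+$. Start with $C_0=\mathcal A$ and factor $w$ over $C_0$ (into letters). Whenever the current factorization of $w$ into codewords of the current code $C$ has at least two factors, let $s$ be its final factor and $u$ the factor immediately to the left of $s$. Let $k\ge1$ be maximal such that the factorization ends with the block of factors $u,\dots,u,s$ with $k$ copies of $u$ before $s$ (when $s=u$, this means a terminal run of $k+1$ copies of $u$). Record the pair $(u,k)$, replace $C$ by $C[u,k]$, and refactor the unchanged word $w$ over the new code. Stop when the factorization consists of one codeword. If the recorded pairs are, in order, $((u_1,k_1),\ldots,(u_m,k_m))$, then $$c_{\mathrm T}(w):=\sum_{i=1}^m\log_2(k_i+1).$$ *)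

theory Defs
  imports "HOL-Probability.Probability"
begin

section \<open>Words and T-augmentation\<close>

definition word_power :: "'a list \<Rightarrow> nat \<Rightarrow> 'a list" where
  "word_power u j = concat (replicate j u)"

definition T_augment :: "'a list set \<Rightarrow> 'a list \<Rightarrow> nat \<Rightarrow> 'a list set" where
  "T_augment C u k =
     {word_power u j @ s | j s. s \<in> C - {u} \<and> j \<le> k} \<union> {word_power u (k + 1)}"

definition letters :: "'a list set" where
  "letters = range (\<lambda>a. [a])"

definition factorization :: "'a list set \<Rightarrow> 'a list \<Rightarrow> 'a list list \<Rightarrow> bool" where
  "factorization C w fs \<longleftrightarrow> set fs \<subseteq> C \<and> concat fs = w"


section \<open>Canonical recovery and T-complexity\<close>

text \<open>\<open>recovery w C ps\<close>: started from the code \<open>C\<close>, the procedure applied to the fixed word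
  \<open>w\<close> terminates and records the list of pairs \<open>ps\<close>. For nonempty \<open>w\<close> and \<open>C =\<close> \<^const>\<open>letters\<close>
  there is exactly one such list (\<open>recovery_exists_unique\<close> below), so the description operator
  in \<open>canonical_recovery\<close> is well defined; its value at the empty word is irrelevant.\<close>

inductive recovery :: "'a list \<Rightarrow> 'a list set \<Rightarrow> ('a list \<times> nat) list \<Rightarrow> bool"
  for w :: "'a list" where
  stop: "factorization C w [c] \<Longrightarrow> recovery w C []"
| step: "factorization C w fs \<Longrightarrow> fs = pre @ replicate k u @ [s] \<Longrightarrow> k \<ge> 1 \<Longrightarrow>
         (\<And>pre' k'. fs = pre' @ replicate k' u @ [s] \<Longrightarrow> k' \<le> k) \<Longrightarrow>
         recovery w (T_augment C u k) ps \<Longrightarrow> recovery w C ((u, k) # ps)"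

definition canonical_recovery :: "'a list \<Rightarrow> ('a list \<times> nat) list" where
  "canonical_recovery w = (THE ps. recovery w letters ps)"

definition T_complexity :: "'a list \<Rightarrow> real" where
  "T_complexity w = (\<Sum>(u, k)\<leftarrow>canonical_recovery w. log 2 (real k + 1))"


section \<open>Well-definedness of the canonical recovery\<close>

definition prefix_code :: "'a list set \<Rightarrow> bool" where
  "prefix_code C \<longleftrightarrow> [] \<notin> C \<and> (\<forall>x\<in>C. \<forall>y\<in>C. \<forall>v. y = x @ v \<longrightarrow> y = x)"

lemma prefix_codeD:
  assumes "prefix_code C" "x \<in> C" "y \<in> C" "x @ a = y @ b"
  shows "x = y"
proof -
  obtain v where "x = y @ v \<or> x @ v = y"
    using assms(4) by (auto simp: append_eq_append_conv2)
  then have "x = y @ v \<or> y = x @ v" by blast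
  then show ?thesis using assms(1-3) unfolding prefix_code_def by blast
qed

lemma prefix_code_nonempty: "prefix_code C \<Longrightarrow> x \<in> C \<Longrightarrow> x \<noteq> []"
  unfolding prefix_code_def by blast

lemma prefix_code_letters: "prefix_code letters"
  by (auto simp: prefix_code_def letters_def)

lemma factorization_unique:
  assumes "prefix_code C"
  shows "factorization C w fs \<Longrightarrow> factorization C w gs \<Longrightarrow> fs = gs"
proof (induction fs arbitrary: w gs)
  case Nil
  then show ?case using prefix_code_nonempty[OF assms]
    by (cases gs) (auto simp: factorization_def)
next
  case (Cons f fs)
  have "f \<noteq> []" using prefix_code_nonempty[OF assms] Cons.prems by (auto simp: factorization_def)
  then obtain g gs' where gs: "gs = g # gs'"
    using Cons.prems by (cases gs) (auto simp: factorization_def)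
  have "f = g"
    by (rule prefix_codeD[OF assms, of f g "concat fs" "concat gs'"])
      (use Cons.prems gs in \<open>auto simp: factorization_def\<close>)
  moreover have "fs = gs'"
    by (rule Cons.IH[of "concat fs"])
      (use Cons.prems gs calculation in \<open>auto simp: factorization_def\<close>)
  ultimately show ?case using gs by simp
qed

lemma word_power_Suc: "word_power u (Suc j) = u @ word_power u j"
  by (simp add: word_power_def)

lemma word_power_add: "word_power u (i + j) = word_power u i @ word_power u j"
  by (simp add: word_power_def replicate_add)

lemma prefix_code_T_augment:
  assumes C: "prefix_code C" and u: "u \<in> C"
  shows "prefix_code (T_augment C u k)"
proof -
  have ne: "u \<noteq> []" "\<And>s. s \<in> C \<Longrightarrow> s \<noteq> []" using C u unfolding prefix_code_def by blast+
  have A: False if "s \<in> C - {u}" "word_power u i @ s @ a = word_power u j @ b" "i < j"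
    for s i j a b
  proof -
    have "word_power u j = word_power u i @ u @ word_power u (j - i - 1)"
      using that(3) word_power_add[of u i "Suc (j - i - 1)"] by (simp add: word_power_Suc)
    then have "s @ a = u @ (word_power u (j - i - 1) @ b)" using that(2) by simp
    from prefix_codeD[OF C _ u this] that(1) show False by auto
  qed
  have "y = x" if x: "x \<in> T_augment C u k" and y: "y \<in> T_augment C u k" and v: "y = x @ v" for x y v
  proof (cases "x = word_power u (k + 1)")
    case True
    show ?thesis
    proof (rule ccontr)
      assume "y \<noteq> x"
      then obtain j s where j: "y = word_power u j @ s" "s \<in> C - {u}" "j \<le> k"
        using y True unfolding T_augment_def by auto
      show False by (rule A[OF j(2), of j "[]" "k+1" v]) (use j v True in auto)
    qed
  next
    case False
    then obtain i s where i: "x = word_power u i @ s" "s \<in> C - {u}" "i \<le> k"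
      using x unfolding T_augment_def by auto
    have y': "y \<noteq> word_power u (k + 1)"
    proof
      assume "y = word_power u (k + 1)"
      then show False using A[OF i(2), of i v "k+1" "[]"] i v by auto
    qed
    obtain j t where j: "y = word_power u j @ t" "t \<in> C - {u}" "j \<le> k"
      using y y' unfolding T_augment_def by auto
    have "\<not> i < j" using A[OF i(2), of i v j t] i j v by auto
    moreover have "\<not> j < i" using A[OF j(2), of j "[]" i "s @ v"] i j v by auto
    ultimately have "i = j" by simp
    then have "t @ [] = s @ v" using i j v by simp
    from prefix_codeD[OF C _ _ this] i j have "t = s" by blast
    then show ?thesis using i j \<open>i = j\<close> by simp
  qed
  moreover have "[] \<notin> T_augment C u k"
    using ne by (auto simp: T_augment_def word_power_Suc)
  ultimately show ?thesis unfolding prefix_code_def by blast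
qed

lemma refactor_blocks:
  assumes "u \<in> C"
  shows "set xs \<subseteq> C \<Longrightarrow> xs = [] \<or> last xs \<noteq> u \<Longrightarrow>
    \<exists>ys. set ys \<subseteq> T_augment C u k \<and> concat ys = concat xs \<and> length ys \<le> length xs"
proof (induction xs rule: length_induct)
  case (1 xs)
  show ?case
  proof (cases "xs = []")
    case True
    then show ?thesis by (intro exI[of _ "[]"]) auto
  next
    case False
    define n where "n = length (takeWhile (\<lambda>x. x = u) xs)"
    have tw: "takeWhile (\<lambda>x. x = u) xs = replicate n u"
      unfolding n_def by (rule sym, rule replicate_length_same) (auto dest: set_takeWhileD)
    have "dropWhile (\<lambda>x. x = u) xs \<noteq> []"
    proof
      assume "dropWhile (\<lambda>x. x = u) xs = []"
      then have "\<forall>x\<in>set xs. x = u" by (simp add: dropWhile_eq_Nil_conv)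
      then show False using False 1(3) last_in_set by blast
    qed
    then obtain t rest where t: "dropWhile (\<lambda>x. x = u) xs = t # rest"
      by (meson list.exhaust)
    have tu: "t \<noteq> u" using hd_dropWhile[of "\<lambda>x. x = u" xs] t by simp
    have xs: "xs = replicate n u @ t # rest"
      using takeWhile_dropWhile_id[of "\<lambda>x. x = u" xs] unfolding tw t by simp
    show ?thesis
    proof (cases "n \<le> k")
      case True
      have "length rest < length xs" "set rest \<subseteq> C" "rest = [] \<or> last rest \<noteq> u"
        using 1(2,3) xs by auto
      then obtain ys where ys: "set ys \<subseteq> T_augment C u k" "concat ys = concat rest"
        "length ys \<le> length rest"
        using 1(1) by blast
      have "word_power u n @ t \<in> T_augment C u k"
        using True tu 1(2) xs unfolding T_augment_def by auto
      then show ?thesis using ys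
        by (intro exI[of _ "(word_power u n @ t) # ys"]) (auto simp: xs word_power_def)
    next
      case False
      define rest' where "rest' = replicate (n - (k + 1)) u @ t # rest"
      have xs': "xs = replicate (k + 1) u @ rest'"
        using False unfolding xs rest'_def
        by (metis append_assoc le_add_diff_inverse not_less_eq_eq replicate_add Suc_eq_plus1)
      have "length rest' < length xs" "set rest' \<subseteq> C" "rest' = [] \<or> last rest' \<noteq> u"
        using 1(2,3) xs' rest'_def by (auto split: if_splits)
      then obtain ys where ys: "set ys \<subseteq> T_augment C u k" "concat ys = concat rest'"
        "length ys \<le> length rest'"
        using 1(1) by blast
      have "word_power u (k + 1) \<in> T_augment C u k" by (simp add: T_augment_def)
      moreover have "concat xs = word_power u (k + 1) @ concat rest'"
        unfolding xs' word_power_def by simp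
      ultimately show ?thesis using ys xs'
        by (intro exI[of _ "word_power u (k + 1) # ys"]) auto
    qed
  qed
qed

lemma refactor:
  assumes f: "factorization C w fs" and fs: "fs = pre @ replicate k u @ [s]" and k: "k \<ge> 1"
    and mx: "\<And>pre' k'. fs = pre' @ replicate k' u @ [s] \<Longrightarrow> k' \<le> k"
  obtains gs where "factorization (T_augment C u k) w gs" "gs \<noteq> []" "length gs < length fs"
proof -
  have uC: "u \<in> C" and pC: "set pre \<subseteq> C" and sC: "s \<in> C"
    using f k unfolding factorization_def fs by auto
  have "pre = [] \<or> last pre \<noteq> u"
  proof (rule ccontr)
    assume "\<not> ?thesis"
    then have "pre = butlast pre @ [u]" by (metis append_butlast_last_id)
    then have "fs = butlast pre @ replicate (Suc k) u @ [s]"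
      unfolding fs by (metis append_Cons append_Nil append_assoc replicate_Suc)
    from mx[OF this] show False by simp
  qed
  then obtain ys where ys: "set ys \<subseteq> T_augment C u k" "concat ys = concat pre"
    "length ys \<le> length pre"
    using refactor_blocks[OF uC pC] by blast
  have "word_power u k @ s \<in> T_augment C u k"
  proof (cases "s = u")
    case True
    then have "word_power u k @ s = word_power u (k + 1)"
      unfolding word_power_add by (simp add: word_power_def)
    then show ?thesis by (simp add: T_augment_def)
  next
    case False
    then show ?thesis using sC unfolding T_augment_def by auto
  qed
  then have "factorization (T_augment C u k) w (ys @ [word_power u k @ s])"
    using ys f unfolding factorization_def fs by (auto simp: word_power_def)
  then show ?thesis using that ys k fs by force
qed

lemma terminal_block:
  assumes "length fs \<ge> 2"
  obtains pre k u s where "fs = pre @ replicate k u @ [s]" "k \<ge> 1"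
    "\<And>pre' k'. fs = pre' @ replicate k' u @ [s] \<Longrightarrow> k' \<le> k"
proof -
  obtain xs s where 1: "fs = xs @ [s]" using assms by (cases fs rule: rev_cases) auto
  obtain pre u where 2: "xs = pre @ [u]" using 1 assms by (cases xs rule: rev_cases) auto
  define Q where "Q k \<longleftrightarrow> (\<exists>pre'. fs = pre' @ replicate k u @ [s])" for k
  have Q1: "Q 1" unfolding Q_def using 1 2 by auto
  have bd: "\<And>k. Q k \<Longrightarrow> k \<le> length fs" unfolding Q_def by auto
  have "Q (Greatest Q)" by (rule GreatestI_nat[of Q, OF Q1 bd])
  moreover have mx: "\<And>k. Q k \<Longrightarrow> k \<le> Greatest Q" by (rule Greatest_le_nat[of Q, OF _ bd])
  ultimately show ?thesis using that[of _ "Greatest Q" u s] mx[OF Q1] unfolding Q_def by blast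
qed

lemma recovery_exists:
  "factorization C w fs \<Longrightarrow> fs \<noteq> [] \<Longrightarrow> \<exists>ps. recovery w C ps"
proof (induction "length fs" arbitrary: C fs rule: less_induct)
  case less
  show ?case
  proof (cases "length fs \<ge> 2")
    case False
    then obtain c where "fs = [c]" using less.prems(2)
      by (cases fs; cases "tl fs") auto
    then show ?thesis using less.prems recovery.stop by blast
  next
    case True
    then obtain pre k u s where b: "fs = pre @ replicate k u @ [s]" "k \<ge> 1"
      "\<And>pre' k'. fs = pre' @ replicate k' u @ [s] \<Longrightarrow> k' \<le> k"
      by (rule terminal_block) blast
    obtain gs where "factorization (T_augment C u k) w gs" "gs \<noteq> []" "length gs < length fs"
      by (rule refactor[OF less.prems(1) b])
    then obtain ps where "recovery w (T_augment C u k) ps" using less.hyps by blast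
    with b have "recovery w C ((u, k) # ps)"
      by (intro recovery.step[OF less.prems(1) b(1,2)])
    then show ?thesis by blast
  qed
qed

lemma recovery_unique:
  "recovery w C ps \<Longrightarrow> prefix_code C \<Longrightarrow> recovery w C qs \<Longrightarrow> ps = qs"
proof (induction arbitrary: qs rule: recovery.induct)
  case (stop C c)
  from stop(3) show ?case
  proof cases
    case (step fs pre k u s ps)
    then have "fs = [c]" using factorization_unique stop by blast
    then show ?thesis using step by (cases pre) auto
  qed auto
next
  case (step C fs pre k u s ps)
  from step.prems(2) show ?case
  proof cases
    case (stop c)
    then have "fs = [c]" using factorization_unique step by blast
    then show ?thesis using step by (cases pre) auto
  next
    case (step fs' pre' k' u' s' ps')
    have eq: "fs' = fs" using factorization_unique step.prems(1) step.hyps(1) step by blast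
    have "s' = s" using step.hyps(2) step eq by auto
    have "last (butlast fs) = u"
      using step.hyps(2,3) by (auto simp: butlast_append last_append)
    moreover have "last (butlast fs) = u'"
      using step(3,4) eq by (auto simp: butlast_append last_append)
    ultimately have "u' = u" by simp
    have "k' = k" using step.hyps(2,4) step(3,5) eq \<open>s' = s\<close> \<open>u' = u\<close> by (metis le_antisym)
    have "u \<in> C" using step.hyps(1,2,3) by (auto simp: factorization_def)
    then have "prefix_code (T_augment C u k)" using step.prems(1) prefix_code_T_augment by blast
    then have "ps = ps'" using step.IH step(6) \<open>u' = u\<close> \<open>k' = k\<close> by blast
    then show ?thesis using step(1) \<open>u' = u\<close> \<open>k' = k\<close> by simp
  qed
qed

theorem recovery_exists_unique:
  assumes "w \<noteq> []"
  shows "\<exists>!ps. recovery w letters ps"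
proof -
  have "factorization letters w (map (\<lambda>a. [a]) w)"
    by (auto simp: factorization_def letters_def)
  then show ?thesis
    using assms recovery_exists recovery_unique[OF _ prefix_code_letters] by blast
qed


section \<open>Entropy and modes of convergence\<close>

definition source_entropy :: "('a::finite \<Rightarrow> real) \<Rightarrow> real" where
  "source_entropy p = - (\<Sum>a\<in>UNIV. p a * ln (p a))"

definition source_entropy2 :: "('a::finite \<Rightarrow> real) \<Rightarrow> real" where
  "source_entropy2 p = source_entropy p / ln 2"

text \<open>The limits below are constants, so the \<open>N\<close>-th random variable may live on its own
  probability space \<open>P N\<close>.\<close>

definition converges_in_probability ::
    "(nat \<Rightarrow> 'w measure) \<Rightarrow> (nat \<Rightarrow> 'w \<Rightarrow> real) \<Rightarrow> real \<Rightarrow> bool" where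
  "converges_in_probability P X l \<longleftrightarrow>
     (\<forall>N. X N \<in> borel_measurable (P N)) \<and>
     (\<forall>\<epsilon>>0. (\<lambda>N. measure (P N) {\<omega> \<in> space (P N). \<bar>X N \<omega> - l\<bar> > \<epsilon>}) \<longlonglongrightarrow> 0)"

text \<open>Integrability is required explicitly because the Bochner integral of a non-integrable
  function is 0.\<close>

definition converges_in_Lr ::
    "(nat \<Rightarrow> 'w measure) \<Rightarrow> (nat \<Rightarrow> 'w \<Rightarrow> real) \<Rightarrow> real \<Rightarrow> real \<Rightarrow> bool" where
  "converges_in_Lr P X l r \<longleftrightarrow>
     (\<forall>N. X N \<in> borel_measurable (P N)) \<and>
     (\<forall>N. integrable (P N) (\<lambda>\<omega>. \<bar>X N \<omega> - l\<bar> powr r)) \<and>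
     (\<lambda>N. integral\<^sup>L (P N) (\<lambda>\<omega>. \<bar>X N \<omega> - l\<bar> powr r)) \<longlonglongrightarrow> 0"

end

theory Submission
  imports Defs "HOL-Real_Asymp.Real_Asymp"
begin

text \<open>Replacing a prefix code \<open>C\<close> by \<open>C[u,k]\<close> multiplies \<open>1 - \<Sum>c\<in>C. x(c)\<close> by
  \<open>1 + x(u) + \<dots> + x(u)\<^sup>k\<close> for every multiplicative weight \<open>x\<close>. With \<open>x(c) = p(c) z\<^bsup>|c|\<^esup>\<close> this makes
  the mean codeword length after any sequence of augmentations a product \<open>D\<close> over the eliminated words,
  and comparing coefficients of logarithmic derivatives in \<open>z\<close> gives a Mertens-type formula:
  the eliminated words of length up to \<open>L\<close> contribute at most \<open>1 + 1/2 + \<dots> + 1/L\<close> to \<open>ln D\<close>, and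
  nearly that much as soon as no codeword has probability well above \<open>exp(-h L)\<close>.
  Longer words contribute little, since \<open>N\<close> distinct words have been eliminated at most.
  Hence \<open>D \<approx> e\<^sup>\<gamma> ln N / h\<close>, where the upper bound holds for every path.

  The recorded pairs determine the word, and its probability is the weight of its path up to the
  factor \<open>D\<close> and bounded corrections. Exponential tilting by \<open>z = exp(\<plusminus>\<eta> / ln N)\<close>, for which the
  normalising constants of the steps are \<open>1 - (1 - z) D\<close>, therefore bounds the number of steps from
  both sides by \<open>N / D\<close>. Pairs with \<open>k > 1\<close> are too rare to matter, and a deterministic bound of
  order \<open>N / ln N\<close> upgrades convergence in probability to convergence in \<open>L\<^sup>r\<close>.\<close>

section \<open>Multiplicative weights on words\<close>

text \<open>The path of a random word has no tractable law: each elimination depends on the word as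
  read from its right end, and the code keeps changing. The proof never describes that law. It
  compares each word with a path weight whose sum over all paths of the same total length is at most
  one, so every estimate holds path by path. Tilting is free of charge up to an explicit factor,
  because that total length is fixed at N - 1. The scale \<eta> / ln N of the tilt keeps z^n bounded
  for lengths n of order ln N, while z^N still beats every power of N.

  The constant e^\<gamma> stems from the truncation length: words of probability about 1/N have
  length about ln N / h, and the harmonic sum up to L is ln L + \<gamma> + o(1).

  A lower bound for D cannot hold on every path; the empty path has D = 1. The upper bound for the
  complexity must therefore discard words whose paths keep a heavy codeword for long. The waiting
  time N^(1 - e/2) is long compared with 1 / p(c) for codewords c heavier than N^(-1 + e), and short
  compared with N / ln N.\<close>

definition wt :: "('a \<Rightarrow> 'r::comm_monoid_mult) \<Rightarrow> 'a list \<Rightarrow> 'r" where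
  "wt y w = prod_list (map y w)"

lemma wt_simps [simp]:
  "wt y [] = 1" "wt y (a # w) = y a * wt y w" "wt y (v @ w) = wt y v * wt y w"
  by (simp_all add: wt_def)

lemma wt_word_power [simp]: "wt y (word_power u k) = wt y u ^ k"
  by (induction k) (simp_all add: word_power_Suc, simp add: word_power_def)

lemma length_word_power [simp]: "length (word_power u k) = k * length u"
  by (induction k) (simp_all add: word_power_Suc, simp add: word_power_def)

lemma sum_wt_length:
  fixes y :: "'a::finite \<Rightarrow> 'r::comm_semiring_1"
  shows "(\<Sum>w | length w = n. wt y w) = (\<Sum>a\<in>UNIV. y a) ^ n"
proof (induction n)
  case (Suc n)
  have "bij_betw (\<lambda>(a, w). a # w) (UNIV \<times> {w. length w = n}) {w::'a list. length w = Suc n}"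
    by (rule bij_betwI[where g = "\<lambda>w. (hd w, tl w)"]) (auto simp: length_Suc_conv)
  then have "(\<Sum>w | length w = Suc n. wt y w)
      = (\<Sum>(a, w)\<in>UNIV \<times> {w. length w = n}. wt y (a # w))"
    by (simp add: sum.reindex_bij_betw[symmetric] case_prod_unfold)
  also have "\<dots> = (\<Sum>a\<in>UNIV. y a) * (\<Sum>w | length w = n. wt y w)"
    by (simp add: sum_product sum.cartesian_product)
  finally show ?case using Suc by simp
qed simp

lemma finite_words_length [simp]: "finite {w :: 'a::finite list. length w = n}"
  using finite_lists_length_eq[of "UNIV :: 'a set" n] by simp

section \<open>Codes along a path of T-augmentations\<close>

definition geo :: "'r::comm_semiring_1 \<Rightarrow> nat \<Rightarrow> 'r" where
  "geo x k = (\<Sum>j\<le>k. x ^ j)"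

text \<open>If i < j, cancelling u^i leaves s against a word that starts with u, and the prefix
  property gives s = u, which is excluded. Hence sums over the words u^j s factor.\<close>

lemma word_power_append_inj:
  assumes C: "prefix_code C" "u \<in> C" "s \<in> C - {u}" "t \<in> C - {u}"
    and eq: "word_power u i @ s = word_power u j @ t"
  shows "i = j \<and> s = t"
proof -
  have A: False if "s \<in> C - {u}" "i < j" "word_power u i @ s = word_power u j @ t" for i j s t
  proof -
    have "word_power u j = word_power u i @ u @ word_power u (j - i - 1)"
      using that(2) word_power_add[of u i "Suc (j - i - 1)"] by (simp add: word_power_Suc)
    then have "s @ [] = u @ (word_power u (j - i - 1) @ t)" using that(3) by simp
    from prefix_codeD[OF C(1) _ C(2) this] that(1) show False by auto
  qed
  have "i = j"
    using A[of s i j t] A[of t j i s] C(3,4) eq by (metis linorder_neqE_nat)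
  then show ?thesis using eq by simp
qed

lemma word_power_append_neq:
  assumes C: "prefix_code C" "u \<in> C" "s \<in> C - {u}" and "j \<le> k"
  shows "word_power u j @ s \<noteq> word_power u (k + 1)"
proof
  assume eq: "word_power u j @ s = word_power u (k + 1)"
  have "word_power u (k + 1) = word_power u j @ u @ word_power u (k - j)"
    using assms(4) word_power_add[of u j "Suc (k - j)"] by (simp add: word_power_Suc)
  then have "s @ [] = u @ word_power u (k - j)" using eq by simp
  from prefix_codeD[OF C(1) _ C(2) this] C(3) show False by auto
qed

lemma T_augment_eq_image:
  "T_augment C u k = (\<lambda>(j, s). word_power u j @ s) ` ({..k} \<times> (C - {u})) \<union> {word_power u (k + 1)}"
  by (auto simp: T_augment_def)

lemma finite_T_augment: "finite C \<Longrightarrow> finite (T_augment C u k)"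
  by (simp add: T_augment_eq_image)

text \<open>With F the weight of C and x that of u, the new weight is \<open>geo x k\<close> times F
  - x, plus x^(k+1); the identity (1 - x) \<open>geo x k\<close> = 1 - x^(k+1) rearranges this into
  a product. Values lie in a general commutative ring because the identity is applied both to real
  weights and to power series.\<close>

lemma sum_T_augment:
  fixes y :: "'a \<Rightarrow> 'r::comm_ring_1"
  assumes C: "finite C" "prefix_code C" "u \<in> C"
  shows "1 - (\<Sum>c\<in>T_augment C u k. wt y c) = (1 - (\<Sum>c\<in>C. wt y c)) * geo (wt y u) k"
proof -
  let ?f = "\<lambda>(j, s). word_power u j @ s" and ?x = "wt y u"
  have inj: "inj_on ?f ({..k} \<times> (C - {u}))"
    using word_power_append_inj[OF C(2,3)] by (intro inj_onI) auto
  have notin: "word_power u (k + 1) \<notin> ?f ` ({..k} \<times> (C - {u}))"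
  proof
    assume "word_power u (k + 1) \<in> ?f ` ({..k} \<times> (C - {u}))"
    then obtain j s where "word_power u (k + 1) = word_power u j @ s" "j \<le> k" "s \<in> C - {u}" by auto
    then show False using word_power_append_neq[OF C(2,3), of s j k] by simp
  qed
  have "(\<Sum>c\<in>T_augment C u k. wt y c) = (\<Sum>c\<in>?f ` ({..k} \<times> (C - {u})). wt y c) + ?x ^ (k + 1)"
    unfolding T_augment_eq_image using C(1) notin by (subst sum.union_disjoint) auto
  also have "(\<Sum>c\<in>?f ` ({..k} \<times> (C - {u})). wt y c) = (\<Sum>j\<le>k. \<Sum>s\<in>C - {u}. ?x ^ j * wt y s)"
    by (subst sum.reindex[OF inj]) (simp add: sum.cartesian_product case_prod_unfold o_def)
  also have "\<dots> = geo ?x k * ((\<Sum>c\<in>C. wt y c) - ?x)"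
    using C by (simp add: sum_distrib_left[symmetric] sum_distrib_right[symmetric] geo_def sum_diff1)
  finally have *: "(\<Sum>c\<in>T_augment C u k. wt y c)
      = geo ?x k * ((\<Sum>c\<in>C. wt y c) - ?x) + ?x ^ (k + 1)" .
  have "(1 - ?x) * geo ?x k = 1 - ?x ^ Suc k"
    unfolding geo_def by (rule sum_gp_basic)
  then show ?thesis unfolding * by (simp add: algebra_simps)
qed

fun code_after :: "'a list set \<Rightarrow> ('a list \<times> nat) list \<Rightarrow> 'a list set" where
  "code_after C [] = C"
| "code_after C ((u, k) # ps) = code_after (T_augment C u k) ps"

text \<open>What is kept of the recovery: any codeword may be eliminated, with any positive
  exponent. No word is involved and maximality of the exponent is dropped, so paths form a tree over
  which weights can be summed.\<close>

fun aug_path :: "'a list set \<Rightarrow> ('a list \<times> nat) list \<Rightarrow> bool" where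
  "aug_path C [] = True"
| "aug_path C ((u, k) # ps) = (u \<in> C \<and> k \<ge> 1 \<and> aug_path (T_augment C u k) ps)"

definition path_length :: "('a list \<times> nat) list \<Rightarrow> nat" where
  "path_length ps = (\<Sum>(u, k)\<leftarrow>ps. k * length u)"

lemma path_length_simps [simp]:
  "path_length [] = 0" "path_length ((u, k) # ps) = k * length u + path_length ps"
  by (simp_all add: path_length_def)

definition fin_code :: "'a list set \<Rightarrow> bool" where
  "fin_code C \<longleftrightarrow> finite C \<and> prefix_code C"

lemma fin_code_letters: "fin_code (letters :: 'a::finite list set)"
  unfolding fin_code_def using prefix_code_letters by (auto simp: letters_def)

lemma fin_code_T_augment: "fin_code C \<Longrightarrow> u \<in> C \<Longrightarrow> fin_code (T_augment C u k)"
  by (simp add: fin_code_def finite_T_augment prefix_code_T_augment)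

lemma fin_code_nonempty: "fin_code C \<Longrightarrow> c \<in> C \<Longrightarrow> c \<noteq> []"
  by (auto simp: fin_code_def prefix_code_def)

lemma code_after_append: "code_after C (ps @ qs) = code_after (code_after C ps) qs"
  by (induction ps arbitrary: C) auto

lemma aug_path_append:
  "aug_path C (ps @ qs) \<longleftrightarrow> aug_path C ps \<and> aug_path (code_after C ps) qs"
  by (induction ps arbitrary: C) auto

lemma fin_code_code_after: "fin_code C \<Longrightarrow> aug_path C ps \<Longrightarrow> fin_code (code_after C ps)"
  by (induction ps arbitrary: C) (auto simp: fin_code_T_augment)

lemma aug_path_take: "aug_path C ps \<Longrightarrow> aug_path C (take t ps)"
  by (metis append_take_drop_id aug_path_append)

lemma aug_path_nth:
  assumes "aug_path C ps" "t < length ps"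
  shows "fst (ps ! t) \<in> code_after C (take t ps)" "snd (ps ! t) \<ge> 1"
    "code_after C (take (Suc t) ps) = T_augment (code_after C (take t ps)) (fst (ps ! t)) (snd (ps ! t))"
proof -
  have "ps = take t ps @ (fst (ps ! t), snd (ps ! t)) # drop (Suc t) ps"
    using assms(2) by (simp add: Cons_nth_drop_Suc)
  then have "aug_path C (take t ps @ (fst (ps ! t), snd (ps ! t)) # drop (Suc t) ps)"
    using assms(1) by metis
  then show "fst (ps ! t) \<in> code_after C (take t ps)" "snd (ps ! t) \<ge> 1"
    unfolding aug_path_append aug_path.simps by blast+
  have "take (Suc t) ps = take t ps @ [(fst (ps ! t), snd (ps ! t))]"
    using assms(2) by (simp add: take_Suc_conv_app_nth)
  then show "code_after C (take (Suc t) ps)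
      = T_augment (code_after C (take t ps)) (fst (ps ! t)) (snd (ps ! t))"
    by (simp only: code_after_append code_after.simps)
qed

lemma sum_code_after:
  fixes y :: "'a \<Rightarrow> 'r::comm_ring_1"
  assumes "fin_code C" "aug_path C ps"
  shows "1 - (\<Sum>c\<in>code_after C ps. wt y c)
    = (1 - (\<Sum>c\<in>C. wt y c)) * (\<Prod>t<length ps. geo (wt y (fst (ps ! t))) (snd (ps ! t)))"
  using assms
proof (induction ps arbitrary: C)
  case (Cons q ps)
  obtain u k where q: "q = (u, k)" by force
  have "fin_code (T_augment C u k)" using Cons.prems by (auto simp: q fin_code_T_augment)
  then show ?case
    using Cons.prems Cons.IH[of "T_augment C u k"] sum_T_augment[of C u y k]
    by (auto simp: q fin_code_def prod.lessThan_Suc_shift simp del: prod.lessThan_Suc)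
qed simp

lemma sum_letters: "(\<Sum>c\<in>letters. wt y c) = (\<Sum>a\<in>UNIV. y a)"
  unfolding letters_def by (subst sum.reindex) (auto simp: inj_on_def)

text \<open>This property of an eliminated codeword persists, so the codeword never returns.\<close>

definition starts_off :: "'a list \<Rightarrow> 'a list set \<Rightarrow> bool" where
  "starts_off u C \<longleftrightarrow> (\<forall>c\<in>C. \<forall>v. u \<noteq> c @ v)"

text \<open>A new codeword is either an old one other than u, which cannot be a prefix of u in a
  prefix code, or strictly longer than u.\<close>

lemma starts_off_T_augment_eliminated:
  assumes "fin_code C" "u \<in> C" "k \<ge> 1"
  shows "starts_off u (T_augment C u k)"
  unfolding starts_off_def
proof (intro ballI allI notI)
  fix c v assume c: "c \<in> T_augment C u k" and eq: "u = c @ v"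
  note ne = fin_code_nonempty[OF assms(1)]
  from c consider j s where "c = word_power u j @ s" "s \<in> C - {u}" | "c = word_power u (k + 1)"
    by (auto simp: T_augment_def)
  then show False
  proof cases
    case 1
    show False
    proof (cases j)
      case 0
      then have "u @ [] = s @ v" using 1 eq by (simp add: word_power_def)
      then show False using prefix_codeD[of C u s "[]" v] 1 assms by (auto simp: fin_code_def)
    next
      case (Suc i)
      then have "length u \<ge> length u + length s"
        using 1 arg_cong[OF eq, of length] by simp
      then show False using ne[of s] 1 by simp
    qed
  next
    case 2
    then have "length u \<ge> (k + 1) * length u" using arg_cong[OF eq, of length] by simp
    then show False using ne[OF assms(2)] assms(3) by simp
  qed
qed

text \<open>Every codeword of C[u,k] has a codeword of C as a prefix, so a new codeword that is a
  prefix of v would yield an old one.\<close>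

lemma starts_off_T_augment: 
  assumes "starts_off v C" "u \<in> C"
  shows "starts_off v (T_augment C u k)"
proof -
  have "\<exists>a\<in>C. \<exists>b. c = a @ b" if c: "c \<in> T_augment C u k" for c
  proof -
    from c consider j s where "c = word_power u j @ s" "s \<in> C - {u}" | "c = word_power u (k + 1)"
      by (auto simp: T_augment_def)
    then show ?thesis
    proof cases
      case 1
      then show ?thesis using assms(2)
        by (cases j) (auto simp: word_power_Suc, auto simp: word_power_def)
    next
      case 2
      then show ?thesis using assms(2) by (auto simp: word_power_Suc)
    qed
  qed
  then show ?thesis using assms(1) unfolding starts_off_def by (metis append.assoc)
qed

text \<open>The second conjunct strengthens the induction: it is applied to u and the code right
  after the elimination of u.\<close>

lemma distinct_path_words_aux:
  assumes "fin_code C" "aug_path C ps"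
  shows "distinct (map fst ps) \<and> (\<forall>v. starts_off v C \<longrightarrow> v \<notin> fst ` set ps)"
  using assms
proof (induction ps arbitrary: C)
  case (Cons q ps)
  obtain u k where q: "q = (u, k)" by force
  have C: "u \<in> C" "k \<ge> 1" "aug_path (T_augment C u k) ps" using Cons.prems by (auto simp: q)
  have IH: "distinct (map fst ps)"
    "\<And>v. starts_off v (T_augment C u k) \<Longrightarrow> v \<notin> fst ` set ps"
    using Cons.IH[of "T_augment C u k"] C Cons.prems(1) fin_code_T_augment by blast+
  have "u \<notin> fst ` set ps"
    using IH(2) starts_off_T_augment_eliminated[OF Cons.prems(1) C(1,2)] by blast
  moreover have "v \<noteq> u" "v \<notin> fst ` set ps" if "starts_off v C" for v
    using that C(1) IH(2) starts_off_T_augment[OF that C(1)] by (auto simp: starts_off_def)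
  ultimately show ?case using IH(1) by (auto simp: q)
qed simp

lemma inj_on_path_words:
  assumes "fin_code C" "aug_path C ps"
  shows "inj_on (\<lambda>t. fst (ps ! t)) {..<length ps}"
  using distinct_path_words_aux[OF assms] inj_on_nth[of "map fst ps" "{..<length ps}"]
  by (auto simp: inj_on_def)

lemma path_words_nonempty:
  assumes "fin_code C" "aug_path C ps" "t < length ps"
  shows "fst (ps ! t) \<noteq> []"
  using fin_code_nonempty[OF fin_code_code_after[OF assms(1) aug_path_take[OF assms(2)]]]
    aug_path_nth(1)[OF assms(2,3)] by blast

section \<open>The path of a word\<close>

text \<open>Recovery consumes the word from its right end, so the pair recorded first contributes
  the rightmost block.\<close>

fun path_word :: "('a list \<times> nat) list \<Rightarrow> 'a list" where
  "path_word [] = []"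
| "path_word ((u, k) # ps) = path_word ps @ word_power u k"

lemma length_path_word: "length (path_word ps) = path_length ps"
  by (induction ps rule: path_word.induct) auto

lemma wt_path_word:
  "wt y (path_word ps) = (\<Prod>t<length ps. wt y (fst (ps ! t)) ^ snd (ps ! t))"
  by (induction ps rule: path_word.induct)
     (auto simp: prod.lessThan_Suc_shift mult.commute simp del: prod.lessThan_Suc)

text \<open>A step turns the final factor s into u^k s. Unwinding this writes w as the blocks u^k,
  the latest one leftmost, followed by the final factor of the initial factorization.\<close>

lemma recovery_path:
  assumes "recovery w C ps"
  shows "prefix_code C \<Longrightarrow> factorization C w fs \<Longrightarrow> aug_path C ps \<and> w = path_word ps @ last fs"
  using assms
proof (induction arbitrary: fs rule: recovery.induct)
  case (stop C c)
  then have "fs = [c]" using factorization_unique by blast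
  then show ?case using stop by (auto simp: factorization_def)
next
  case (step C fs' pre k u s ps)
  have fs: "fs = pre @ replicate k u @ [s]"
    using factorization_unique[OF step.prems(1) step.prems(2) step.hyps(1)] step.hyps(2) by simp
  have uC: "u \<in> C" and pC: "set pre \<subseteq> C" and sC: "s \<in> C"
    using step.hyps(1-3) unfolding factorization_def by auto
  have "pre = [] \<or> last pre \<noteq> u"
  proof (rule ccontr)
    assume "\<not> ?thesis"
    then have "pre = butlast pre @ [u]" by (metis append_butlast_last_id)
    then have "fs' = butlast pre @ replicate (Suc k) u @ [s]"
      unfolding step.hyps(2) by (metis append_Cons append_Nil append_assoc replicate_Suc)
    from step.hyps(4)[OF this] show False by simp
  qed
  then obtain ys where ys: "set ys \<subseteq> T_augment C u k" "concat ys = concat pre"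
    using refactor_blocks[OF uC pC] by blast
  have "word_power u k @ s \<in> T_augment C u k"
  proof (cases "s = u")
    case True
    then have "word_power u k @ s = word_power u (k + 1)"
      unfolding word_power_add by (simp add: word_power_def)
    then show ?thesis by (simp add: T_augment_def)
  next
    case False
    then show ?thesis using sC unfolding T_augment_def by auto
  qed
  then have "factorization (T_augment C u k) w (ys @ [word_power u k @ s])"
    using ys step.hyps(1,2) unfolding factorization_def by (auto simp: word_power_def)
  from step.IH[OF prefix_code_T_augment[OF step.prems(1) uC] this]
  show ?case using uC step.hyps(3) by (auto simp: fs)
qed

lemma canonical_recovery_path:
  assumes "w \<noteq> []"
  shows "aug_path letters (canonical_recovery w)"
    "w = path_word (canonical_recovery w) @ [last w]"
proof -
  have r: "recovery w letters (canonical_recovery w)"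
    unfolding canonical_recovery_def by (rule theI'[OF recovery_exists_unique[OF assms]])
  have "factorization letters w (map (\<lambda>a. [a]) w)"
    by (auto simp: factorization_def letters_def)
  from recovery_path[OF r prefix_code_letters this]
  show "aug_path letters (canonical_recovery w)"
    "w = path_word (canonical_recovery w) @ [last w]"
    using assms by (simp_all add: last_map)
qed

section \<open>Summing step weights over paths\<close>

text \<open>The step weight may depend on the time i, which allows weights to be altered only inside
  a window of steps, as in \<open>sum_words_survives\<close>.\<close>

definition path_wt ::
    "(nat \<Rightarrow> 'a list set \<Rightarrow> 'a list \<Rightarrow> nat \<Rightarrow> real) \<Rightarrow> nat \<Rightarrow> 'a list set \<Rightarrow> ('a list \<times> nat) list \<Rightarrow> real" where
  "path_wt q i C ps =
     (\<Prod>t<length ps. q (i + t) (code_after C (take t ps)) (fst (ps ! t)) (snd (ps ! t)))"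

lemma path_wt_Cons:
  "path_wt q i C ((u, k) # ps) = q i C u k * path_wt q (Suc i) (T_augment C u k) ps"
  by (simp add: path_wt_def prod.lessThan_Suc_shift del: prod.lessThan_Suc)

definition paths :: "'a list set \<Rightarrow> nat \<Rightarrow> ('a list \<times> nat) list set" where
  "paths C n = {ps. aug_path C ps \<and> path_length ps = n}"

lemma paths_0: "fin_code C \<Longrightarrow> paths C 0 = {[]}"
proof -
  assume C: "fin_code C"
  have "ps = []" if "aug_path C ps" "path_length ps = 0" for ps
    using that fin_code_nonempty[OF C] by (cases ps) auto
  then show ?thesis by (auto simp: paths_def)
qed

lemma paths_rec:
  assumes C: "fin_code C" and n: "n > 0"
  shows "paths C n = (\<Union>(u, k)\<in>{(u, k). u \<in> C \<and> k \<in> {1..n} \<and> k * length u \<le> n}.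
    (\<lambda>ps. (u, k) # ps) ` paths (T_augment C u k) (n - k * length u))" (is "_ = ?R")
proof
  show "paths C n \<subseteq> ?R"
  proof
    fix qs assume "qs \<in> paths C n"
    then obtain u k ps where qs: "qs = (u, k) # ps" "u \<in> C" "k \<ge> 1" "aug_path (T_augment C u k) ps"
      "k * length u + path_length ps = n"
      using n by (cases qs) (auto simp: paths_def)
    have "length u \<ge> 1" using fin_code_nonempty[OF C qs(2)] by (cases u) auto
    then have "k * 1 \<le> k * length u" by (intro mult_le_mono) auto
    then have "k \<le> n" "k * length u \<le> n" using qs(5) by linarith+
    then have "k \<in> {1..n}" using qs(3) by simp
    moreover have "ps \<in> paths (T_augment C u k) (n - k * length u)" using qs by (auto simp: paths_def)
    ultimately show "qs \<in> ?R" using qs(1,2) \<open>k * length u \<le> n\<close> by fastforce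
  qed
  show "?R \<subseteq> paths C n" by (auto simp: paths_def)
qed

text \<open>Paths of equal length form an antichain in the tree of all paths, which is why
  substochastic step weights give total weight at most one.\<close>

lemma sum_path_wt_le_1:
  assumes q0: "\<And>i C u k. q i C u k \<ge> 0"
    and q1: "\<And>i C K. I C \<Longrightarrow> (\<Sum>u\<in>C. \<Sum>k=1..K. q i C u k) \<le> 1"
    and I: "\<And>C u k. I C \<Longrightarrow> u \<in> C \<Longrightarrow> k \<ge> 1 \<Longrightarrow> I (T_augment C u k)"
    and I_fin: "\<And>C. I C \<Longrightarrow> fin_code C"
  shows "I C \<Longrightarrow> finite (paths C n) \<and> (\<Sum>ps\<in>paths C n. path_wt q i C ps) \<le> 1"
proof (induction n arbitrary: i C rule: less_induct)
  case (less n)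
  show ?case
  proof (cases "n = 0")
    case True
    then show ?thesis using paths_0[OF I_fin[OF less.prems]] by (simp add: path_wt_def)
  next
    case False
    define S where "S = {(u, k). u \<in> C \<and> k \<in> {1..n} \<and> k * length u \<le> n}"
    define T where "T uk = (case uk of (u, k) \<Rightarrow>
      (\<lambda>ps. (u, k) # ps) ` paths (T_augment C u k) (n - k * length u))" for uk
    note C = I_fin[OF less.prems]
    have S_sub: "S \<subseteq> C \<times> {1..n}" unfolding S_def by auto
    then have finS: "finite S" using C by (auto simp: fin_code_def intro: finite_subset)
    have eq: "paths C n = (\<Union>uk\<in>S. T uk)"
      unfolding T_def S_def using paths_rec[OF C] False by simp
    have IH: "finite (paths (T_augment C u k) (n - k * length u))"
      "(\<Sum>ps\<in>paths (T_augment C u k) (n - k * length u). path_wt q (Suc i) (T_augment C u k) ps) \<le> 1"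
      if "(u, k) \<in> S" for u k
    proof -
      have *: "u \<in> C" "k \<ge> 1" using that by (auto simp: S_def)
      have "k * length u > 0" using * fin_code_nonempty[OF C *(1)] by simp
      then have "n - k * length u < n" using False by simp
      from less.IH[OF this I[OF less.prems *]]
      show "finite (paths (T_augment C u k) (n - k * length u))"
        "(\<Sum>ps\<in>paths (T_augment C u k) (n - k * length u). path_wt q (Suc i) (T_augment C u k) ps) \<le> 1"
        by blast+
    qed
    have finT: "\<forall>uk\<in>S. finite (T uk)" using IH(1) by (auto simp: T_def)
    have disj: "\<forall>x\<in>S. \<forall>y\<in>S. x \<noteq> y \<longrightarrow> T x \<inter> T y = {}" by (auto simp: T_def)
    have "(\<Sum>ps\<in>paths C n. path_wt q i C ps) = (\<Sum>uk\<in>S. \<Sum>ps\<in>T uk. path_wt q i C ps)"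
      unfolding eq by (rule sum.UNION_disjoint[OF finS finT disj])
    also have "\<dots> \<le> (\<Sum>(u, k)\<in>S. q i C u k)"
    proof (rule sum_mono, clarify)
      fix u k assume uk: "(u, k) \<in> S"
      have "(\<Sum>ps\<in>T (u, k). path_wt q i C ps)
        = q i C u k * (\<Sum>ps\<in>paths (T_augment C u k) (n - k * length u). path_wt q (Suc i) (T_augment C u k) ps)"
        unfolding T_def by (simp add: sum.reindex path_wt_Cons sum_distrib_left)
      also have "\<dots> \<le> q i C u k * 1" using IH(2)[OF uk] q0 by (intro mult_left_mono)
      finally show "(\<Sum>ps\<in>T (u, k). path_wt q i C ps) \<le> q i C u k" by simp
    qed
    also have "\<dots> \<le> (\<Sum>(u, k)\<in>C \<times> {1..n}. q i C u k)"
      using S_sub C q0 by (intro sum_mono2) (auto simp: fin_code_def)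
    also have "\<dots> = (\<Sum>u\<in>C. \<Sum>k=1..n. q i C u k)"
      by (simp add: sum.cartesian_product)
    also have "\<dots> \<le> 1" by (rule q1[OF less.prems])
    finally show ?thesis using finS finT by (auto simp: eq)
  qed
qed

unbundle no vec_syntax
unbundle fps_syntax

section \<open>Logarithmic derivatives\<close>

text \<open>The series X G'/G. Its n-th coefficient is n times that of the formal ln G, so products
  become sums, and division by n later recovers the logarithm.\<close>

definition logderiv :: "real fps \<Rightarrow> real fps" where
  "logderiv G = fps_X * fps_deriv G * inverse G"

lemma logderiv_mult:
  assumes "G $ 0 \<noteq> 0" "H $ 0 \<noteq> 0"
  shows "logderiv (G * H) = logderiv G + logderiv H"
proof -
  have "G * inverse G = 1" "H * inverse H = 1"
    using assms by (simp_all add: inverse_mult_eq_1')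
  moreover have "logderiv (G * H) = fps_X * fps_deriv G * inverse G * (H * inverse H)
      + fps_X * fps_deriv H * inverse H * (G * inverse G)"
    unfolding logderiv_def by (simp add: fps_inverse_mult algebra_simps)
  ultimately show ?thesis by (simp add: logderiv_def)
qed

lemma logderiv_prod:
  assumes "finite A" "\<And>i. i \<in> A \<Longrightarrow> G i $ 0 = 1"
  shows "logderiv (\<Prod>i\<in>A. G i) = (\<Sum>i\<in>A. logderiv (G i))"
  using assms
proof (induction A rule: finite_induct)
  case (insert i A)
  have "(\<Prod>i\<in>A. G i) $ 0 = 1" using insert(1) insert(4)[OF insertI2]
    by (induction A rule: finite_induct) auto
  then show ?case using insert by (simp add: logderiv_mult)
qed (simp add: logderiv_def)

lemma fps_X_mult_deriv_monom:
  "fps_X * fps_deriv (fps_const c * fps_X ^ l) = fps_const (real l) * (fps_const c * fps_X ^ l)"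
proof (rule fps_ext)
  fix n show "(fps_X * fps_deriv (fps_const c * fps_X ^ l)) $ n
      = (fps_const (real l) * (fps_const c * fps_X ^ l)) $ n"
    by (cases n) (auto simp: fps_X_power_nth)
qed

lemma logderiv_1_minus_monom:
  assumes "l \<ge> 1" "n \<ge> 1"
  shows "logderiv (1 - fps_const c * fps_X ^ l) $ n
    = - (if l dvd n then real l * c ^ (n div l) else 0)"
proof -
  \<comment> \<open>The geometric series in c X^l, identified as the inverse of 1 - M through the
    recurrence of its coefficients.\<close>
  define S where "S = Abs_fps (\<lambda>n. if l dvd n then c ^ (n div l) else 0)"
  define M where "M = fps_const c * (fps_X :: real fps) ^ l"
  have MS: "(M * S) $ m = (if m < l then 0 else c * S $ (m - l))" for m
    unfolding M_def by (simp add: mult.assoc fps_X_power_mult_nth)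
  have rec: "(M * S) $ m = S $ m - (if m = 0 then 1 else 0)" for m
  proof (cases "m < l")
    case True
    then have "S $ m = (if m = 0 then 1 else 0)" using assms by (auto simp: S_def dest: dvd_imp_le)
    then show ?thesis using True by (simp add: MS)
  next
    case False
    then obtain r where r: "m = l + r" using le_Suc_ex not_less by blast
    then have "S $ m = c * S $ (m - l)" using assms by (auto simp: S_def)
    then show ?thesis using r assms by (simp add: MS)
  qed
  have "(1 - M) * S = 1" by (rule fps_ext) (simp add: algebra_simps rec)
  then have S: "inverse (1 - M) = S" using fps_inverse_unique by blast
  have "logderiv (1 - M) = - ((fps_X * fps_deriv M) * S)"
    unfolding logderiv_def S by simp
  also have "fps_X * fps_deriv M = fps_const (real l) * M"
    unfolding M_def by (rule fps_X_mult_deriv_monom)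
  finally have "logderiv (1 - M) $ n = - (real l * (M * S) $ n)"
    by (simp add: mult.assoc)
  then show ?thesis using assms unfolding M_def[symmetric] rec by (auto simp: S_def)
qed

text \<open>The n-th coefficient of the logarithmic derivative of 1 + y + ... + y^k for y = c X^l.
  The two terms come from the denominator and the numerator of (1 - y^(k+1)) / (1 - y).\<close>

definition tau :: "real \<Rightarrow> nat \<Rightarrow> nat \<Rightarrow> nat \<Rightarrow> real" where
  "tau c l k n = (if l dvd n then real l * c ^ (n div l) else 0)
    - (if (k + 1) * l dvd n then real ((k + 1) * l) * (c ^ (k + 1)) ^ (n div ((k + 1) * l)) else 0)"

lemma geo_mult_1_minus: "geo (x :: 'r::comm_ring_1) k * (1 - x) = 1 - x ^ (k + 1)"
  using sum_gp_basic[of x k] by (simp add: geo_def mult.commute)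

lemma logderiv_geo_monom:
  assumes "l \<ge> 1" "n \<ge> 1"
  shows "logderiv (geo (fps_const c * fps_X ^ l) k) $ n = tau c l k n"
    and "geo (fps_const c * fps_X ^ l) k $ 0 = 1"
proof -
  let ?M = "fps_const c * (fps_X :: real fps) ^ l"
  have pow: "?M ^ j = fps_const (c ^ j) * fps_X ^ (j * l)" for j
    by (simp add: power_mult_distrib fps_const_power power_mult[symmetric] mult.commute)
  have 0: "?M $ 0 = 0" using assms(1) by (simp add: fps_X_power_nth)
  have "geo ?M k $ 0 = (\<Sum>j\<le>k. (?M $ 0) ^ j)"
    unfolding geo_def by (simp add: fps_sum_nth fps_power_zeroth)
  also have "\<dots> = 1" unfolding 0 by (induction k) auto
  finally show g0: "geo ?M k $ 0 = 1" .
  have "logderiv (geo ?M k) + logderiv (1 - ?M) = logderiv (1 - ?M ^ (k + 1))"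
    using logderiv_mult[of "geo ?M k" "1 - ?M"] g0 0 unfolding geo_mult_1_minus
    by (simp only: fps_sub_nth fps_one_nth) simp
  then have "logderiv (geo ?M k) $ n = logderiv (1 - ?M ^ (k + 1)) $ n - logderiv (1 - ?M) $ n"
    by (metis add_diff_cancel_right' fps_sub_nth)
  then show "logderiv (geo ?M k) $ n = tau c l k n"
    using assms unfolding pow by (subst (asm) (1 2) logderiv_1_minus_monom) (auto simp: tau_def)
qed

section \<open>The renewal sequence of a code\<close>

definition code_fps :: "('a \<Rightarrow> real) \<Rightarrow> 'a list set \<Rightarrow> real fps" where
  "code_fps p C = (\<Sum>c\<in>C. fps_const (wt p c) * fps_X ^ length c)"

text \<open>The total weight of the concatenations of codewords that have length n. For a code of
  total weight one this is the probability that a renewal process with random codewords as steps has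
  a renewal at n.\<close>

definition renewal :: "('a \<Rightarrow> real) \<Rightarrow> 'a list set \<Rightarrow> nat \<Rightarrow> real" where
  "renewal p C n = inverse (1 - code_fps p C) $ n"

lemma code_fps_mult_nth:
  "(code_fps p C * G) $ n = (\<Sum>c\<in>C. if length c \<le> n then wt p c * G $ (n - length c) else 0)"
  unfolding code_fps_def sum_distrib_right fps_sum_nth
  by (intro sum.cong) (auto simp: mult.assoc fps_X_power_mult_nth)

lemma code_fps_0: "fin_code C \<Longrightarrow> code_fps p C $ 0 = 0"
  unfolding code_fps_def fps_sum_nth
  by (intro sum.neutral) (auto simp: fps_X_power_nth dest: fin_code_nonempty)

lemma renewal_rec:
  assumes "fin_code C"
  shows "renewal p C n = (if n = 0 then 1 else 0)
    + (\<Sum>c\<in>C. if length c \<le> n then wt p c * renewal p C (n - length c) else 0)"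
proof -
  let ?F = "code_fps p C" and ?V = "inverse (1 - code_fps p C)"
  have "(1 - ?F) * ?V = 1"
    using code_fps_0[OF assms] by (intro inverse_mult_eq_1') auto
  then have "?V = 1 + ?F * ?V" by (simp add: algebra_simps)
  then have "?V $ n = (1 + ?F * ?V) $ n" by simp
  then show ?thesis unfolding renewal_def by (simp add: code_fps_mult_nth)
qed

lemma renewal_nonneg:
  assumes C: "fin_code C" and p: "\<And>a. p a \<ge> 0"
  shows "renewal p C n \<ge> 0"
proof (induction n rule: less_induct)
  case (less n)
  have wt0: "wt p c \<ge> 0" for c by (induction c) (auto simp: p)
  have "(if length c \<le> n then wt p c * renewal p C (n - length c) else 0) \<ge> 0" if "c \<in> C" for c
    using fin_code_nonempty[OF C that] less.IH[of "n - length c"] wt0[of c]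
    by (cases "n = 0") auto
  then show ?case by (subst renewal_rec[OF C]) (auto intro!: add_nonneg_nonneg sum_nonneg)
qed

text \<open>With F the series of the code, the coefficient of X F' / (1 - F) is the convolution of
  |c| p(c) with the renewal sequence. All terms are nonnegative, and replacing |c| by n leaves n
  times the right side of the renewal equation.\<close>

lemma logderiv_code_bounds:
  assumes C: "fin_code C" and p: "\<And>a. p a \<ge> 0" and n: "n \<ge> 1"
  shows "- logderiv (1 - code_fps p C) $ n \<ge> 0"
    "- logderiv (1 - code_fps p C) $ n \<le> real n * renewal p C n"
proof -
  let ?F = "code_fps p C" and ?V = "inverse (1 - code_fps p C)"
  have wt0: "wt p c \<ge> 0" for c by (induction c) (auto simp: p)
  have "fps_X * fps_deriv ?F
      = (\<Sum>c\<in>C. fps_const (real (length c)) * (fps_const (wt p c) * fps_X ^ length c))"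
    unfolding code_fps_def fps_deriv_sum sum_distrib_left[of fps_X]
    by (simp only: fps_X_mult_deriv_monom)
  then have "- logderiv (1 - ?F)
      = (\<Sum>c\<in>C. fps_const (real (length c)) * (fps_const (wt p c) * fps_X ^ length c)) * ?V"
    unfolding logderiv_def by simp
  then have "- logderiv (1 - ?F) $ n = ((\<Sum>c\<in>C. fps_const (real (length c)) * (fps_const (wt p c) * fps_X ^ length c)) * ?V) $ n"
    by (metis fps_neg_nth)
  also have "\<dots> = (\<Sum>c\<in>C. if length c \<le> n then real (length c) * wt p c * renewal p C (n - length c) else 0)"
    unfolding sum_distrib_right fps_sum_nth renewal_def
    by (intro sum.cong) (auto simp: mult.assoc fps_X_power_mult_nth)
  finally have eq: "- logderiv (1 - ?F) $ n
    = (\<Sum>c\<in>C. if length c \<le> n then real (length c) * wt p c * renewal p C (n - length c) else 0)" .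
  show "- logderiv (1 - ?F) $ n \<ge> 0"
    unfolding eq using wt0 renewal_nonneg[of C p, OF C p] by (intro sum_nonneg) auto
  have "- logderiv (1 - ?F) $ n
    \<le> (\<Sum>c\<in>C. real n * (if length c \<le> n then wt p c * renewal p C (n - length c) else 0))"
    unfolding eq using wt0 renewal_nonneg[of C p, OF C p]
    by (intro sum_mono) (auto intro!: mult_right_mono simp: mult.assoc)
  also have "\<dots> = real n * renewal p C n"
    using n by (subst renewal_rec[OF C]) (simp add: sum_distrib_left)
  finally show "- logderiv (1 - ?F) $ n \<le> real n * renewal p C n" .
qed

text \<open>A tilted version of the code turns the absence of heavy codewords into smallness of the
  renewal sequence.\<close>

lemma renewal_le:
  fixes S B :: real
  assumes C: "fin_code C" and p: "\<And>a. p a \<ge> 0" and S: "S \<ge> 0" and B: "B \<ge> 0"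
    and b: "\<And>c. c \<in> C \<Longrightarrow> b c \<ge> 0" "(\<Sum>c\<in>C. b c) \<le> 1"
    and 1: "\<And>c. c \<in> C \<Longrightarrow> wt p c \<le> S ^ length c * b c"
    and 2: "\<And>c. c \<in> C \<Longrightarrow> wt p c \<le> B * (S ^ length c * b c)"
  shows "n \<ge> 1 \<Longrightarrow> renewal p C n \<le> B * S ^ n"
proof (induction n rule: less_induct)
  case (less n)
  have wt0: "wt p c \<ge> 0" for c by (induction c) (auto simp: p)
  have R0: "renewal p C 0 = 1"
    by (subst renewal_rec[OF C]) (auto intro!: sum.neutral dest: fin_code_nonempty[OF C])
  have "(if length c \<le> n then wt p c * renewal p C (n - length c) else 0) \<le> B * S ^ n * b c"
    if c: "c \<in> C" for c
  \<comment> \<open>Shorter codewords inherit the factor B from the induction hypothesis and use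
    assumption \<open>1\<close>. A codeword of length exactly n meets the value 1 of the sequence at
    0, which has no factor B; there assumption \<open>2\<close> supplies it.\<close>
  proof (cases "length c < n")
    case True
    have "length c \<ge> 1" using fin_code_nonempty[OF C c] by (cases c) auto
    then have "renewal p C (n - length c) \<le> B * S ^ (n - length c)"
      using True by (intro less.IH) auto
    then have "wt p c * renewal p C (n - length c) \<le> (S ^ length c * b c) * (B * S ^ (n - length c))"
      using wt0 1[OF c] renewal_nonneg[of C p, OF C p] S b(1)[OF c] by (intro mult_mono) auto
    also have "\<dots> = B * S ^ n * b c"
      using True power_add[of S "length c" "n - length c"] by simp
    finally show ?thesis using True by simp
  next
    case False
    then show ?thesis using 2[OF c] R0 b(1)[OF c] B S by (auto simp: mult.assoc)
  qed
  then have "(\<Sum>c\<in>C. if length c \<le> n then wt p c * renewal p C (n - length c) else 0)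
      \<le> B * S ^ n * (\<Sum>c\<in>C. b c)"
    unfolding sum_distrib_left by (intro sum_mono)
  also have "\<dots> \<le> B * S ^ n * 1" using b(2) B S by (intro mult_left_mono) auto
  finally show ?case using less.prems by (subst renewal_rec[OF C]) simp
qed

text \<open>The letters have total weight one, so their series is X and 1 - F = (1 - X) times the
  product over the path. Taking logarithmic derivatives, 1 - X contributes -1 to every coefficient;
  moved across, it is the 1 that becomes the harmonic sum after division by n.\<close>

lemma sum_tau:
  fixes p :: "'a::finite \<Rightarrow> real"
  assumes p1: "(\<Sum>a\<in>UNIV. p a) = 1" and ps: "aug_path letters ps" and n: "n \<ge> 1"
  shows "(\<Sum>t<length ps. tau (wt p (fst (ps ! t))) (length (fst (ps ! t))) (snd (ps ! t)) n)
    = 1 + logderiv (1 - code_fps p (code_after letters ps)) $ n"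
proof -
  define y where "y a = fps_const (p a) * (fps_X :: real fps)" for a
  have wty: "wt y w = fps_const (wt p w) * fps_X ^ length w" for w
    by (induction w) (simp_all add: y_def algebra_simps flip: fps_const_mult)
  let ?u = "\<lambda>t. fst (ps ! t)" and ?k = "\<lambda>t. snd (ps ! t)"
  have "(\<Sum>a\<in>UNIV. y a) = fps_X"
    unfolding y_def sum_distrib_right[symmetric] using p1
    by (simp add: fps_eq_iff fps_sum_nth)
  then have "1 - code_fps p (code_after letters ps)
      = (1 - fps_X) * (\<Prod>t<length ps. geo (wt y (?u t)) (?k t))"
    using sum_code_after[OF fin_code_letters ps, of y]
    unfolding sum_letters by (simp add: code_fps_def wty)
  moreover have g: "geo (wt y (?u t)) (?k t) $ 0 = 1"
    "logderiv (geo (wt y (?u t)) (?k t)) $ n = tau (wt p (?u t)) (length (?u t)) (?k t) n"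
    if "t < length ps" for t
  proof -
    have "length (?u t) \<ge> 1"
      using path_words_nonempty[OF fin_code_letters ps that] by (cases "?u t") auto
    from logderiv_geo_monom[OF this n]
    show "geo (wt y (?u t)) (?k t) $ 0 = 1"
      "logderiv (geo (wt y (?u t)) (?k t)) $ n = tau (wt p (?u t)) (length (?u t)) (?k t) n"
      unfolding wty by blast+
  qed
  moreover have "(\<Prod>t<m. geo (wt y (?u t)) (?k t)) $ 0 = 1" if "m \<le> length ps" for m
    using that g(1) by (induction m) auto
  moreover have "logderiv (\<Prod>t<length ps. geo (wt y (?u t)) (?k t))
      = (\<Sum>t<length ps. logderiv (geo (wt y (?u t)) (?k t)))"
    by (rule logderiv_prod) (use g(1) in auto)
  ultimately have "logderiv (1 - code_fps p (code_after letters ps))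
      = logderiv (1 - fps_X) + (\<Sum>t<length ps. logderiv (geo (wt y (?u t)) (?k t)))"
    by (simp add: logderiv_mult)
  moreover have "logderiv (1 - fps_X) $ n = - 1"
    using logderiv_1_minus_monom[of 1 n 1] n by simp
  ultimately show ?thesis using g(2) by (simp add: fps_sum_nth)
qed

unbundle no fps_syntax
unbundle vec_syntax

section \<open>Truncated logarithms\<close>

lemma ln_series_tail:
  fixes x :: real
  assumes x: "0 \<le> x" "x < 1"
  shows "0 \<le> - ln (1 - x) - (\<Sum>j=1..M. x ^ j / real j)" (is "0 \<le> ?d")
    "- ln (1 - x) - (\<Sum>j=1..M. x ^ j / real j) \<le> x ^ (M + 1) / (1 - x)"
proof -
  define d where "d = ?d"
  define f where "f j = x ^ j / real j" for j
  have s: "f sums (- ln (1 - x))"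
  proof -
    have "(\<lambda>n. - (x ^ n) / real n) sums ln (1 - x)"
      using ln_series'[of "-x"] x by simp
    then have "(\<lambda>n. - (- (x ^ n) / real n)) sums (- ln (1 - x))"
      by (rule sums_minus)
    then show ?thesis by (simp add: f_def[abs_def])
  qed
  have f_shift: "(\<lambda>j. f (j + (M + 1))) sums (- ln (1 - x) - (\<Sum>j<M + 1. f j))"
    using sums_iff_shift[of f "M + 1"] s by simp
  have "(\<Sum>j<M + 1. f j) = (\<Sum>j=1..M. f j)"
    by (rule sum.mono_neutral_right) (auto simp: f_def)
  then have d: "(\<lambda>j. f (j + (M + 1))) sums d" using f_shift by (simp add: d_def f_def)
  show "0 \<le> ?d" unfolding d_def[symmetric]
    by (rule sums_le[OF _ sums_zero d]) (use x in \<open>auto simp: f_def\<close>)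
  have "(\<lambda>j. x ^ (M + 1) * x ^ j) sums (x ^ (M + 1) * (1 / (1 - x)))"
    using x by (intro sums_mult geometric_sums) auto
  moreover have "\<And>j. f (j + (M + 1)) \<le> x ^ (M + 1) * x ^ j"
  proof -
    fix j
    have "f (j + (M + 1)) \<le> x ^ (j + (M + 1)) / 1"
      unfolding f_def using x by (intro divide_left_mono) auto
    then show "f (j + (M + 1)) \<le> x ^ (M + 1) * x ^ j" by (simp add: power_add mult_ac)
  qed
  ultimately have "d \<le> x ^ (M + 1) * (1 / (1 - x))" by (intro sums_le[OF _ d])
  then show "?d \<le> x ^ (M + 1) / (1 - x)" unfolding d_def by simp
qed

lemma sum_dvd_reindex:
  fixes x :: real
  assumes "l \<ge> 1"
  shows "(\<Sum>n=1..L. (if l dvd n then real l * x ^ (n div l) else 0) / real n)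
    = (\<Sum>j=1..L div l. x ^ j / real j)"
proof -
  have "(\<Sum>n=1..L. (if l dvd n then real l * x ^ (n div l) else 0) / real n)
      = (\<Sum>n\<in>{n\<in>{1..L}. l dvd n}. real l * x ^ (n div l) / real n)"
    by (rule sum.mono_neutral_cong_right) auto
  also have "\<dots> = (\<Sum>j=1..L div l. x ^ j / real j)"
  proof (rule sum.reindex_bij_witness[where i = "\<lambda>j. j * l" and j = "\<lambda>n. n div l"])
    show "a div l * l = a" if "a \<in> {n \<in> {1..L}. l dvd n}" for a using that by auto
    show "a div l \<in> {1..L div l}" if "a \<in> {n \<in> {1..L}. l dvd n}" for a
      using that assms by (auto simp: div_le_mono dvd_imp_le Suc_le_eq div_greater_zero_iff)
    show "b * l div l = b" if "b \<in> {1..L div l}" for b using assms by simp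
    show "b * l \<in> {n \<in> {1..L}. l dvd n}" if "b \<in> {1..L div l}" for b
    proof -
      have "b * l \<le> (L div l) * l" using that by simp
      also have "\<dots> \<le> L" by simp
      finally show ?thesis using that assms by auto
    qed
    show "x ^ (a div l) / real (a div l) = real l * x ^ (a div l) / real a"
      if "a \<in> {n \<in> {1..L}. l dvd n}" for a
      using that assms by (auto simp: field_simps)
  qed
  finally show ?thesis .
qed

text \<open>The error is a difference of two logarithmic tails, for x and for x^(k+1). Both lie
  between 0 and the stated bound, since (L div ((k+1) l) + 1) (k+1) exceeds L div l, so no factor 2
  appears.\<close>

lemma ln_geo_truncation:
  fixes x :: real
  assumes x: "0 \<le> x" "x < 1" and l: "l \<ge> 1"
  shows "\<bar>ln (geo x k) - (\<Sum>n=1..L. tau x l k n / real n)\<bar> \<le> x ^ (L div l + 1) / (1 - x)"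
proof -
  let ?l' = "(k + 1) * l" and ?y = "x ^ (k + 1)"
  have y: "0 \<le> ?y" "?y \<le> x" "?y < 1" using x power_decreasing[of 1 "k + 1" x] by auto
  let ?d = "- ln (1 - x) - (\<Sum>j=1..L div l. x ^ j / real j)"
  let ?e = "- ln (1 - ?y) - (\<Sum>j=1..L div ?l'. ?y ^ j / real j)"
  have "geo x k = (1 - ?y) / (1 - x)"
    using geo_mult_1_minus[of x k] x by (simp add: field_simps)
  then have "ln (geo x k) = ln (1 - ?y) - ln (1 - x)" using x y by (simp add: ln_div)
  moreover have "(\<Sum>n=1..L. tau x l k n / real n)
      = (\<Sum>j=1..L div l. x ^ j / real j) - (\<Sum>j=1..L div ?l'. ?y ^ j / real j)"
    unfolding tau_def diff_divide_distrib sum_subtractf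
    using sum_dvd_reindex[of l x L] sum_dvd_reindex[of ?l' ?y L] l by simp
  ultimately have eq: "ln (geo x k) - (\<Sum>n=1..L. tau x l k n / real n) = ?d - ?e" by simp
  have "?e \<le> ?y ^ (L div ?l' + 1) / (1 - ?y)" by (rule ln_series_tail) (use y in auto)
  also have "\<dots> \<le> x ^ (L div l + 1) / (1 - x)"
  proof (rule frac_le)
    have "L < (L div ?l' + 1) * ?l'"
      using dividend_less_times_div[of ?l' L] l by (simp add: mult.commute)
    then have "L div l < (L div ?l' + 1) * (k + 1)"
      using l by (simp only: div_less_iff_less_mult mult.assoc)
    then show "?y ^ (L div ?l' + 1) \<le> x ^ (L div l + 1)"
      unfolding power_mult[symmetric] using x by (intro power_decreasing) (auto simp: mult.commute)
  qed (use x y in auto)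
  finally have "?e \<le> x ^ (L div l + 1) / (1 - x)" .
  moreover have "0 \<le> ?e" by (rule ln_series_tail) (use y in auto)
  moreover have "0 \<le> ?d" "?d \<le> x ^ (L div l + 1) / (1 - x)" by (rule ln_series_tail; use x in simp)+
  ultimately show ?thesis unfolding eq by linarith
qed

section \<open>Weights of words under the source\<close>

locale source =
  fixes p :: "'a::finite \<Rightarrow> real"
  assumes card_alphabet: "CARD('a) \<ge> 2"
    and p_pos: "\<And>a. p a > 0"
    and p_sum: "(\<Sum>a\<in>UNIV. p a) = 1"
begin

abbreviation h :: real where "h \<equiv> source_entropy p"

definition pmax :: real where "pmax = Max (range p)"

lemma p_le_pmax: "p a \<le> pmax"
  unfolding pmax_def by (rule Max_ge) auto

lemma p_less_1: "p a < 1"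
proof -
  have "card (UNIV - {a}) > 0" using card_alphabet by (simp add: card_Diff_singleton)
  then obtain b where b: "b \<noteq> a" by (metis Diff_iff card_gt_0_iff ex_in_conv insertI1)
  have "p a + p b = (\<Sum>c\<in>{a, b}. p c)" using b by simp
  also have "\<dots> \<le> (\<Sum>c\<in>UNIV. p c)" using p_pos by (intro sum_mono2) (auto intro: less_imp_le)
  finally show ?thesis using p_sum p_pos[of b] by simp
qed

lemma pmax_pos: "0 < pmax" and pmax_less_1: "pmax < 1"
proof -
  have "pmax \<in> range p" unfolding pmax_def by (rule Max_in) auto
  then show "0 < pmax" "pmax < 1" using p_pos p_less_1 by auto
qed

lemma h_pos: "h > 0"
proof -
  have "p a * ln (p a) < 0" for a
    using p_pos[of a] p_less_1[of a] by (simp add: mult_pos_neg)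
  then have "(\<Sum>a\<in>UNIV. p a * ln (p a)) < (\<Sum>a\<in>(UNIV::'a set). 0)"
    by (intro sum_strict_mono) auto
  then show ?thesis by (simp add: source_entropy_def)
qed

lemma wt_pos: "wt p w > 0"
  by (induction w) (auto simp: p_pos)

lemma wt_le_pmax: "wt p w \<le> pmax ^ length w"
  using p_le_pmax p_pos wt_pos by (induction w) (auto intro!: mult_mono simp: less_imp_le pmax_pos)

lemma wt_le_1: "wt p w \<le> 1"
  using wt_le_pmax[of w] pmax_pos pmax_less_1 power_le_one[of pmax "length w"] by linarith

section \<open>Exponential tilting by word length and power sums of the source\<close>

definition xwt :: "real \<Rightarrow> 'a list \<Rightarrow> real" where
  "xwt z u = wt p u * z ^ length u"

lemma xwt_eq_wt: "xwt z u = wt (\<lambda>a. p a * z) u"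
  unfolding xwt_def by (induction u) auto

lemma xwt_pos: "z > 0 \<Longrightarrow> xwt z u > 0"
  by (simp add: xwt_def wt_pos)

lemma xwt_le:
  assumes "z > 0" "pmax * z < 1" "u \<noteq> []"
  shows "xwt z u \<le> pmax * z"
proof -
  have "xwt z u \<le> (pmax * z) ^ length u"
    using wt_le_pmax[of u] assms(1) by (simp add: xwt_def power_mult_distrib mult_right_mono)
  also have "\<dots> \<le> (pmax * z) ^ 1"
    using assms pmax_pos by (intro power_decreasing) (auto simp: Suc_le_eq)
  finally show ?thesis by simp
qed

lemma sum_xwt_length: "(\<Sum>u | length u = n. xwt z u) = z ^ n"
  unfolding xwt_eq_wt sum_wt_length sum_distrib_right[symmetric] p_sum by simp

text \<open>The moment generating function of ln p(a) for a random letter a; on words of length n it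
  becomes the n-th power.\<close>

definition psi :: "real \<Rightarrow> real" where
  "psi s = (\<Sum>a\<in>UNIV. p a powr (1 + s))"

lemma wt_powr: "wt (\<lambda>a. p a powr r) w = wt p w powr r"
  using p_pos wt_pos by (induction w) (auto simp: powr_mult less_imp_le)

lemma sum_wt_powr_length: "(\<Sum>u | length u = n. wt p u powr (1 + s)) = psi s ^ n"
  using sum_wt_length[of "\<lambda>a. p a powr (1 + s)" n] by (simp add: wt_powr psi_def)

lemma psi_pos: "psi s > 0"
  unfolding psi_def by (rule sum_pos) (auto simp: p_pos less_imp_neq[OF p_pos, symmetric])

lemma psi_0: "psi 0 = 1"
  using p_sum p_pos by (simp add: psi_def less_imp_le)

text \<open>The derivative of \<open>psi\<close> at 0 is -h, which is how the entropy enters.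
  Positive s controls long words that are still heavy, negative s the codes without heavy
  codewords.\<close>

lemma psi_near_0:
  assumes "\<eta> > 0"
  shows "\<exists>s0>0. \<forall>s. 0 < \<bar>s\<bar> \<and> \<bar>s\<bar> < s0 \<longrightarrow> psi s \<le> 1 - h * s + \<eta> * \<bar>s\<bar>"
proof -
  have "(psi has_real_derivative (\<Sum>a\<in>UNIV. p a powr (1 + 0) * ln (p a))) (at 0)"
    unfolding psi_def using p_pos
    by (auto intro!: derivative_eq_intros simp: less_imp_le mult.commute)
  moreover have "(\<Sum>a\<in>UNIV. p a powr (1 + 0) * ln (p a)) = - h"
    using p_pos by (simp add: source_entropy_def less_imp_le)
  ultimately have "((\<lambda>s. (psi s - psi 0) / s) \<longlongrightarrow> - h) (at 0)"
    by (simp add: DERIV_def)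
  then obtain s0 where s0: "s0 > 0"
    "\<And>s. s \<noteq> 0 \<Longrightarrow> \<bar>s\<bar> < s0 \<Longrightarrow> \<bar>(psi s - 1) / s + h\<bar> < \<eta>"
    using assms unfolding LIM_def by (force simp: dist_real_def psi_0)
  have "psi s \<le> 1 - h * s + \<eta> * \<bar>s\<bar>" if s: "0 < \<bar>s\<bar>" "\<bar>s\<bar> < s0" for s
  proof -
    have "\<bar>(psi s - 1) / s + h\<bar> * \<bar>s\<bar> \<le> \<eta> * \<bar>s\<bar>"
      using s0(2)[of s] s by (intro mult_right_mono) auto
    moreover have "\<bar>(psi s - 1) / s + h\<bar> * \<bar>s\<bar> = \<bar>psi s - 1 + h * s\<bar>"
      using s unfolding abs_mult[symmetric] by (simp add: distrib_right)
    ultimately show ?thesis by linarith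
  qed
  then show ?thesis using s0(1) by blast
qed

lemma sum_words_le:
  fixes f :: "'a list \<Rightarrow> real"
  assumes "finite U" "\<And>u. f u \<ge> 0" "\<And>u. u \<in> U \<Longrightarrow> length u \<in> A" "finite A"
  shows "(\<Sum>u\<in>U. f u) \<le> (\<Sum>n\<in>A. \<Sum>u | length u = n. f u)"
proof -
  have "(\<Sum>u\<in>U. f u) \<le> (\<Sum>u\<in>(\<Union>n\<in>A. {u. length u = n}). f u)"
    using assms by (intro sum_mono2) auto
  also have "\<dots> = (\<Sum>n\<in>A. \<Sum>u | length u = n. f u)"
    using assms(4) by (intro sum.UNION_disjoint) auto
  finally show ?thesis .
qed

text \<open>For l = |u| at most L, the product l (L div l) is at least L/2, so all but one factor of
  the truncation error contribute (pmax z)^(L/2). The remaining factor sums to z^l over the words of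
  length l.\<close>

lemma sum_short_words:
  assumes U: "finite U" "\<And>u. u \<in> U \<Longrightarrow> u \<noteq> [] \<and> length u \<le> L"
    and z: "z > 0" "pmax * z < 1"
  shows "(\<Sum>u\<in>U. xwt z u ^ (L div length u + 1)) \<le> (\<Sum>l=1..L. z ^ l) * sqrt (pmax * z) ^ L"
proof -
  let ?q = "pmax * z"
  have q: "0 < ?q" "?q < 1" using z pmax_pos by auto
  have *: "xwt z u ^ (L div length u + 1) \<le> xwt z u * sqrt ?q ^ L" if u: "u \<in> U" for u
  proof -
    define l where "l = length u"
    have l: "l \<ge> 1" "l \<le> L" using U(2)[OF u] by (auto simp: l_def Suc_le_eq)
    have "l * 1 \<le> l * (L div l)" using l by (intro mult_le_mono2) (simp add: div_greater_zero_iff Suc_le_eq)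
    moreover have "L < l + l * (L div l)" using dividend_less_times_div[of l L] l by simp
    ultimately have "L \<le> 2 * (l * (L div l))" by linarith
    then have "sqrt ?q ^ (2 * (l * (L div l))) \<le> sqrt ?q ^ L"
      using q by (intro power_decreasing) auto
    then have 1: "?q ^ (l * (L div l)) \<le> sqrt ?q ^ L"
      using q by (simp add: power_mult)
    have "xwt z u \<le> ?q ^ l"
      using wt_le_pmax[of u] z(1) by (simp add: xwt_def power_mult_distrib mult_right_mono l_def)
    then have "xwt z u ^ (L div l) \<le> (?q ^ l) ^ (L div l)"
      using xwt_pos[OF z(1), of u] by (intro power_mono) auto
    then have "xwt z u ^ (L div l) \<le> sqrt ?q ^ L" using 1 by (simp add: power_mult)
    then show ?thesis using xwt_pos[OF z(1), of u] by (simp add: l_def mult_left_mono)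
  qed
  have "(\<Sum>u\<in>U. xwt z u ^ (L div length u + 1)) \<le> (\<Sum>u\<in>U. xwt z u) * sqrt ?q ^ L"
    unfolding sum_distrib_right by (rule sum_mono[OF *])
  also have "(\<Sum>u\<in>U. xwt z u) \<le> (\<Sum>l=1..L. \<Sum>u | length u = l. xwt z u)"
    using U xwt_pos[OF z(1)] by (intro sum_words_le) (auto simp: Suc_le_eq less_imp_le)
  finally show ?thesis using q by (simp add: sum_xwt_length mult_right_mono)
qed

text \<open>The power p(u)^\<delta> absorbs z^|u|. Of the remaining p(u)^(1-\<delta>), words of
  weight at most \<rho> are bounded by counting, at most N times; for heavier words
  p(u)^(1-\<delta>) is at most \<rho>^(-(s+\<delta>)) p(u)^(1+s), which is summed over all lengths
  above L as a geometric series in \<open>psi s\<close>.\<close>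

lemma sum_long_words:
  assumes U: "finite U" "card U \<le> N" "\<And>u. u \<in> U \<Longrightarrow> length u > L"
    and z: "z > 0" "pmax powr \<delta> * z \<le> 1"
    and \<delta>: "0 \<le> \<delta>" "\<delta> < 1" and s: "s > 0" "psi s < 1" and \<rho>: "\<rho> > 0"
  shows "(\<Sum>u\<in>U. xwt z u)
    \<le> real N * \<rho> powr (1 - \<delta>) + \<rho> powr (- (s + \<delta>)) * (psi s ^ (L + 1) / (1 - psi s))"
proof -
  have *: "xwt z u \<le> \<rho> powr (1 - \<delta>) + \<rho> powr (- (s + \<delta>)) * wt p u powr (1 + s)" for u
  proof -
    let ?w = "wt p u"
    have w: "?w > 0" by (rule wt_pos)
    have "?w powr \<delta> \<le> (pmax ^ length u) powr \<delta>"
      using w wt_le_pmax[of u] \<delta> by (intro powr_mono2) auto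
    also have "\<dots> = (pmax powr \<delta>) ^ length u"
      using pmax_pos by (simp add: powr_power powr_realpow[symmetric] powr_powr mult.commute)
    finally have "?w powr \<delta> * z ^ length u \<le> (pmax powr \<delta> * z) ^ length u"
      using z by (simp add: power_mult_distrib mult_right_mono)
    also have "\<dots> \<le> 1" using z by (intro power_le_one) auto
    finally have 1: "?w powr \<delta> * z ^ length u \<le> 1" .
    have "xwt z u = ?w powr (1 - \<delta>) * (?w powr \<delta> * z ^ length u)"
      using w by (simp add: xwt_def mult.assoc[symmetric] powr_add[symmetric])
    also have "\<dots> \<le> ?w powr (1 - \<delta>) * 1" by (intro mult_left_mono 1) auto
    finally have 2: "xwt z u \<le> ?w powr (1 - \<delta>)" by simp
    show ?thesis
    proof (cases "?w \<le> \<rho>")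
      case True
      then have "?w powr (1 - \<delta>) \<le> \<rho> powr (1 - \<delta>)" using w \<delta> by (intro powr_mono2) auto
      then show ?thesis using 2 by (smt (verit) mult_nonneg_nonneg powr_ge_zero)
    next
      case False
      have "?w powr (1 - \<delta>) = ?w powr (- (s + \<delta>)) * ?w powr (1 + s)"
        by (simp add: powr_add[symmetric])
      also have "\<dots> \<le> \<rho> powr (- (s + \<delta>)) * ?w powr (1 + s)"
        using False \<rho> s \<delta> by (intro mult_right_mono powr_mono2') auto
      finally show ?thesis using 2 by (smt (verit) powr_ge_zero)
    qed
  qed
  obtain M where M: "\<And>u. u \<in> U \<Longrightarrow> length u \<le> M"
    using U(1) by (meson finite_imageI finite_nat_set_iff_bounded_le imageI)
  have "(\<Sum>u\<in>U. wt p u powr (1 + s)) \<le> (\<Sum>n=L+1..M. \<Sum>u | length u = n. wt p u powr (1 + s))"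
    using U M by (intro sum_words_le) (auto simp: Suc_le_eq)
  also have "\<dots> = (\<Sum>n=L+1..M. psi s ^ n)" by (simp add: sum_wt_powr_length)
  also have "\<dots> \<le> psi s ^ (L + 1) / (1 - psi s)"
  proof (cases "L + 1 \<le> M")
    case True
    have "(1 - psi s) * (\<Sum>n=L+1..M. psi s ^ n) = psi s ^ (L + 1) - psi s ^ Suc M"
      by (rule sum_gp_multiplied[OF True])
    then have "(1 - psi s) * (\<Sum>n=L+1..M. psi s ^ n) \<le> psi s ^ (L + 1)"
      using psi_pos[of s] by simp
    then show ?thesis using s by (simp add: field_simps)
  next
    case False
    then show ?thesis using s psi_pos[of s] by simp
  qed
  finally have 3: "(\<Sum>u\<in>U. wt p u powr (1 + s)) \<le> psi s ^ (L + 1) / (1 - psi s)" .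
  have "(\<Sum>u\<in>U. xwt z u) \<le> (\<Sum>u\<in>U. \<rho> powr (1 - \<delta>) + \<rho> powr (- (s + \<delta>)) * wt p u powr (1 + s))"
    by (rule sum_mono[OF *])
  also have "\<dots> = real (card U) * \<rho> powr (1 - \<delta>) + \<rho> powr (- (s + \<delta>)) * (\<Sum>u\<in>U. wt p u powr (1 + s))"
    by (simp add: sum.distrib sum_distrib_left)
  also have "\<dots> \<le> real N * \<rho> powr (1 - \<delta>) + \<rho> powr (- (s + \<delta>)) * (psi s ^ (L + 1) / (1 - psi s))"
    using U(2) 3 by (intro add_mono mult_right_mono mult_left_mono) auto
  finally show ?thesis .
qed

section \<open>The mean codeword length\<close>

text \<open>The mean codeword length at \<open>z = 1\<close>.\<close>

definition expansion :: "real \<Rightarrow> ('a list \<times> nat) list \<Rightarrow> real" where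
  "expansion z ps = (\<Prod>t<length ps. geo (xwt z (fst (ps ! t))) (snd (ps ! t)))"

definition code_sum :: "real \<Rightarrow> 'a list set \<Rightarrow> real" where
  "code_sum z C = (\<Sum>c\<in>C. xwt z c)"

text \<open>The letters have sum z. Thus (1 - \<open>code_sum z C\<close>) / (1 - z) is the product
  along the path, and its limit at z = 1 is the mean codeword length.\<close>

lemma code_sum_path:
  assumes "aug_path letters ps"
  shows "code_sum z (code_after letters ps) = 1 - (1 - z) * expansion z ps"
proof -
  have "(\<Sum>a\<in>UNIV. p a * z) = z" by (simp add: sum_distrib_right[symmetric] p_sum)
  then show ?thesis
    using sum_code_after[OF fin_code_letters assms, of "\<lambda>a. p a * z"]
    by (simp add: code_sum_def expansion_def xwt_eq_wt sum_letters)
qed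

lemma geo_ge_1: "x \<ge> 0 \<Longrightarrow> geo (x::real) k \<ge> 1"
  unfolding geo_def by (induction k) (auto intro: add_increasing2)

lemma expansion_ge_1: "z > 0 \<Longrightarrow> expansion z ps \<ge> 1"
  unfolding expansion_def by (intro prod_ge_1 geo_ge_1) (simp add: xwt_pos less_imp_le)

lemma expansion_take_le:
  assumes "z > 0"
  shows "expansion z (take t ps) \<le> expansion z ps"
proof -
  have *: "expansion z (take t ps) = (\<Prod>i<min (length ps) t. geo (xwt z (fst (ps ! i))) (snd (ps ! i)))"
    unfolding expansion_def by (intro prod.cong) auto
  have "(\<Prod>i<min (length ps) t. geo (xwt z (fst (ps ! i))) (snd (ps ! i)))
    \<le> (\<Prod>i<length ps. geo (xwt z (fst (ps ! i))) (snd (ps ! i)))"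
    by (rule prod_mono2) (use assms xwt_pos geo_ge_1 in \<open>auto simp: less_imp_le intro: order_trans[OF zero_le_one]\<close>)
  then show ?thesis unfolding * by (simp add: expansion_def)
qed

lemma ln_expansion:
  assumes "z > 0"
  shows "ln (expansion z ps) = (\<Sum>t<length ps. ln (geo (xwt z (fst (ps ! t))) (snd (ps ! t))))"
proof -
  have "geo (xwt z u) k \<noteq> 0" for u k
    using geo_ge_1[of "xwt z u" k] xwt_pos[OF assms, of u] by linarith
  then show ?thesis unfolding expansion_def by (intro ln_prod) auto
qed

lemma tau_scale: "l \<ge> 1 \<Longrightarrow> tau (c * z ^ l) l k n = tau c l k n * z ^ n"
proof -
  assume l: "l \<ge> 1"
  have 1: "(c * z ^ l) ^ (n div l) = c ^ (n div l) * z ^ n" if "l dvd n"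
    using that by (simp add: power_mult_distrib power_mult[symmetric])
  have 2: "((c * z ^ l) ^ (k + 1)) ^ (n div ((k + 1) * l)) = (c ^ (k + 1)) ^ (n div ((k + 1) * l)) * z ^ n"
    if "(k + 1) * l dvd n"
  proof -
    have "(c * z ^ l) ^ (k + 1) = c ^ (k + 1) * z ^ ((k + 1) * l)"
      by (simp only: power_mult_distrib power_mult[symmetric] mult.commute)
    then have "((c * z ^ l) ^ (k + 1)) ^ (n div ((k + 1) * l))
        = (c ^ (k + 1)) ^ (n div ((k + 1) * l)) * z ^ ((k + 1) * l * (n div ((k + 1) * l)))"
      by (simp only: power_mult_distrib power_mult)
    then show ?thesis using that by (simp only: dvd_mult_div_cancel)
  qed
  show ?thesis unfolding tau_def left_diff_distrib using 1 2 by auto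
qed

definition path_words :: "('a list \<times> nat) list \<Rightarrow> 'a list set" where
  "path_words ps = (\<lambda>t. fst (ps ! t)) ` {..<length ps}"

text \<open>As no word is eliminated twice, a sum over steps is a sum over a set of words and can be
  bounded by a sum over all words.\<close>

lemma sum_path_words:
  assumes "aug_path letters ps"
  shows "(\<Sum>t<length ps. f (fst (ps ! t))) = (\<Sum>u\<in>path_words ps. f u)"
  unfolding path_words_def by (subst sum.reindex[OF inj_on_path_words[OF fin_code_letters assms]]) simp

lemma path_words_props:
  assumes "aug_path letters ps"
  shows "finite (path_words ps)" "card (path_words ps) \<le> length ps" "u \<in> path_words ps \<Longrightarrow> u \<noteq> []"
  unfolding path_words_def using path_words_nonempty[OF fin_code_letters assms] card_image_le[of "{..<length ps}" "\<lambda>t. fst (ps ! t)"]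
  by auto

lemma sum_tau_scaled:
  assumes ps: "aug_path letters ps"
  shows "(\<Sum>t<length ps. \<Sum>n=1..L. tau (xwt z (fst (ps ! t))) (length (fst (ps ! t))) (snd (ps ! t)) n / real n)
    = (\<Sum>n=1..L. z ^ n / real n * (1 + fps_nth (logderiv (1 - code_fps p (code_after letters ps))) n))"
proof -
  have "(\<Sum>t<length ps. \<Sum>n=1..L. tau (xwt z (fst (ps ! t))) (length (fst (ps ! t))) (snd (ps ! t)) n / real n)
    = (\<Sum>n=1..L. \<Sum>t<length ps. z ^ n / real n * tau (wt p (fst (ps ! t))) (length (fst (ps ! t))) (snd (ps ! t)) n)"
  proof (subst sum.swap, intro sum.cong refl)
    fix n t assume "t \<in> {..<length ps}"
    then have "length (fst (ps ! t)) \<ge> 1"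
      using path_words_nonempty[OF fin_code_letters ps, of t] by (cases "fst (ps ! t)") auto
    then show "tau (xwt z (fst (ps ! t))) (length (fst (ps ! t))) (snd (ps ! t)) n / real n
      = z ^ n / real n * tau (wt p (fst (ps ! t))) (length (fst (ps ! t))) (snd (ps ! t)) n"
      by (simp add: xwt_def tau_scale)
  qed
  also have "\<dots> = (\<Sum>n=1..L. z ^ n / real n * (1 + fps_nth (logderiv (1 - code_fps p (code_after letters ps))) n))"
    unfolding sum_distrib_left[symmetric] using sum_tau[OF p_sum ps] by (intro sum.cong) auto
  finally show ?thesis .
qed

text \<open>Each logarithm is truncated at L. The truncated parts add up to at most the tilted
  harmonic sum because the coefficients contributed by the final code are nonpositive. For a word
  longer than L the truncated part vanishes and the error exponent is 1, so the error is the weight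
  itself; this is where \<open>sum_long_words\<close> is needed.\<close>

lemma ln_expansion_upper:
  assumes ps: "aug_path letters ps" "length ps \<le> N"
    and z: "z > 0" "pmax * z < 1" "pmax powr \<delta> * z \<le> 1"
    and \<delta>: "0 \<le> \<delta>" "\<delta> < 1" and s: "s > 0" "psi s < 1" and \<rho>: "\<rho> > 0"
  shows "ln (expansion z ps) \<le> (\<Sum>n=1..L. z ^ n / real n)
    + ((\<Sum>l=1..L. z ^ l) * sqrt (pmax * z) ^ L
       + (real N * \<rho> powr (1 - \<delta>) + \<rho> powr (- (s + \<delta>)) * (psi s ^ (L + 1) / (1 - psi s))))
      / (1 - pmax * z)"
proof -
  let ?q = "pmax * z" and ?u = "\<lambda>t. fst (ps ! t)"
  let ?T = "\<lambda>t. \<Sum>n=1..L. tau (xwt z (?u t)) (length (?u t)) (snd (ps ! t)) n / real n"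
  let ?f = "\<lambda>u. xwt z u ^ (L div length u + 1)"
  note fin = path_words_props[OF ps(1)]
  have u: "?u t \<noteq> []" if "t < length ps" for t
    using path_words_nonempty[OF fin_code_letters ps(1) that] .
  have "ln (geo (xwt z (?u t)) (snd (ps ! t))) \<le> ?T t + ?f (?u t) / (1 - ?q)" if t: "t < length ps" for t
  proof -
    have x: "0 < xwt z (?u t)" "xwt z (?u t) \<le> ?q" using xwt_pos xwt_le u[OF t] z by auto
    have "length (?u t) \<ge> 1" using u[OF t] by (cases "?u t") auto
    then have "ln (geo (xwt z (?u t)) (snd (ps ! t))) \<le> ?T t + ?f (?u t) / (1 - xwt z (?u t))"
      using ln_geo_truncation[of "xwt z (?u t)" "length (?u t)" "snd (ps ! t)" L] x z
      by linarith
    also have "?f (?u t) / (1 - xwt z (?u t)) \<le> ?f (?u t) / (1 - ?q)"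
      using x z by (intro divide_left_mono) auto
    finally show ?thesis by simp
  qed
  then have "ln (expansion z ps) \<le> (\<Sum>t<length ps. ?T t) + (\<Sum>t<length ps. ?f (?u t)) / (1 - ?q)"
    unfolding ln_expansion[OF z(1)] sum_divide_distrib sum.distrib[symmetric] by (intro sum_mono) auto
  also have "(\<Sum>t<length ps. ?T t) \<le> (\<Sum>n=1..L. z ^ n / real n * 1)"
    unfolding sum_tau_scaled[OF ps(1)]
    using logderiv_code_bounds(1)[OF fin_code_code_after[OF fin_code_letters ps(1)], of p] p_pos z
    by (intro sum_mono mult_left_mono) (auto simp: less_imp_le)
  also have "(\<Sum>t<length ps. ?f (?u t)) = (\<Sum>u\<in>path_words ps. ?f u)"
    by (rule sum_path_words[OF ps(1)])
  also have "\<dots> = (\<Sum>u\<in>{u\<in>path_words ps. length u \<le> L}. ?f u) + (\<Sum>u\<in>{u\<in>path_words ps. length u > L}. ?f u)"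
    using fin(1) by (subst sum.union_disjoint[symmetric]) (auto intro!: sum.cong)
  also have "(\<Sum>u\<in>{u\<in>path_words ps. length u \<le> L}. ?f u) \<le> (\<Sum>l=1..L. z ^ l) * sqrt ?q ^ L"
    using fin z by (intro sum_short_words) auto
  also have "(\<Sum>u\<in>{u\<in>path_words ps. length u > L}. ?f u) = (\<Sum>u\<in>{u\<in>path_words ps. length u > L}. xwt z u)"
    by (intro sum.cong) auto
  also have "\<dots> \<le> real N * \<rho> powr (1 - \<delta>) + \<rho> powr (- (s + \<delta>)) * (psi s ^ (L + 1) / (1 - psi s))"
    using fin ps(2) z \<delta> s \<rho> card_mono[of "path_words ps" "{u\<in>path_words ps. length u > L}"]
    by (intro sum_long_words) auto
  finally show ?thesis using z(2) by (simp add: divide_right_mono)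
qed

text \<open>Words longer than L have nonnegative logarithms and are dropped, so no long-word error
  appears. The price is the contribution of the final code, bounded through its renewal
  sequence.\<close>

lemma ln_expansion_lower:
  assumes ps: "aug_path letters ps"
    and z: "z > 0" "z \<le> 1"
  shows "ln (expansion z ps) \<ge> (\<Sum>n=1..L. z ^ n / real n)
    - (\<Sum>n=1..L. renewal p (code_after letters ps) n)
    - (\<Sum>l=1..L. z ^ l) * sqrt (pmax * z) ^ L / (1 - pmax * z)"
proof -
  let ?q = "pmax * z" and ?u = "\<lambda>t. fst (ps ! t)" and ?C = "code_after letters ps"
  let ?T = "\<lambda>t. \<Sum>n=1..L. tau (xwt z (?u t)) (length (?u t)) (snd (ps ! t)) n / real n"
  let ?f = "\<lambda>u. if length u \<le> L then xwt z u ^ (L div length u + 1) else 0"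
  have q: "?q < 1" using z pmax_pos pmax_less_1 mult_left_le[of z pmax] by linarith
  note fin = path_words_props[OF ps(1)]
  have C: "fin_code ?C" by (rule fin_code_code_after[OF fin_code_letters ps])
  have u: "?u t \<noteq> []" if "t < length ps" for t
    using path_words_nonempty[OF fin_code_letters ps(1) that] .
  have "?T t - ?f (?u t) / (1 - ?q) \<le> ln (geo (xwt z (?u t)) (snd (ps ! t)))" if t: "t < length ps" for t
  proof (cases "length (?u t) \<le> L")
    case True
    have x: "0 < xwt z (?u t)" "xwt z (?u t) \<le> ?q" using xwt_pos xwt_le u[OF t] z q by auto
    have "length (?u t) \<ge> 1" using u[OF t] by (cases "?u t") auto
    moreover have "0 \<le> xwt z (?u t)" "xwt z (?u t) < 1" using x q by linarith+
    ultimately have "\<bar>ln (geo (xwt z (?u t)) (snd (ps ! t))) - ?T t\<bar>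
        \<le> xwt z (?u t) ^ (L div length (?u t) + 1) / (1 - xwt z (?u t))"
      by (intro ln_geo_truncation)
    then have "?T t - ?f (?u t) / (1 - xwt z (?u t)) \<le> ln (geo (xwt z (?u t)) (snd (ps ! t)))"
      using True by (simp only: if_True)
    moreover have "?f (?u t) / (1 - xwt z (?u t)) \<le> ?f (?u t) / (1 - ?q)"
      using x q by (intro divide_left_mono) auto
    ultimately show ?thesis by linarith
  next
    case False
    have "tau (xwt z (?u t)) (length (?u t)) (snd (ps ! t)) n = 0" if n: "n \<in> {1..L}" for n
    proof -
      have a: "\<not> length (?u t) dvd n" using n False by (auto dest: dvd_imp_le)
      then have "\<not> (snd (ps ! t) + 1) * length (?u t) dvd n" using dvd_mult_right by blast
      with a show ?thesis by (simp only: tau_def if_False)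
    qed
    then have "?T t = 0" by (intro sum.neutral) auto
    moreover have "ln (geo (xwt z (?u t)) (snd (ps ! t))) \<ge> 0"
      using geo_ge_1[of "xwt z (?u t)"] xwt_pos[OF z(1), of "?u t"] by simp
    ultimately show ?thesis using False by simp
  qed
  then have "ln (expansion z ps) \<ge> (\<Sum>t<length ps. ?T t) - (\<Sum>t<length ps. ?f (?u t)) / (1 - ?q)"
    unfolding ln_expansion[OF z(1)] sum_divide_distrib sum_subtractf[symmetric] by (intro sum_mono) auto
  moreover have "(\<Sum>t<length ps. ?T t) \<ge> (\<Sum>n=1..L. z ^ n / real n - renewal p ?C n)"
    unfolding sum_tau_scaled[OF ps(1)]
  proof (rule sum_mono)
    fix n assume n: "n \<in> {1..L}"
    let ?r = "- fps_nth (logderiv (1 - code_fps p ?C)) n"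
    have r: "0 \<le> ?r" "?r \<le> real n * renewal p ?C n"
      using logderiv_code_bounds[OF C, of p n] p_pos n by (auto simp: less_imp_le)
    have "z ^ n / real n * ?r \<le> 1 / real n * (real n * renewal p ?C n)"
      using z r by (intro mult_mono divide_right_mono power_le_one) auto
    also have "\<dots> = renewal p ?C n" using n by simp
    finally show "z ^ n / real n - renewal p ?C n
        \<le> z ^ n / real n * (1 + fps_nth (logderiv (1 - code_fps p ?C)) n)"
      by (simp add: algebra_simps)
  qed
  moreover have "(\<Sum>t<length ps. ?f (?u t)) \<le> (\<Sum>l=1..L. z ^ l) * sqrt ?q ^ L"
  proof -
    have "(\<Sum>t<length ps. ?f (?u t)) = (\<Sum>u\<in>path_words ps. ?f u)"
      by (rule sum_path_words[OF ps(1)])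
    also have "\<dots> = (\<Sum>u\<in>{u\<in>path_words ps. length u \<le> L}. xwt z u ^ (L div length u + 1))"
      using fin(1) by (intro sum.mono_neutral_cong_right) auto
    also have "\<dots> \<le> (\<Sum>l=1..L. z ^ l) * sqrt ?q ^ L"
      using fin z q by (intro sum_short_words) auto
    finally show ?thesis .
  qed
  then have "(\<Sum>t<length ps. ?f (?u t)) / (1 - ?q) \<le> (\<Sum>l=1..L. z ^ l) * sqrt ?q ^ L / (1 - ?q)"
    using q by (intro divide_right_mono) auto
  ultimately show ?thesis by (simp add: sum_subtractf)
qed

text \<open>The letters weighted by p(a)^(1+s) / \<open>psi s\<close> have total weight one, and
  then the factor 1 - 1 = 0 makes the total one for every code on a path.\<close>

lemma sum_tilted_code:
  assumes ps: "aug_path letters ps"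
  shows "(\<Sum>c\<in>code_after letters ps. wt p c powr (1 + s) / psi s ^ length c) = 1"
proof -
  let ?y = "\<lambda>a. p a powr (1 + s) / psi s"
  have wty: "wt ?y c = wt p c powr (1 + s) / psi s ^ length c" for c
    unfolding wt_powr[symmetric] by (induction c) auto
  have "(\<Sum>a\<in>UNIV. ?y a) = 1"
    using psi_pos[of s] by (simp add: sum_divide_distrib[symmetric] psi_def[symmetric])
  then show ?thesis
    using sum_code_after[OF fin_code_letters ps, of ?y] unfolding sum_letters by (simp add: wty)
qed

text \<open>Split p(c) = p(c)^s p(c)^(1-s). The first factor is at most \<rho>^s by lightness, and
  the second is the tilted weight of c times the power |c| of \<open>psi (- s)\<close>.\<close>

lemma renewal_no_heavy:
  assumes ps: "aug_path letters ps" and s: "0 \<le> s" and \<rho>: "\<rho> > 0"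
    and light: "\<And>c. c \<in> code_after letters ps \<Longrightarrow> wt p c \<le> \<rho>"
    and n: "n \<ge> 1"
  shows "renewal p (code_after letters ps) n \<le> \<rho> powr s * psi (- s) ^ n"
proof (rule renewal_le[where b = "\<lambda>c. wt p c powr (1 + - s) / psi (- s) ^ length c"])
  show "fin_code (code_after letters ps)" by (rule fin_code_code_after[OF fin_code_letters ps])
  show "(\<Sum>c\<in>code_after letters ps. wt p c powr (1 + - s) / psi (- s) ^ length c) \<le> 1"
    using sum_tilted_code[OF ps, of "- s"] by simp
  fix c assume c: "c \<in> code_after letters ps"
  have eq: "psi (- s) ^ length c * (wt p c powr (1 + - s) / psi (- s) ^ length c) = wt p c powr (1 - s)"
    using psi_pos[of "- s"] by simp
  have "wt p c powr 1 \<le> wt p c powr (1 - s)"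
    using wt_pos[of c] wt_le_1[of c] s by (intro powr_mono') auto
  then show "wt p c \<le> psi (- s) ^ length c * (wt p c powr (1 + - s) / psi (- s) ^ length c)"
    unfolding eq using wt_pos[of c] by simp
  have "wt p c = wt p c powr s * wt p c powr (1 - s)"
    using wt_pos[of c] by (simp add: powr_add[symmetric])
  also have "\<dots> \<le> \<rho> powr s * wt p c powr (1 - s)"
    using wt_pos[of c] light[OF c] s by (intro mult_right_mono powr_mono2) auto
  finally show "wt p c \<le> \<rho> powr s * (psi (- s) ^ length c * (wt p c powr (1 + - s) / psi (- s) ^ length c))"
    unfolding eq .
qed (use psi_pos[of "- s"] p_pos n in \<open>auto simp: less_imp_le\<close>)

end

section \<open>Asymptotics of the mean codeword length\<close>

lemma tendsto_harm_minus_ln: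
  assumes "filterlim L at_top F"
  shows "((\<lambda>N. (\<Sum>n=1..L N. 1 / real n) - ln (real (L N))) \<longlongrightarrow> euler_mascheroni) F"
  using filterlim_compose[OF euler_mascheroni_LIMSEQ assms]
  by (simp add: harm_def inverse_eq_divide)

text \<open>Covers the rounding up in \<open>expansion_upper\<close> and the rounding down in
  \<open>expansion_lower\<close>. With k = h and c = (1 \<plusminus> 3e) / h the limit is ln (1
  \<plusminus> 3e), the price of truncating away from ln N / h.\<close>

lemma rounded_ln_asymp:
  fixes L :: "nat \<Rightarrow> nat"
  assumes c: "c > 0" and L: "\<forall>\<^sub>F N in sequentially. \<bar>real (L N) - c * ln (real N)\<bar> \<le> 1"
  shows "filterlim L at_top sequentially"
    and "k > 0 \<Longrightarrow> (\<lambda>N. ln (real (L N)) - ln (ln (real N) / k)) \<longlonglongrightarrow> ln (c * k)"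
proof -
  have "filterlim (\<lambda>N. c * ln (real N) - 1) at_top sequentially" using c by real_asymp
  then have "filterlim (\<lambda>N. real (L N)) at_top sequentially"
    by (rule filterlim_at_top_mono) (use L in \<open>eventually_elim, linarith\<close>)
  then show L_top: "filterlim L at_top sequentially"
    by (simp add: filterlim_sequentially_iff_filterlim_real)
  have ev: "\<forall>\<^sub>F N in sequentially. ln (real N) \<ge> 1" by real_asymp
  have L_lim: "(\<lambda>N. real (L N) / ln (real N)) \<longlonglongrightarrow> c"
  proof (rule tendsto_sandwich)
    show "\<forall>\<^sub>F N in sequentially. (c * ln (real N) - 1) / ln (real N) \<le> real (L N) / ln (real N)"
      "\<forall>\<^sub>F N in sequentially. real (L N) / ln (real N) \<le> (c * ln (real N) + 1) / ln (real N)"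
      using L ev by (eventually_elim, intro divide_right_mono, linarith, linarith)+
    show "(\<lambda>N. (c * ln (real N) - 1) / ln (real N)) \<longlonglongrightarrow> c"
      "(\<lambda>N. (c * ln (real N) + 1) / ln (real N)) \<longlonglongrightarrow> c" by real_asymp+
  qed
  assume k: "k > 0"
  have "(\<lambda>N. ln (real (L N) / ln (real N) * k)) \<longlonglongrightarrow> ln (c * k)"
    using c k by (intro tendsto_ln tendsto_mult L_lim tendsto_const) auto
  moreover have "\<forall>\<^sub>F N in sequentially. L N \<ge> 1"
    using L_top by (simp add: filterlim_at_top)
  then have "\<forall>\<^sub>F N in sequentially.
      ln (real (L N) / ln (real N) * k) = ln (real (L N)) - ln (ln (real N) / k)"
    using ev by eventually_elim (use k in \<open>simp add: ln_mult ln_div\<close>)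
  ultimately show "(\<lambda>N. ln (real (L N)) - ln (ln (real N) / k)) \<longlonglongrightarrow> ln (c * k)"
    by (simp cong: tendsto_cong)
qed

section \<open>Bounds of order ln N for the expansion\<close>

context source
begin

lemma exp_div_ln_tendsto_1: "(\<lambda>N. exp (\<eta> / ln (real N))) \<longlonglongrightarrow> 1"
  by real_asymp

text \<open>Here sqrt pmax serves as a number strictly between pmax and 1 that does not depend on
  N.\<close>

lemma eventually_pmax_mult_le:
  "\<forall>\<^sub>F N in sequentially. pmax * exp (\<eta> / ln (real N)) \<le> sqrt pmax"
proof -
  have "(\<lambda>N. pmax * exp (\<eta> / ln (real N))) \<longlonglongrightarrow> pmax * 1"
    by (intro tendsto_mult tendsto_const exp_div_ln_tendsto_1)
  moreover have "pmax < sqrt pmax"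
    using pmax_pos pmax_less_1 by (intro real_less_rsqrt) (simp add: power2_eq_square)
  ultimately have "\<forall>\<^sub>F N in sequentially. pmax * exp (\<eta> / ln (real N)) < sqrt pmax"
    by (intro order_tendstoD(2)) auto
  then show ?thesis by eventually_elim simp
qed

text \<open>Truncation slightly above ln N / h, at L = (1 + 3e) ln N / h, makes words longer than L
  have probability typically below N^(-(1+e)), so N of them are negligible. The harmonic sum then
  yields \<gamma> + ln (ln N / h) + ln (1 + 3e), and \<open>d0\<close> is the slack left up to ln (1
  + \<epsilon>).\<close>

lemma expansion_upper:
  assumes \<epsilon>: "0 < \<epsilon>"
  shows "\<exists>\<eta>>0. \<forall>\<^sub>F N in sequentially. \<forall>ps. aug_path letters ps \<longrightarrow> length ps \<le> N \<longrightarrow>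
    expansion (exp (\<eta> / ln (real N))) ps \<le> exp euler_mascheroni * (1 + \<epsilon>) * ln (real N) / h"
proof -
  define e where "e = \<epsilon> / 6"
  have e: "e > 0" using \<epsilon> by (simp add: e_def)
  define d0 where "d0 = ln (1 + \<epsilon>) - ln (1 + 3 * e)"
  have d0: "d0 > 0" using \<epsilon> by (simp add: d0_def e_def)
  define K where "K = (1 + 3 * e) / h + 1"
  have K: "K > 0" using e h_pos by (simp add: K_def add_pos_pos)
  \<comment> \<open>K ln N bounds L, so z^n is at most exp 1 and hence at most 3 for all n up to L,
    and the total loss 3 \<eta> K in the harmonic sum is at most d0 / 2.\<close>
  define \<eta> where "\<eta> = min 1 (d0 / 6) / K"
  have \<eta>: "\<eta> > 0" "\<eta> * K \<le> 1" "\<eta> * K \<le> d0 / 6" using d0 K by (auto simp: \<eta>_def)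
  \<comment> \<open>The error allowed in the linear bound for \<open>psi\<close> is tuned so that
    the decay at length L is N^(-s (1 + 2e)): exactly one of the three e is spent.\<close>
  define \<eta>1 where "\<eta>1 = h * e / (1 + 3 * e)"
  have \<eta>1: "\<eta>1 > 0" "\<eta>1 < h" "(h - \<eta>1) * (1 + 3 * e) = h * (1 + 2 * e)"
    using h_pos e by (auto simp: \<eta>1_def field_simps intro: add_pos_pos)
  obtain s0 where s0: "s0 > 0" "\<And>s. 0 < \<bar>s\<bar> \<Longrightarrow> \<bar>s\<bar> < s0 \<Longrightarrow> psi s \<le> 1 - h * s + \<eta>1 * \<bar>s\<bar>"
    using psi_near_0[OF \<eta>1(1)] by blast
  define s where "s = min s0 1 / 2"
  have s: "0 < s" "s < 1" "s < s0" using s0(1) by (auto simp: s_def)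
  \<comment> \<open>Makes (1 + e) \<delta> half of the margin s e between (1 + e) s and (1 + 2e) s;
    the other half remains as the decay N^(-s e / 2).\<close>
  define \<delta> where "\<delta> = s * e / 2 / (1 + e)"
  have "1 + e \<noteq> 0" using e by simp
  then have \<delta>_eq: "(1 + e) * \<delta> = s * e / 2" unfolding \<delta>_def by (metis nonzero_mult_div_cancel_left times_divide_eq_right)
  have "s * e < 1 * (2 * (1 + e))" using s e by (intro mult_strict_mono) auto
  then have \<delta>: "0 < \<delta>" "\<delta> < 1" using s e by (auto simp: \<delta>_def)
  have expo1: "1 - (1 + e) * (1 - \<delta>) < 0"
  proof -
    have "s * e < 2 * e" using s e by (intro mult_strict_right_mono) auto
    then show ?thesis using \<delta>_eq by (simp add: algebra_simps)
  qed
  have psi1: "psi s \<le> 1 - s * (h - \<eta>1)" using s0(2)[of s] s by (simp add: algebra_simps)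
  moreover have "s * (h - \<eta>1) > 0" using s \<eta>1 by simp
  ultimately have psi_lt: "psi s < 1" by linarith
  have psi_exp: "psi s \<le> exp (- (s * (h - \<eta>1)))"
    using psi1 exp_ge_add_one_self[of "- (s * (h - \<eta>1))"] by linarith
  define L where "L N = nat \<lceil>(1 + 3 * e) * ln (real N) / h\<rceil>" for N :: nat
  have L_round: "\<forall>\<^sub>F N in sequentially. \<bar>real (L N) - (1 + 3 * e) / h * ln (real N)\<bar> \<le> 1"
    using eventually_gt_at_top[of 1]
  proof eventually_elim
    case (elim N)
    then have "(1 + 3 * e) * ln (real N) / h \<ge> 0" using e h_pos by simp
    then show ?case unfolding L_def by simp linarith
  qed
  have c: "(1 + 3 * e) / h > 0" using e h_pos by simp
  note L_top = rounded_ln_asymp(1)[OF c L_round]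
  have L_ln: "(\<lambda>N. ln (real (L N)) - ln (ln (real N) / h)) \<longlonglongrightarrow> ln (1 + 3 * e)"
    using rounded_ln_asymp(2)[OF c L_round h_pos] h_pos by simp
  define z where "z N = exp (\<eta> / ln (real N))" for N :: nat
  define \<rho> where "\<rho> N = real N powr (- (1 + e))" for N :: nat
  define \<theta> where "\<theta> = sqrt (sqrt pmax)"
  have \<theta>: "0 < \<theta>" "\<theta> < 1" using pmax_pos pmax_less_1 by (auto simp: \<theta>_def)
  define err where "err N = (3 * (real (L N) * \<theta> ^ L N) + (real N powr (1 - (1 + e) * (1 - \<delta>))
    + real N powr (- (s * e / 2)) / (1 - psi s))) / (1 - sqrt pmax)" for N
  have "(\<lambda>N. real (L N) * \<theta> ^ L N) \<longlonglongrightarrow> 0"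
    using filterlim_compose[OF powser_times_n_limit_0[of \<theta>] L_top] \<theta> by simp
  moreover have "(\<lambda>N. real N powr (1 - (1 + e) * (1 - \<delta>))) \<longlonglongrightarrow> 0"
    by (rule tendsto_neg_powr[OF expo1 filterlim_real_sequentially])
  moreover have "(\<lambda>N. real N powr (- (s * e / 2))) \<longlonglongrightarrow> 0"
    using s e by (intro tendsto_neg_powr filterlim_real_sequentially) auto
  ultimately have "err \<longlonglongrightarrow> (3 * 0 + (0 + 0 / (1 - psi s))) / (1 - sqrt pmax)"
    unfolding err_def using psi_lt pmax_less_1 by (intro tendsto_intros) auto
  then have err0: "err \<longlonglongrightarrow> 0" by simp
  have "(\<lambda>N. ((\<Sum>n=1..L N. 1 / real n) - ln (real (L N))) + (ln (real (L N)) - ln (ln (real N) / h)) + err N)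
    \<longlonglongrightarrow> euler_mascheroni + ln (1 + 3 * e) + 0"
    by (intro tendsto_add tendsto_harm_minus_ln L_top L_ln err0)
  then have ev1: "\<forall>\<^sub>F N in sequentially. ((\<Sum>n=1..L N. 1 / real n) - ln (real (L N)))
     + (ln (real (L N)) - ln (ln (real N) / h)) + err N < euler_mascheroni + ln (1 + 3 * e) + d0 / 2"
    using d0 by (intro order_tendstoD(2)[where a = "euler_mascheroni + ln (1 + 3 * e) + d0 / 2"]) auto
  have zlim: "z \<longlonglongrightarrow> 1" unfolding z_def[abs_def] by (rule exp_div_ln_tendsto_1)
  have "(\<lambda>N. pmax powr \<delta> * z N) \<longlonglongrightarrow> pmax powr \<delta> * 1"
    by (intro tendsto_mult tendsto_const zlim)
  moreover have "pmax powr \<delta> < 1" using powr_less_mono2[of \<delta> pmax 1] pmax_pos pmax_less_1 \<delta> by simp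
  ultimately have ev2: "\<forall>\<^sub>F N in sequentially. pmax powr \<delta> * z N < 1"
    by (intro order_tendstoD(2)[where a = 1]) auto
  have ev3: "\<forall>\<^sub>F N in sequentially. ln (real N) \<ge> 1" by real_asymp
  have "\<forall>\<^sub>F N in sequentially. \<forall>ps. aug_path letters ps \<longrightarrow> length ps \<le> N \<longrightarrow>
    expansion (z N) ps \<le> exp euler_mascheroni * (1 + \<epsilon>) * ln (real N) / h"
    using ev1 ev2 ev3 eventually_pmax_mult_le[of \<eta>] eventually_gt_at_top[of 1]
  proof eventually_elim
    case (elim N)
    have N: "real N > 1" using elim(5) by simp
    have lnN: "ln (real N) > 0" using N by simp
    have z1: "z N \<ge> 1" unfolding z_def using \<eta> lnN by simp
    have q: "pmax * z N \<le> sqrt pmax" "sqrt pmax < 1" "pmax * z N > 0"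
      using elim(4) pmax_pos pmax_less_1 z1 by (auto simp: z_def)
    have q1: "pmax * z N < 1" using q(1,2) by linarith
    have L_le: "real (L N) \<le> (1 + 3 * e) * ln (real N) / h + 1"
      unfolding L_def using e h_pos lnN by (simp add: of_nat_ceiling)
    have L_ge: "real (L N + 1) \<ge> (1 + 3 * e) * ln (real N) / h"
      unfolding L_def by linarith
    have "real (L N) \<le> K * ln (real N)"
      using L_le elim(3) by (simp add: K_def algebra_simps)
    then have "\<eta> / ln (real N) * real (L N) \<le> \<eta> / ln (real N) * (K * ln (real N))"
      using \<eta> lnN by (intro mult_left_mono) auto
    then have lamL: "\<eta> / ln (real N) * real (L N) \<le> \<eta> * K" using lnN by simp
    have exp3: "exp (\<eta> * K) \<le> 3" using \<eta>(2) exp_le by (meson exp_le_cancel_iff order_trans)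
    have zn: "z N ^ n = exp (\<eta> / ln (real N) * real n)" for n
      unfolding z_def by (simp add: exp_of_nat_mult[symmetric] mult.commute)
    have zn3: "z N ^ n \<le> 3" if "n \<le> L N" for n
    proof -
      have "\<eta> / ln (real N) * real n \<le> \<eta> / ln (real N) * real (L N)"
        using that \<eta> lnN by (intro mult_left_mono) auto
      then have "z N ^ n \<le> exp (\<eta> * K)" unfolding zn using lamL by simp
      then show ?thesis using exp3 by simp
    qed
    have S1: "(\<Sum>n=1..L N. z N ^ n / real n) \<le> (\<Sum>n=1..L N. 1 / real n) + d0 / 2"
    proof -
      have "z N ^ n / real n \<le> 1 / real n + 3 * (\<eta> / ln (real N))" if n: "n \<in> {1..L N}" for n
      proof -
        let ?x = "\<eta> / ln (real N) * real n"
        \<comment> \<open>Multiplying by exp x gives exp x \<le> 1 + x exp x. Since x is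
          proportional to n, division by n leaves a loss of 3 \<eta> / ln N per term.\<close>
        have "1 - ?x \<le> exp (- ?x)" using exp_ge_add_one_self[of "- ?x"] by simp
        then have "exp ?x * (1 - ?x) \<le> exp ?x * exp (- ?x)" by (intro mult_left_mono) auto
        then have "z N ^ n \<le> 1 + z N ^ n * ?x"
          unfolding zn by (simp add: exp_minus_inverse right_diff_distrib)
        also have "\<dots> \<le> 1 + 3 * ?x" using zn3[of n] n \<eta> lnN by (intro add_left_mono mult_right_mono) auto
        finally show ?thesis using n by (simp add: field_simps)
      qed
      then have "(\<Sum>n=1..L N. z N ^ n / real n) \<le> (\<Sum>n=1..L N. 1 / real n + 3 * (\<eta> / ln (real N)))"
        by (rule sum_mono)
      also have "\<dots> = (\<Sum>n=1..L N. 1 / real n) + 3 * (\<eta> / ln (real N) * real (L N))"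
        by (simp add: sum.distrib)
      finally show ?thesis using lamL \<eta>(3) by linarith
    qed
    have S2: "(\<Sum>l=1..L N. z N ^ l) * sqrt (pmax * z N) ^ L N \<le> 3 * (real (L N) * \<theta> ^ L N)"
    proof -
      have "(\<Sum>l=1..L N. z N ^ l) \<le> (\<Sum>l=1..L N. 3)" by (intro sum_mono zn3) auto
      moreover have "sqrt (pmax * z N) ^ L N \<le> \<theta> ^ L N"
        unfolding \<theta>_def using q by (intro power_mono) auto
      ultimately have "(\<Sum>l=1..L N. z N ^ l) * sqrt (pmax * z N) ^ L N \<le> (3 * real (L N)) * \<theta> ^ L N"
        using q \<theta> by (intro mult_mono) auto
      then show ?thesis by simp
    qed
    have S3: "real N * \<rho> N powr (1 - \<delta>) = real N powr (1 - (1 + e) * (1 - \<delta>))"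
    proof -
      have "real N * \<rho> N powr (1 - \<delta>) = real N powr 1 * real N powr (- (1 + e) * (1 - \<delta>))"
        unfolding \<rho>_def powr_powr using N by simp
      also have "\<dots> = real N powr (1 - (1 + e) * (1 - \<delta>))"
        unfolding powr_add[symmetric] by (simp add: algebra_simps)
      finally show ?thesis .
    qed
    have S4: "\<rho> N powr (- (s + \<delta>)) * psi s ^ (L N + 1) \<le> real N powr (- (s * e / 2))"
    proof -
      have "psi s ^ (L N + 1) \<le> exp (- (s * (h - \<eta>1))) ^ (L N + 1)"
        using psi_exp psi_pos[of s] by (intro power_mono) auto
      also have "\<dots> = exp (- (s * (h - \<eta>1)) * real (L N + 1))"
        by (simp only: exp_of_nat_mult[symmetric] mult.commute)
      also have "\<dots> \<le> exp (- (s * (h - \<eta>1)) * ((1 + 3 * e) * ln (real N) / h))"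
        using L_ge s \<eta>1 by (intro exp_le_cancel_iff[THEN iffD2] mult_left_mono_neg) auto
      also have "- (s * (h - \<eta>1)) * ((1 + 3 * e) * ln (real N) / h)
          = - (s * ((h - \<eta>1) * (1 + 3 * e)) * ln (real N) / h)" by simp
      also have "\<dots> = (- (s * (1 + 2 * e))) * ln (real N)"
        unfolding \<eta>1(3) using h_pos by simp
      also have "exp \<dots> = real N powr (- (s * (1 + 2 * e)))"
        using N by (simp add: powr_def)
      finally have "psi s ^ (L N + 1) \<le> real N powr (- (s * (1 + 2 * e)))" .
      then have "\<rho> N powr (- (s + \<delta>)) * psi s ^ (L N + 1)
          \<le> \<rho> N powr (- (s + \<delta>)) * real N powr (- (s * (1 + 2 * e)))" by (intro mult_left_mono) auto
      also have "\<dots> = real N powr ((1 + e) * (s + \<delta>) - s * (1 + 2 * e))"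
        unfolding \<rho>_def powr_powr powr_add[symmetric] by (simp add: algebra_simps)
      also have "(1 + e) * (s + \<delta>) - s * (1 + 2 * e) = (1 + e) * \<delta> - s * e" by (simp add: algebra_simps)
      also note \<delta>_eq
      also have "s * e / 2 - s * e = - (s * e / 2)" by linarith
      finally show ?thesis .
    qed
    show ?case
    proof (intro allI impI)
      fix ps :: "('a list \<times> nat) list" assume ps: "aug_path letters ps" "length ps \<le> N"
      have "ln (expansion (z N) ps) \<le> (\<Sum>n=1..L N. z N ^ n / real n)
        + ((\<Sum>l=1..L N. z N ^ l) * sqrt (pmax * z N) ^ L N
           + (real N * \<rho> N powr (1 - \<delta>) + \<rho> N powr (- (s + \<delta>)) * (psi s ^ (L N + 1) / (1 - psi s))))
          / (1 - pmax * z N)"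
        using z1 q1 elim(2) \<delta> s psi_lt N by (intro ln_expansion_upper[OF ps]) (auto simp: \<rho>_def)
      also have "\<dots> \<le> ((\<Sum>n=1..L N. 1 / real n) + d0 / 2) + err N"
      proof (rule add_mono[OF S1])
        have "\<rho> N powr (- (s + \<delta>)) * (psi s ^ (L N + 1) / (1 - psi s)) \<le> real N powr (- (s * e / 2)) / (1 - psi s)"
          using S4 psi_lt by (simp add: divide_right_mono)
        then have "(\<Sum>l=1..L N. z N ^ l) * sqrt (pmax * z N) ^ L N
           + (real N * \<rho> N powr (1 - \<delta>) + \<rho> N powr (- (s + \<delta>)) * (psi s ^ (L N + 1) / (1 - psi s)))
           \<le> 3 * (real (L N) * \<theta> ^ L N) + (real N powr (1 - (1 + e) * (1 - \<delta>))
              + real N powr (- (s * e / 2)) / (1 - psi s))" (is "?A \<le> ?B")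
          using S2 unfolding S3 by linarith
        moreover have "?B \<ge> 0" using \<theta> psi_lt by (intro add_nonneg_nonneg) auto
        ultimately show "?A / (1 - pmax * z N) \<le> err N"
          unfolding err_def using q by (intro frac_le) auto
      qed
      also have "\<dots> < euler_mascheroni + ln (ln (real N) / h) + (ln (1 + 3 * e) + d0)"
        using elim(1) by linarith
      also have "ln (1 + 3 * e) + d0 = ln (1 + \<epsilon>)" by (simp add: d0_def)
      finally have "ln (expansion (z N) ps) \<le> euler_mascheroni + ln (ln (real N) / h) + ln (1 + \<epsilon>)" by simp
      then have "exp (ln (expansion (z N) ps)) \<le> exp (euler_mascheroni + ln (ln (real N) / h) + ln (1 + \<epsilon>))"
        by simp
      moreover have "exp (ln (expansion (z N) ps)) = expansion (z N) ps"
        using expansion_ge_1[of "z N" ps] z1 by simp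
      ultimately have "expansion (z N) ps \<le> exp (euler_mascheroni + ln (ln (real N) / h) + ln (1 + \<epsilon>))"
        by simp
      also have "\<dots> = exp euler_mascheroni * (1 + \<epsilon>) * ln (real N) / h"
        using lnN h_pos \<epsilon> by (simp add: exp_add)
      finally show "expansion (z N) ps \<le> exp euler_mascheroni * (1 + \<epsilon>) * ln (real N) / h" .
    qed
  qed
  then show ?thesis using \<eta>(1) unfolding z_def by blast
qed

text \<open>Truncation slightly below ln N / h. If all codewords weigh at most N^(-1+e), the renewal
  sequence of the final code is still negligible up to L, so the code costs almost nothing in the
  comparison with the harmonic sum.\<close>

lemma expansion_lower:
  assumes \<epsilon>: "0 < \<epsilon>" "\<epsilon> < 1"
  shows "\<exists>e>0. e < 1 \<and> (\<exists>\<eta>>0. \<forall>\<^sub>F N in sequentially. \<forall>ps. aug_path letters ps \<longrightarrow>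
    (\<forall>c\<in>code_after letters ps. wt p c \<le> real N powr (- 1 + e)) \<longrightarrow>
    expansion (exp (- \<eta> / ln (real N))) ps \<ge> exp euler_mascheroni * (1 - \<epsilon>) * ln (real N) / h)"
proof -
  define e where "e = \<epsilon> / 6"
  have e: "e > 0" "3 * e < 1" using \<epsilon> by (simp_all add: e_def)
  define d0 where "d0 = ln (1 - 3 * e) - ln (1 - \<epsilon>)"
  have d0: "d0 > 0" using \<epsilon> by (simp add: d0_def e_def)
  \<comment> \<open>As L is at most ln N / h, replacing z^n by 1 costs at most \<eta> / h = d0 / 2
    in total.\<close>
  define \<eta> where "\<eta> = h * d0 / 2"
  have \<eta>: "\<eta> > 0" using h_pos d0 by (simp add: \<eta>_def)
  define \<eta>1 where "\<eta>1 = h * e"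
  have \<eta>1: "\<eta>1 > 0" using h_pos e by (auto simp: \<eta>1_def)
  obtain s0 where s0: "s0 > 0" "\<And>s. 0 < \<bar>s\<bar> \<Longrightarrow> \<bar>s\<bar> < s0 \<Longrightarrow> psi s \<le> 1 - h * s + \<eta>1 * \<bar>s\<bar>"
    using psi_near_0[OF \<eta>1(1)] by blast
  define s where "s = s0 / 2"
  have s: "0 < s" "s < s0" using s0(1) by (auto simp: s_def)
  have "psi (- s) \<le> 1 + s * (h * (1 + e))"
    using s0(2)[of "- s"] s by (simp add: algebra_simps \<eta>1_def)
  then have psi_exp: "psi (- s) \<le> exp (s * (h * (1 + e)))"
    using exp_ge_add_one_self[of "s * (h * (1 + e))"] by linarith
  \<comment> \<open>For n up to this L the renewal bound is at most N^(-s (1-e)) N^(s (1+e) (1-3e)),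
    hence at most N^(-s e), which survives summation over L terms.\<close>
  define L where "L N = nat \<lfloor>(1 - 3 * e) * ln (real N) / h\<rfloor>" for N :: nat
  have e3: "1 - 3 * e > 0" using e by simp
  have L_round: "\<forall>\<^sub>F N in sequentially. \<bar>real (L N) - (1 - 3 * e) / h * ln (real N)\<bar> \<le> 1"
    using eventually_gt_at_top[of 1]
  proof eventually_elim
    case (elim N)
    then have "(1 - 3 * e) * ln (real N) / h \<ge> 0" using e h_pos by simp
    then show ?case unfolding L_def by simp linarith
  qed
  have c: "(1 - 3 * e) / h > 0" using e h_pos by simp
  note L_top = rounded_ln_asymp(1)[OF c L_round]
  have L_ln: "(\<lambda>N. ln (real (L N)) - ln (ln (real N) / h)) \<longlonglongrightarrow> ln (1 - 3 * e)"
    using rounded_ln_asymp(2)[OF c L_round h_pos] h_pos by simp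
  define z where "z N = exp (- \<eta> / ln (real N))" for N :: nat
  define \<rho> where "\<rho> N = real N powr (- 1 + e)" for N :: nat
  define \<theta> where "\<theta> = sqrt pmax"
  have \<theta>: "0 < \<theta>" "\<theta> < 1" using pmax_pos pmax_less_1 by (auto simp: \<theta>_def)
  define err where "err N = real (L N) * \<theta> ^ L N / (1 - pmax) + ln (real N) * real N powr (- (s * e)) / h" for N
  have "(\<lambda>N. real (L N) * \<theta> ^ L N) \<longlonglongrightarrow> 0"
    using filterlim_compose[OF powser_times_n_limit_0[of \<theta>] L_top] \<theta> by simp
  moreover have "(\<lambda>N. ln (real N) * real N powr (- (s * e))) \<longlonglongrightarrow> 0"
  proof -
    have "s * e > 0" using s e by simp
    then show ?thesis by real_asymp
  qed
  ultimately have "err \<longlonglongrightarrow> 0 / (1 - pmax) + 0 / h"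
    unfolding err_def using h_pos pmax_less_1 by (intro tendsto_intros) auto
  then have err0: "err \<longlonglongrightarrow> 0" by simp
  have "(\<lambda>N. ((\<Sum>n=1..L N. 1 / real n) - ln (real (L N))) + (ln (real (L N)) - ln (ln (real N) / h)) - err N)
    \<longlonglongrightarrow> euler_mascheroni + ln (1 - 3 * e) - 0"
    by (intro tendsto_add tendsto_diff tendsto_harm_minus_ln L_top L_ln err0)
  then have ev1: "\<forall>\<^sub>F N in sequentially. ((\<Sum>n=1..L N. 1 / real n) - ln (real (L N)))
     + (ln (real (L N)) - ln (ln (real N) / h)) - err N > euler_mascheroni + ln (1 - 3 * e) - d0 / 2"
    using d0 by (intro order_tendstoD(1)[where a = "euler_mascheroni + ln (1 - 3 * e) - d0 / 2"]) auto
  have "\<forall>\<^sub>F N in sequentially. \<forall>ps. aug_path letters ps \<longrightarrow>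
    (\<forall>c\<in>code_after letters ps. wt p c \<le> real N powr (- 1 + e)) \<longrightarrow>
    expansion (z N) ps \<ge> exp euler_mascheroni * (1 - \<epsilon>) * ln (real N) / h"
    using ev1 eventually_gt_at_top[of 1]
  proof eventually_elim
    case (elim N)
    have N: "real N > 1" using elim(2) by simp
    have lnN: "ln (real N) > 0" using N by simp
    have z1: "z N \<le> 1" "z N > 0" unfolding z_def using \<eta> lnN by simp_all
    have q: "pmax * z N \<le> pmax" "0 < pmax * z N" using pmax_pos z1 by (auto simp: mult_left_le)
    have "0 \<le> (1 - 3 * e) * ln (real N) / h" using e3 lnN h_pos by simp
    then have L_le: "real (L N) \<le> (1 - 3 * e) * ln (real N) / h"
      unfolding L_def by linarith
    have "\<dots> \<le> 1 * ln (real N) / h" using e lnN h_pos by (intro divide_right_mono mult_right_mono) auto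
    then have L_le': "real (L N) \<le> ln (real N) / h" using L_le by simp
    have "\<eta> / ln (real N) * real (L N) \<le> \<eta> / ln (real N) * (ln (real N) / h)"
      using L_le' \<eta> lnN by (intro mult_left_mono) auto
    then have lamL: "\<eta> / ln (real N) * real (L N) \<le> d0 / 2" using lnN h_pos by (simp add: \<eta>_def)
    have zn: "z N ^ n = exp (- (\<eta> / ln (real N) * real n))" for n
      unfolding z_def by (simp add: exp_of_nat_mult[symmetric] mult.commute)
    have S1: "(\<Sum>n=1..L N. z N ^ n / real n) \<ge> (\<Sum>n=1..L N. 1 / real n) - d0 / 2"
    proof -
      have "1 / real n - \<eta> / ln (real N) \<le> z N ^ n / real n" if n: "n \<in> {1..L N}" for n
      proof -
        have "1 - \<eta> / ln (real N) * real n \<le> z N ^ n"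
          unfolding zn using exp_ge_add_one_self[of "- (\<eta> / ln (real N) * real n)"] by simp
        then have "(1 - \<eta> / ln (real N) * real n) / real n \<le> z N ^ n / real n"
          by (intro divide_right_mono) auto
        then show ?thesis using n by (simp add: diff_divide_distrib)
      qed
      then have "(\<Sum>n=1..L N. 1 / real n - \<eta> / ln (real N)) \<le> (\<Sum>n=1..L N. z N ^ n / real n)"
        by (rule sum_mono)
      then show ?thesis using lamL by (simp add: sum_subtractf mult.commute)
    qed
    have S2: "(\<Sum>l=1..L N. z N ^ l) * sqrt (pmax * z N) ^ L N / (1 - pmax * z N) \<le> real (L N) * \<theta> ^ L N / (1 - pmax)"
    proof (intro frac_le)
      have "(\<Sum>l=1..L N. z N ^ l) \<le> (\<Sum>l=1..L N. 1)" using z1 by (intro sum_mono power_le_one) auto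
      moreover have "sqrt (pmax * z N) ^ L N \<le> \<theta> ^ L N"
        unfolding \<theta>_def using q by (intro power_mono) auto
      ultimately show "(\<Sum>l=1..L N. z N ^ l) * sqrt (pmax * z N) ^ L N \<le> real (L N) * \<theta> ^ L N"
        using q by (intro mult_mono) auto
    qed (use pmax_less_1 q \<theta> in auto)
    show ?case
    proof (intro allI impI)
      fix ps :: "('a list \<times> nat) list" assume ps: "aug_path letters ps"
        and light: "\<forall>c\<in>code_after letters ps. wt p c \<le> real N powr (- 1 + e)"
      have "renewal p (code_after letters ps) n \<le> real N powr (- (s * e))" if n: "n \<in> {1..L N}" for n
      proof -
        have "renewal p (code_after letters ps) n \<le> \<rho> N powr s * psi (- s) ^ n"
          using n light s N by (intro renewal_no_heavy[OF ps]) (auto simp: \<rho>_def)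
        also have "psi (- s) ^ n \<le> exp (s * (h * (1 + e))) ^ n"
          using psi_exp psi_pos[of "- s"] by (intro power_mono) auto
        also have "\<dots> = exp (s * (h * (1 + e)) * real n)" by (simp only: exp_of_nat_mult[symmetric] mult.commute)
        also have "\<dots> \<le> exp (s * (h * (1 + e)) * ((1 - 3 * e) * ln (real N) / h))"
        proof -
          have "real n \<le> (1 - 3 * e) * ln (real N) / h" using n L_le by (auto intro: order_trans)
          then show ?thesis using s h_pos e by (intro exp_le_cancel_iff[THEN iffD2] mult_left_mono) auto
        qed
        also have "\<dots> = real N powr (s * ((1 + e) * (1 - 3 * e)))"
          using N h_pos by (simp add: powr_def)
        also have "\<dots> \<le> real N powr (s * (1 - 2 * e))"
          using N s e by (intro powr_mono mult_left_mono) (auto simp: algebra_simps)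
        also have "\<rho> N powr s * real N powr (s * (1 - 2 * e)) = real N powr (- (s * e))"
          unfolding \<rho>_def powr_powr powr_add[symmetric] by (simp add: algebra_simps)
        finally show ?thesis by (simp add: mult_left_mono)
      qed
      then have "(\<Sum>n=1..L N. renewal p (code_after letters ps) n) \<le> (\<Sum>n=1..L N. real N powr (- (s * e)))"
        by (rule sum_mono)
      also have "\<dots> = real (L N) * real N powr (- (s * e))" by simp
      also have "\<dots> \<le> ln (real N) / h * real N powr (- (s * e))"
        using L_le' by (intro mult_right_mono) auto
      finally have S3: "(\<Sum>n=1..L N. renewal p (code_after letters ps) n)
          \<le> ln (real N) * real N powr (- (s * e)) / h" by simp
      have "ln (expansion (z N) ps) \<ge> (\<Sum>n=1..L N. z N ^ n / real n)
        - (\<Sum>n=1..L N. renewal p (code_after letters ps) n)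
        - (\<Sum>l=1..L N. z N ^ l) * sqrt (pmax * z N) ^ L N / (1 - pmax * z N)"
        by (rule ln_expansion_lower[OF ps z1(2,1)])
      then have "ln (expansion (z N) ps) \<ge> (\<Sum>n=1..L N. 1 / real n) - d0 / 2 - err N"
        using S1 S2 S3 unfolding err_def by linarith
      then have "ln (expansion (z N) ps) \<ge> euler_mascheroni + ln (ln (real N) / h) + (ln (1 - 3 * e) - d0)"
        using elim(1) by linarith
      also have "ln (1 - 3 * e) - d0 = ln (1 - \<epsilon>)" by (simp add: d0_def)
      finally have *: "euler_mascheroni + ln (ln (real N) / h) + ln (1 - \<epsilon>) \<le> ln (expansion (z N) ps)" .
      have "exp euler_mascheroni * (1 - \<epsilon>) * ln (real N) / h
          = exp (euler_mascheroni + ln (ln (real N) / h) + ln (1 - \<epsilon>))"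
        using lnN h_pos \<epsilon> by (simp add: exp_add)
      also have "\<dots> \<le> exp (ln (expansion (z N) ps))" using * by simp
      also have "\<dots> = expansion (z N) ps" using expansion_ge_1[OF z1(2), of ps] by simp
      finally show "expansion (z N) ps \<ge> exp euler_mascheroni * (1 - \<epsilon>) * ln (real N) / h" .
    qed
  qed
  then show ?thesis using \<eta>(1) e unfolding z_def by (intro exI[of _ e] conjI exI[of _ \<eta>]) auto
qed

text \<open>The factors 1 / (1 - x) normalise the geometric distribution of the exponents. Their
  product is at most exp of a constant times the sum of the x, and that sum is O(ln N): each length
  up to O(ln N) contributes O(1), and the at most N longer words contribute 1/N each. A power of N
  is harmless in all later estimates.\<close>

lemma prod_inverse_polynomial:
  assumes \<eta>: "\<eta> > 0"
  shows "\<exists>B. \<forall>\<^sub>F N in sequentially. \<forall>ps. aug_path letters ps \<longrightarrow> length ps \<le> N \<longrightarrow>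
    (\<Prod>t<length ps. 1 / (1 - xwt (exp (\<eta> / ln (real N))) (fst (ps ! t)))) \<le> real N powr B"
proof -
  define \<kappa> where "\<kappa> = - ln (sqrt pmax)"
  have \<kappa>: "\<kappa> > 0" using pmax_pos pmax_less_1 by (simp add: \<kappa>_def)
  \<comment> \<open>Chosen so that sqrt pmax to the power b ln N equals 1/N.\<close>
  define b where "b = 1 / \<kappa>"
  have b: "b > 0" using \<kappa> by (simp add: b_def)
  define B where "B = ((b + 1) * exp (\<eta> * (b + 1)) + 1) / (1 - sqrt pmax)"
  have "\<forall>\<^sub>F N in sequentially. ln (real N) \<ge> 1" by real_asymp
  then have "\<forall>\<^sub>F N in sequentially. \<forall>ps. aug_path letters ps \<longrightarrow> length ps \<le> N \<longrightarrow>
    (\<Prod>t<length ps. 1 / (1 - xwt (exp (\<eta> / ln (real N))) (fst (ps ! t)))) \<le> real N powr B"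
    using eventually_pmax_mult_le[of \<eta>] eventually_gt_at_top[of 1]
  proof eventually_elim
    case (elim N)
    define z where "z = exp (\<eta> / ln (real N))"
    have N: "real N > 1" using elim(3) by simp
    have lnN: "ln (real N) > 0" using N by simp
    have z1: "z \<ge> 1" unfolding z_def using \<eta> lnN by simp
    have q: "pmax * z \<le> sqrt pmax" "sqrt pmax < 1" "pmax * z > 0"
      using elim(2) pmax_pos pmax_less_1 z1 by (auto simp: z_def)
    define L where "L = nat \<lceil>b * ln (real N)\<rceil>"
    have L: "real L \<ge> b * ln (real N)" "real L \<le> (b + 1) * ln (real N)"
      using b lnN elim(1) by (auto simp: L_def of_nat_ceiling distrib_right) linarith
    show ?case
    proof (intro allI impI)
      fix ps :: "('a list \<times> nat) list" assume ps: "aug_path letters ps" "length ps \<le> N"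
      let ?u = "\<lambda>t. fst (ps ! t)"
      note fin = path_words_props[OF ps(1)]
      have short: "(\<Sum>u\<in>{u\<in>path_words ps. length u \<le> L}. xwt z u) \<le> (b + 1) * ln (real N) * exp (\<eta> * (b + 1))"
      proof -
        have "(\<Sum>u\<in>{u\<in>path_words ps. length u \<le> L}. xwt z u) \<le> (\<Sum>n=1..L. \<Sum>u | length u = n. xwt z u)"
          using fin z1 by (intro sum_words_le) (auto simp: Suc_le_eq xwt_pos less_imp_le)
        also have "\<dots> \<le> (\<Sum>n=1..L. exp (\<eta> * (b + 1)))"
          unfolding sum_xwt_length
        proof (intro sum_mono)
          fix n assume "n \<in> {1..L}"
          then have "z ^ n \<le> z ^ L" using z1 by (intro power_increasing) auto
          also have "z ^ L = exp (\<eta> / ln (real N) * real L)"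
            unfolding z_def by (simp add: exp_of_nat_mult[symmetric] mult.commute)
          also have "\<dots> \<le> exp (\<eta> / ln (real N) * ((b + 1) * ln (real N)))"
            using L \<eta> lnN by (intro exp_le_cancel_iff[THEN iffD2] mult_left_mono) auto
          also have "\<dots> = exp (\<eta> * (b + 1))" using lnN by simp
          finally show "z ^ n \<le> exp (\<eta> * (b + 1))" .
        qed
        also have "\<dots> = real L * exp (\<eta> * (b + 1))" by simp
        also have "\<dots> \<le> (b + 1) * ln (real N) * exp (\<eta> * (b + 1))"
          using L by (intro mult_right_mono) auto
        finally show ?thesis .
      qed
      have long: "(\<Sum>u\<in>{u\<in>path_words ps. length u > L}. xwt z u) \<le> 1"
      proof -
        have "xwt z u \<le> 1 / real N" if u: "length u > L" for u
        proof -
          have "xwt z u \<le> (pmax * z) ^ length u"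
            using wt_le_pmax[of u] z1 by (simp add: xwt_def power_mult_distrib mult_right_mono)
          also have "\<dots> \<le> sqrt pmax ^ length u" using q by (intro power_mono) auto
          also have "\<dots> \<le> sqrt pmax ^ L" using q u pmax_pos by (intro power_decreasing) auto
          also have "\<dots> = exp (- \<kappa> * real L)"
            using pmax_pos by (simp add: \<kappa>_def powr_realpow[symmetric] powr_def mult.commute)
          also have "\<dots> \<le> exp (- \<kappa> * (b * ln (real N)))"
            using L(1) \<kappa> by (intro exp_le_cancel_iff[THEN iffD2] mult_left_mono_neg) auto
          also have "\<dots> = 1 / real N" using \<kappa> N by (simp add: b_def exp_minus inverse_eq_divide)
          finally show ?thesis .
        qed
        then have "(\<Sum>u\<in>{u\<in>path_words ps. length u > L}. xwt z u)
            \<le> (\<Sum>u\<in>{u\<in>path_words ps. length u > L}. 1 / real N)" by (intro sum_mono) auto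
        also have "\<dots> \<le> real N * (1 / real N)"
          using fin ps(2) card_mono[of "path_words ps" "{u\<in>path_words ps. length u > L}"]
          by (simp add: divide_right_mono)
        finally show ?thesis using N by simp
      qed
      have "(\<Sum>t<length ps. xwt z (?u t)) = (\<Sum>u\<in>path_words ps. xwt z u)"
        by (rule sum_path_words[OF ps(1)])
      also have "\<dots> = (\<Sum>u\<in>{u\<in>path_words ps. length u \<le> L}. xwt z u) + (\<Sum>u\<in>{u\<in>path_words ps. length u > L}. xwt z u)"
        using fin(1) by (subst sum.union_disjoint[symmetric]) (auto intro!: sum.cong)
      also have "\<dots> \<le> (b + 1) * ln (real N) * exp (\<eta> * (b + 1)) + ln (real N)"
        using short long elim(1) by linarith
      finally have sum: "(\<Sum>t<length ps. xwt z (?u t)) \<le> ((b + 1) * exp (\<eta> * (b + 1)) + 1) * ln (real N)"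
        by (simp add: algebra_simps)
      have "(\<Prod>t<length ps. 1 / (1 - xwt z (?u t))) \<le> (\<Prod>t<length ps. exp (xwt z (?u t) / (1 - sqrt pmax)))"
      proof (intro prod_mono conjI)
        fix t assume "t \<in> {..<length ps}"
        then have "?u t \<noteq> []" using path_words_nonempty[OF fin_code_letters ps(1)] by auto
        then have x: "0 < xwt z (?u t)" "xwt z (?u t) \<le> sqrt pmax"
          using xwt_pos[of z "?u t"] xwt_le[of z "?u t"] z1 q by auto
        then show "0 \<le> 1 / (1 - xwt z (?u t))" using q(2) by (intro divide_nonneg_nonneg) linarith+
        have "1 / (1 - xwt z (?u t)) = 1 + xwt z (?u t) / (1 - xwt z (?u t))"
        proof -
          have "1 - xwt z (?u t) \<noteq> 0" using x(2) q(2) by linarith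
          then show ?thesis by (simp add: field_simps)
        qed
        also have "\<dots> \<le> 1 + xwt z (?u t) / (1 - sqrt pmax)"
          using x q(2) by (intro add_left_mono divide_left_mono mult_pos_pos) linarith+
        also have "\<dots> \<le> exp (xwt z (?u t) / (1 - sqrt pmax))" by (rule exp_ge_add_one_self)
        finally show "1 / (1 - xwt z (?u t)) \<le> exp (xwt z (?u t) / (1 - sqrt pmax))" .
      qed
      also have "\<dots> = exp ((\<Sum>t<length ps. xwt z (?u t)) / (1 - sqrt pmax))"
        by (simp add: exp_sum sum_divide_distrib)
      also have "\<dots> \<le> exp (((b + 1) * exp (\<eta> * (b + 1)) + 1) * ln (real N) / (1 - sqrt pmax))"
        using sum q by (intro exp_le_cancel_iff[THEN iffD2] divide_right_mono) auto
      also have "\<dots> = real N powr B" using N by (simp add: powr_def B_def)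
      finally show "(\<Prod>t<length ps. 1 / (1 - xwt (exp (\<eta> / ln (real N))) (?u t))) \<le> real N powr B"
        unfolding z_def .
    qed
  qed
  then show ?thesis by blast
qed

end

section \<open>From words to paths\<close>

lemma length_le_path_length:
  assumes "fin_code C" "aug_path C ps"
  shows "length ps \<le> path_length ps"
  using assms
proof (induction ps arbitrary: C)
  case (Cons q ps)
  obtain u k where q: "q = (u, k)" by force
  have "u \<in> C" "k \<ge> 1" "aug_path (T_augment C u k) ps" using Cons.prems by (auto simp: q)
  moreover from this have "k * length u > 0" using fin_code_nonempty[OF Cons.prems(1)] by simp
  moreover from calculation have "length ps \<le> path_length ps"
    using Cons.IH[of "T_augment C u k"] fin_code_T_augment[OF Cons.prems(1), of u k] by blast
  ultimately show ?case unfolding q path_length_simps list.size by linarith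
qed simp

lemma path_length_eq_sum: "path_length ps = (\<Sum>t<length ps. snd (ps ! t) * length (fst (ps ! t)))"
  unfolding path_length_def by (simp add: sum_list_sum_nth atLeast0LessThan case_prod_unfold)

definition path_complexity :: "('a list \<times> nat) list \<Rightarrow> real" where
  "path_complexity ps = (\<Sum>t<length ps. log 2 (real (snd (ps ! t)) + 1))"

lemma T_complexity_eq: "T_complexity w = path_complexity (canonical_recovery w)"
  unfolding T_complexity_def path_complexity_def
  by (simp add: sum_list_sum_nth atLeast0LessThan case_prod_unfold)

text \<open>Beyond the first, each further unit of the exponent can thus be charged one unit of
  complexity, as 1 + (k - 1) = k.\<close>

lemma log2_Suc_le: "log 2 (real k + 1) \<le> real k"
proof -
  have "real k + 1 \<le> 2 ^ k" by (induction k) auto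
  then have "log 2 (real k + 1) \<le> log 2 (2 ^ k)" by (subst log_le_cancel_iff) auto
  then show ?thesis by (simp add: log_nat_power)
qed

lemma length_le_path_complexity:
  assumes "aug_path C ps"
  shows "real (length ps) \<le> path_complexity ps"
proof -
  have "1 \<le> log 2 (real (snd (ps ! t)) + 1)" if "t < length ps" for t
    using aug_path_nth(2)[OF assms that] by (subst le_log_iff) auto
  then have "(\<Sum>t<length ps. 1) \<le> path_complexity ps"
    unfolding path_complexity_def by (intro sum_mono) auto
  then show ?thesis by simp
qed

section \<open>Word probabilities bounded by path weights\<close>

context source
begin

text \<open>The invariant under which path weights are summed: such codes have total weight one, and
  total tilted weight given by \<open>code_sum_path\<close>.\<close>

definition reachable :: "'a list set \<Rightarrow> bool" where
  "reachable C \<longleftrightarrow> (\<exists>ps. aug_path letters ps \<and> C = code_after letters ps)"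

lemma reachable_T_augment:
  assumes "reachable C" "u \<in> C" "k \<ge> 1"
  shows "reachable (T_augment C u k)"
proof -
  obtain ps where "aug_path letters ps" "C = code_after letters ps"
    using assms(1) by (auto simp: reachable_def)
  then have "aug_path letters (ps @ [(u, k)])" "T_augment C u k = code_after letters (ps @ [(u, k)])"
    using assms by (auto simp: aug_path_append code_after_append)
  then show ?thesis unfolding reachable_def by blast
qed

lemma fin_code_reachable: "reachable C \<Longrightarrow> fin_code C"
  by (auto simp: reachable_def intro: fin_code_code_after fin_code_letters)

lemma reachable_code_after: "aug_path letters ps \<Longrightarrow> reachable (code_after letters (take t ps))"
  unfolding reachable_def using aug_path_take by blast

lemma reachable_letters: "reachable letters"
  unfolding reachable_def by (rule exI[of _ "[]"]) simp

lemma code_sum_1: "reachable C \<Longrightarrow> code_sum 1 C = 1"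
  by (auto simp: reachable_def code_sum_path)

lemma code_sum_pos:
  assumes "reachable C" "z > 0"
  shows "code_sum z C > 0"
proof -
  have "C \<noteq> {}" using code_sum_1[OF assms(1)] by (auto simp: code_sum_def)
  then show ?thesis unfolding code_sum_def
    using fin_code_reachable[OF assms(1)] xwt_pos[OF assms(2)]
    by (intro sum_pos) (auto simp: fin_code_def)
qed

text \<open>A word of length N is determined by its last letter and a path of total length N - 1.
  The last letter sums to one and the path weights to at most one, so a pointwise comparison with
  constant M becomes a probability bound M.\<close>

lemma sum_words_le_paths:
  assumes q0: "\<And>i C u k. q i C u k \<ge> 0"
    and q1: "\<And>i C K. reachable C \<Longrightarrow> (\<Sum>u\<in>C. \<Sum>k=1..K. q i C u k) \<le> 1"
    and M: "M \<ge> 0" and N: "N \<ge> 1"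
    and B: "\<And>ps. aug_path letters ps \<Longrightarrow> path_length ps = N - 1 \<Longrightarrow> ps \<in> B \<Longrightarrow>
      wt p (path_word ps) \<le> M * path_wt q 0 letters ps"
  shows "(\<Sum>w | length w = N \<and> canonical_recovery w \<in> B. wt p w) \<le> M"
proof -
  let ?S = "{w. length w = N \<and> canonical_recovery w \<in> B}"
  let ?f = "\<lambda>w. (last w, canonical_recovery w)"
  have "finite (paths (letters :: 'a list set) (N - 1)) \<and> (\<Sum>ps\<in>paths letters (N - 1). path_wt q 0 letters ps) \<le> 1"
    by (rule sum_path_wt_le_1[where I = reachable])
      (use q0 q1 reachable_T_augment fin_code_reachable reachable_letters in auto)
  then have P: "finite (paths (letters :: 'a list set) (N - 1))" "(\<Sum>ps\<in>paths letters (N - 1). path_wt q 0 letters ps) \<le> 1"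
    by blast+
  have w: "aug_path letters (canonical_recovery w)" "w = path_word (canonical_recovery w) @ [last w]"
    "path_length (canonical_recovery w) = N - 1" if "length w = N" for w :: "'a list"
  proof -
    have ne: "w \<noteq> []" using that N by auto
    show "aug_path letters (canonical_recovery w)" "w = path_word (canonical_recovery w) @ [last w]"
      using canonical_recovery_path[OF ne] by blast+
    then have "length w = path_length (canonical_recovery w) + 1"
      by (metis length_append_singleton length_path_word Suc_eq_plus1)
    then show "path_length (canonical_recovery w) = N - 1" using that by simp
  qed
  have inj: "inj_on ?f ?S"
    by (rule inj_onI) (metis (mono_tags, lifting) mem_Collect_eq prod.inject w(2))
  have "(\<Sum>w\<in>?S. wt p w) \<le> (\<Sum>w\<in>?S. (\<lambda>(a, ps). p a * (M * path_wt q 0 letters ps)) (?f w))"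
  proof (rule sum_mono)
    fix v assume v: "v \<in> ?S"
    then have len: "length v = N" by simp
    have "wt p v = wt p (path_word (canonical_recovery v)) * p (last v)"
      using arg_cong[OF w(2)[OF len], of "wt p"] by simp
    also have "\<dots> \<le> (M * path_wt q 0 letters (canonical_recovery v)) * p (last v)"
      using B[OF w(1)[OF len] w(3)[OF len]] v p_pos[of "last v"] by (intro mult_right_mono) auto
    finally show "wt p v \<le> (\<lambda>(a, ps). p a * (M * path_wt q 0 letters ps)) (?f v)"
      by (simp add: mult.commute)
  qed
  also have "\<dots> = (\<Sum>(a, ps)\<in>?f ` ?S. p a * (M * path_wt q 0 letters ps))"
    by (subst sum.reindex[OF inj]) simp
  also have "\<dots> \<le> (\<Sum>(a, ps)\<in>UNIV \<times> paths letters (N - 1). p a * (M * path_wt q 0 letters ps))"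
  proof (rule sum_mono2)
    show "finite ((UNIV :: 'a set) \<times> paths (letters :: 'a list set) (N - 1))" using P(1) by simp
    show "?f ` ?S \<subseteq> UNIV \<times> paths letters (N - 1)" using w by (auto simp: paths_def)
    have "path_wt q 0 letters ps \<ge> 0" for ps unfolding path_wt_def by (intro prod_nonneg) (simp add: q0)
    then show "\<And>b. b \<in> UNIV \<times> paths letters (N - 1) - ?f ` ?S \<Longrightarrow> 0 \<le> (\<lambda>(a, ps). p a * (M * path_wt q 0 letters ps)) b"
      using p_pos M by (auto simp: less_imp_le)
  qed
  also have "\<dots> = M * (\<Sum>ps\<in>paths letters (N - 1). path_wt q 0 letters ps)"
    unfolding sum.cartesian_product[symmetric] sum_product[symmetric] p_sum
    by (simp add: sum_distrib_left)
  also have "\<dots> \<le> M * 1" by (intro mult_left_mono P M)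
  finally show ?thesis by simp
qed

lemma wt_path_word_scaled:
  "wt p (path_word ps) * z ^ path_length ps = (\<Prod>t<length ps. xwt z (fst (ps ! t)) ^ snd (ps ! t))"
proof -
  have "z ^ path_length ps = (\<Prod>t<length ps. (z ^ length (fst (ps ! t))) ^ snd (ps ! t))"
    unfolding path_length_eq_sum by (simp add: power_sum power_mult[symmetric] mult.commute)
  then show ?thesis
    unfolding wt_path_word xwt_def by (simp add: power_mult_distrib prod.distrib)
qed

text \<open>The comparison weight picks u with probability \<open>xwt z u / code_sum z C\<close> and
  then a geometric exponent k, reweighted by a bonus \<open>b\<close> of mean at most one. Dividing
  the word weight by it leaves, at each step, the normalising sum, the geometric constant and 1/b;
  the tilt itself contributes z^(N-1).\<close>

lemma sum_words_le_tilted: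
  assumes z: "z > 0" "pmax * z < 1" and M: "M \<ge> 0" and N: "N \<ge> 1"
    and b: "\<And>u k. b u k > 0"
      "\<And>u K. u \<noteq> [] \<Longrightarrow> (\<Sum>k=1..K. xwt z u ^ (k - 1) * (1 - xwt z u) * b u k) \<le> 1"
    and B: "\<And>ps. aug_path letters ps \<Longrightarrow> path_length ps = N - 1 \<Longrightarrow> ps \<in> B \<Longrightarrow>
      (\<Prod>t<length ps. code_sum z (code_after letters (take t ps)) * (1 / (1 - xwt z (fst (ps ! t))))
         * (1 / b (fst (ps ! t)) (snd (ps ! t)))) \<le> M * z ^ (N - 1)"
  shows "(\<Sum>w | length w = N \<and> canonical_recovery w \<in> B. wt p w) \<le> M"
proof (rule sum_words_le_paths[where q = "\<lambda>i C u k. xwt z u ^ k * (1 - xwt z u) * b u k / code_sum z C",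
      OF _ _ M N])
  fix i C u k
  have "1 - xwt z u \<ge> 0" using xwt_le[OF z, of u] z by (cases "u = []") (auto simp: xwt_def)
  moreover have "code_sum z C \<ge> 0"
    unfolding code_sum_def using xwt_pos[OF z(1)] by (intro sum_nonneg) (auto simp: less_imp_le)
  ultimately show "xwt z u ^ k * (1 - xwt z u) * b u k / code_sum z C \<ge> 0"
    using xwt_pos[OF z(1), of u] b(1)[of u k] by simp
next
  fix i :: nat and C K assume C: "reachable C"
  have "(\<Sum>u\<in>C. \<Sum>k=1..K. xwt z u ^ k * (1 - xwt z u) * b u k / code_sum z C)
      = (\<Sum>u\<in>C. xwt z u * (\<Sum>k=1..K. xwt z u ^ (k - 1) * (1 - xwt z u) * b u k)) / code_sum z C"
    unfolding sum_divide_distrib sum_distrib_left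
    by (intro sum.cong refl) (auto simp: power_eq_if)
  also have "\<dots> \<le> (\<Sum>u\<in>C. xwt z u * 1) / code_sum z C"
    using code_sum_pos[OF C z(1)] b(2) xwt_pos[OF z(1)] fin_code_nonempty[OF fin_code_reachable[OF C]]
    by (intro divide_right_mono sum_mono mult_left_mono) (auto simp: less_imp_le)
  also have "\<dots> = 1" using code_sum_pos[OF C z(1)] by (simp add: code_sum_def)
  finally show "(\<Sum>u\<in>C. \<Sum>k=1..K. xwt z u ^ k * (1 - xwt z u) * b u k / code_sum z C) \<le> 1" .
next
  fix ps assume ps: "aug_path letters ps" "path_length ps = N - 1" "ps \<in> B"
  let ?q = "\<lambda>(i::nat) C u k. xwt z u ^ k * (1 - xwt z u) * b u k / code_sum z C"
  let ?u = "\<lambda>t. fst (ps ! t)" and ?k = "\<lambda>t. snd (ps ! t)" and ?C = "\<lambda>t. code_after letters (take t ps)"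
  let ?R = "\<Prod>t<length ps. code_sum z (?C t) * (1 / (1 - xwt z (?u t))) * (1 / b (?u t) (?k t))"
  have "(\<Prod>t<length ps. xwt z (?u t) ^ ?k t) = path_wt ?q 0 letters ps * ?R"
    unfolding path_wt_def prod.distrib[symmetric]
  proof (intro prod.cong refl)
    fix t assume t: "t \<in> {..<length ps}"
    then have "?u t \<noteq> []" using path_words_nonempty[OF fin_code_letters ps(1)] by auto
    then have "1 - xwt z (?u t) \<noteq> 0" using xwt_le[OF z, of "?u t"] z by auto
    moreover have "code_sum z (?C t) \<noteq> 0"
      using code_sum_pos[OF reachable_code_after[OF ps(1)] z(1)] by (metis less_irrefl)
    moreover have "b (?u t) (?k t) \<noteq> 0" using b(1)[of "?u t" "?k t"] by simp
    ultimately show "xwt z (?u t) ^ ?k t = ?q (0 + t) (?C t) (?u t) (?k t)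
        * (code_sum z (?C t) * (1 / (1 - xwt z (?u t))) * (1 / b (?u t) (?k t)))" by simp
  qed
  also have "\<dots> \<le> path_wt ?q 0 letters ps * (M * z ^ (N - 1))"
  proof (rule mult_left_mono[OF B[OF ps]])
    show "path_wt ?q 0 letters ps \<ge> 0"
      unfolding path_wt_def
    proof (intro prod_nonneg ballI divide_nonneg_nonneg mult_nonneg_nonneg)
      fix t assume t: "t \<in> {..<length ps}"
      then have "?u t \<noteq> []" using path_words_nonempty[OF fin_code_letters ps(1)] by auto
      then show "1 - xwt z (?u t) \<ge> 0" using xwt_le[OF z, of "?u t"] z by auto
      show "code_sum z (?C t) \<ge> 0"
        using code_sum_pos[OF reachable_code_after[OF ps(1)] z(1)] by (simp add: less_imp_le)
    qed (use b(1) xwt_pos[OF z(1)] in \<open>auto simp: less_imp_le\<close>)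
  qed
  finally have "wt p (path_word ps) * z ^ (N - 1) \<le> (M * path_wt ?q 0 letters ps) * z ^ (N - 1)"
    using wt_path_word_scaled[of ps z] ps(2) by (simp add: mult_ac)
  then show "wt p (path_word ps) \<le> M * path_wt ?q 0 letters ps"
    using z(1) by (simp add: mult_le_cancel_right)
qed

lemma prod_inverse_mono:
  assumes "aug_path letters ps" "0 < z'" "z' \<le> z" "pmax * z < 1"
  shows "(\<Prod>t<length ps. 1 / (1 - xwt z' (fst (ps ! t)))) \<le> (\<Prod>t<length ps. 1 / (1 - xwt z (fst (ps ! t))))"
    and "(\<Prod>t<length ps. 1 / (1 - xwt z' (fst (ps ! t)))) \<ge> 0"
proof -
  have *: "0 < 1 - xwt z (fst (ps ! t))" "xwt z' (fst (ps ! t)) \<le> xwt z (fst (ps ! t))" if "t < length ps" for t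
  proof -
    show "0 < 1 - xwt z (fst (ps ! t))"
      using xwt_le[of z "fst (ps ! t)"] path_words_nonempty[OF fin_code_letters assms(1) that] assms by auto
    show "xwt z' (fst (ps ! t)) \<le> xwt z (fst (ps ! t))"
      unfolding xwt_def using assms wt_pos by (intro mult_left_mono power_mono) (auto simp: less_imp_le)
  qed
  have **: "0 \<le> 1 / (1 - xwt z' (fst (ps ! t)))" "1 / (1 - xwt z' (fst (ps ! t))) \<le> 1 / (1 - xwt z (fst (ps ! t)))"
    if "t < length ps" for t
    using *[OF that] by (auto intro!: divide_left_mono mult_pos_pos)
  show "(\<Prod>t<length ps. 1 / (1 - xwt z' (fst (ps ! t)))) \<le> (\<Prod>t<length ps. 1 / (1 - xwt z (fst (ps ! t))))"
    by (intro prod_mono) (use ** in auto)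
  show "(\<Prod>t<length ps. 1 / (1 - xwt z' (fst (ps ! t)))) \<ge> 0"
    by (intro prod_nonneg) (use ** in auto)
qed

section \<open>Heavy codewords do not survive\<close>

definition heavy_words :: "real \<Rightarrow> 'a list set" where
  "heavy_words r = {u. u \<noteq> [] \<and> wt p u > r}"

lemma heavy_word_length:
  assumes "u \<in> heavy_words r" "r > 0"
  shows "real (length u) < ln r / ln pmax"
proof -
  have "r < pmax ^ length u" using assms wt_le_pmax[of u] by (auto simp: heavy_words_def)
  then have "ln r < real (length u) * ln pmax"
    using assms(2) pmax_pos by (metis ln_less_cancel_iff ln_realpow less_trans zero_less_power)
  then show ?thesis using pmax_pos pmax_less_1 by (simp add: neg_less_divide_eq)
qed

text \<open>Each length carries total weight one, and a heavy word has length below ln r / ln pmax.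
  So the heavy words weigh at most that much together, while each weighs more than r.\<close>

lemma heavy_words_card:
  assumes r: "0 < r" "r \<le> 1"
  shows "finite (heavy_words r)" "real (card (heavy_words r)) \<le> ln r / ln pmax / r"
proof -
  define m where "m = nat \<lfloor>ln r / ln pmax\<rfloor>"
  have nonneg: "ln r / ln pmax \<ge> 0"
    using r pmax_pos pmax_less_1 by (intro divide_nonpos_neg) auto
  have sub: "heavy_words r \<subseteq> (\<Union>n\<in>{1..m}. {u. length u = n})"
  proof
    fix u assume u: "u \<in> heavy_words r"
    then have "length u \<ge> 1" by (cases u) (auto simp: heavy_words_def)
    moreover have "length u \<le> m"
      using heavy_word_length[OF u r(1)] unfolding m_def by linarith
    ultimately show "u \<in> (\<Union>n\<in>{1..m}. {u. length u = n})" by auto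
  qed
  show fin: "finite (heavy_words r)" by (rule finite_subset[OF sub]) auto
  have "real (card (heavy_words r)) * r = (\<Sum>u\<in>heavy_words r. r)" by simp
  also have "\<dots> \<le> (\<Sum>u\<in>heavy_words r. wt p u)" by (intro sum_mono) (auto simp: heavy_words_def)
  also have "\<dots> \<le> (\<Sum>n\<in>{1..m}. \<Sum>u | length u = n. wt p u)"
    using sub fin wt_pos by (intro sum_words_le) (auto simp: less_imp_le)
  also have "\<dots> = real m" by (simp add: sum_wt_length p_sum)
  also have "\<dots> \<le> ln r / ln pmax" unfolding m_def using nonneg by linarith
  finally show "real (card (heavy_words r)) \<le> ln r / ln pmax / r"
    using r by (subst pos_le_divide_eq) auto
qed

text \<open>Membership at both ends of the window means that c is present through D consecutive
  steps, none of which eliminates it.\<close>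

definition survives :: "'a list \<Rightarrow> nat \<Rightarrow> nat \<Rightarrow> ('a list \<times> nat) list \<Rightarrow> bool" where
  "survives c j D ps \<longleftrightarrow> j + D \<le> length ps \<and> (\<forall>i\<in>{j..j + D}. c \<in> code_after letters (take i ps))"

lemma eliminated_not_in:
  assumes "fin_code C" "u \<in> C" "k \<ge> 1"
  shows "u \<notin> T_augment C u k"
  using starts_off_T_augment_eliminated[OF assms] unfolding starts_off_def by (metis append_Nil2)

text \<open>A change of measure at z = 1. A path on which c survives gains 1 / (1 - p(c)) at each of
  the D steps of the window, and M covers the geometric normalisations.\<close>

lemma sum_words_survives:
  assumes c: "c \<noteq> []" and M: "M \<ge> 0" and N: "N \<ge> 1"
    and B: "\<And>ps. aug_path letters ps \<Longrightarrow> path_length ps = N - 1 \<Longrightarrow>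
      (\<Prod>t<length ps. 1 / (1 - wt p (fst (ps ! t)))) \<le> M"
  shows "(\<Sum>w | length w = N \<and> canonical_recovery w \<in> Collect (survives c j D). wt p w) \<le> M * (1 - wt p c) ^ D"
proof -
  have lt1: "wt p u < 1" if "u \<noteq> []" for u
    using xwt_le[of 1 u] that pmax_less_1 by (simp add: xwt_def)
  have c1: "0 < wt p c" "wt p c < 1" using wt_pos lt1[OF c] by auto
  \<comment> \<open>Inside the window and while c is present, c is forbidden and the other codewords
    share its probability, so the total weight remains one.\<close>
  define b where "b i C u = (if j \<le> i \<and> i < j + D \<and> c \<in> C then (if u = c then 0 else 1 / (1 - wt p c)) else 1)"
    for i :: nat and C u
  have b0: "b i C u \<ge> 0" for i C u using c1 by (auto simp: b_def)
  have one_minus: "1 - wt p u \<ge> 0" for u using wt_le_1[of u] by simp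
  define q where "q i C u k = wt p u ^ k * (1 - wt p u) * b i C u" for i :: nat and C u and k :: nat
  show ?thesis
  proof (rule sum_words_le_paths[where q = q, OF _ _ _ N])
    show "q i C u k \<ge> 0" for i C u k using wt_pos[of u] one_minus[of u] b0 by (simp add: q_def less_imp_le)
    show "M * (1 - wt p c) ^ D \<ge> 0" using M c1 by simp
  next
    fix i :: nat and C K assume C: "reachable C"
    have fC: "finite C" using fin_code_reachable[OF C] by (simp add: fin_code_def)
    have sum1: "(\<Sum>u\<in>C. wt p u) = 1" using code_sum_1[OF C] by (simp add: code_sum_def xwt_def)
    have "(\<Sum>k=1..K. q i C u k) \<le> wt p u * b i C u" for u
    proof -
      have "(\<Sum>k=1..K. q i C u k) = (\<Sum>k=1..K. wt p u ^ k * (1 - wt p u)) * b i C u"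
        by (simp add: q_def sum_distrib_right)
      also have "(\<Sum>k=1..K. wt p u ^ k * (1 - wt p u)) \<le> wt p u"
      proof (cases "K \<ge> 1")
        case True
        have "(1 - wt p u) * (\<Sum>k=1..K. wt p u ^ k) = wt p u ^ 1 - wt p u ^ Suc K"
          by (rule sum_gp_multiplied[OF True])
        moreover have "wt p u ^ Suc K \<ge> 0" using wt_pos[of u] by (simp add: less_imp_le)
        ultimately have "(1 - wt p u) * (\<Sum>k=1..K. wt p u ^ k) \<le> wt p u" by simp
        then show ?thesis by (simp add: sum_distrib_left mult.commute)
      qed (use wt_pos[of u] in \<open>simp add: less_imp_le\<close>)
      finally show ?thesis by (simp add: b0 mult_right_mono)
    qed
    then have "(\<Sum>u\<in>C. \<Sum>k=1..K. q i C u k) \<le> (\<Sum>u\<in>C. wt p u * b i C u)" by (rule sum_mono)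
    also have "\<dots> \<le> 1"
    proof (cases "j \<le> i \<and> i < j + D \<and> c \<in> C")
      case True
      have "(\<Sum>u\<in>C. wt p u * b i C u) = (\<Sum>u\<in>C - {c}. wt p u * (1 / (1 - wt p c)))"
        using True by (intro sum.mono_neutral_cong_right[OF fC]) (auto simp: b_def)
      also have "\<dots> = (\<Sum>u\<in>C - {c}. wt p u) / (1 - wt p c)" by (simp add: sum_divide_distrib)
      also have "(\<Sum>u\<in>C - {c}. wt p u) = 1 - wt p c" using True fC sum1 by (simp add: sum_diff1)
      finally show ?thesis using c1 by simp
    next
      case False
      then have "(\<Sum>u\<in>C. wt p u * b i C u) = (\<Sum>u\<in>C. wt p u)" by (intro sum.cong) (auto simp: b_def)
      then show ?thesis using sum1 by simp
    qed
    finally show "(\<Sum>u\<in>C. \<Sum>k=1..K. q i C u k) \<le> 1" .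
  next
    fix ps assume ps: "aug_path letters ps" "path_length ps = N - 1" "ps \<in> Collect (survives c j D)"
    let ?u = "\<lambda>t. fst (ps ! t)" and ?k = "\<lambda>t. snd (ps ! t)" and ?C = "\<lambda>t. code_after letters (take t ps)"
    have len: "j + D \<le> length ps" and mem: "\<And>i. j \<le> i \<Longrightarrow> i \<le> j + D \<Longrightarrow> c \<in> ?C i"
      using ps(3) by (auto simp: survives_def)
    have bt: "b t (?C t) (?u t) = (if t \<in> {j..<j + D} then 1 / (1 - wt p c) else 1)" if t: "t < length ps" for t
    proof (cases "t \<in> {j..<j + D}")
      case True
      have "?u t \<noteq> c"
      proof
        assume "?u t = c"
        then have "c \<notin> ?C (Suc t)"
          using aug_path_nth[OF ps(1) t] eliminated_not_in[OF fin_code_reachable[OF reachable_code_after[OF ps(1)]]]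
          by metis
        then show False using mem[of "Suc t"] True by auto
      qed
      then show ?thesis using True mem[of t] by (auto simp: b_def)
    qed (auto simp: b_def)
    have "(\<Prod>t<length ps. b t (?C t) (?u t)) = (\<Prod>t<length ps. if t \<in> {j..<j + D} then 1 / (1 - wt p c) else 1)"
      by (intro prod.cong) (auto simp: bt)
    also have "\<dots> = (\<Prod>t\<in>{j..<j + D}. 1 / (1 - wt p c))"
      using len by (intro prod.mono_neutral_cong_right) auto
    finally have bprod: "(\<Prod>t<length ps. b t (?C t) (?u t)) = (1 / (1 - wt p c)) ^ D" by simp
    have "path_wt q 0 letters ps * (\<Prod>t<length ps. 1 / (1 - wt p (?u t)))
        = (\<Prod>t<length ps. wt p (?u t) ^ ?k t * b t (?C t) (?u t))"
      unfolding path_wt_def prod.distrib[symmetric]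
    proof (intro prod.cong refl)
      fix t assume "t \<in> {..<length ps}"
      then have "?u t \<noteq> []" using path_words_nonempty[OF fin_code_letters ps(1)] by auto
      then have "1 - wt p (?u t) \<noteq> 0" using lt1 by (metis eq_iff_diff_eq_0 less_irrefl)
      then show "q (0 + t) (?C t) (?u t) (?k t) * (1 / (1 - wt p (?u t))) = wt p (?u t) ^ ?k t * b t (?C t) (?u t)"
        by (simp add: q_def)
    qed
    also have "\<dots> = wt p (path_word ps) * (1 / (1 - wt p c)) ^ D"
      unfolding prod.distrib bprod wt_path_word ..
    finally have "wt p (path_word ps) = path_wt q 0 letters ps * (\<Prod>t<length ps. 1 / (1 - wt p (?u t))) * (1 - wt p c) ^ D"
      using c1 by (simp add: power_divide)
    also have "\<dots> \<le> path_wt q 0 letters ps * M * (1 - wt p c) ^ D"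
    proof (intro mult_right_mono mult_left_mono B[OF ps(1,2)])
      show "path_wt q 0 letters ps \<ge> 0"
        unfolding path_wt_def q_def using wt_pos one_minus b0 by (intro prod_nonneg ballI mult_nonneg_nonneg) (auto simp: less_imp_le)
    qed (use c1 in auto)
    finally show "wt p (path_word ps) \<le> M * (1 - wt p c) ^ D * path_wt q 0 letters ps" by (simp add: mult_ac)
  qed
qed

text \<open>A heavy codeword that is not an initial letter has a heavy proper prefix in the code just
  before it appears, so waiting times add up at most over the length of the word.\<close>

lemma heavy_codeword_time:
  assumes ps: "aug_path letters ps"
    and no: "\<And>c j. c \<in> heavy_words r \<Longrightarrow> \<not> survives c j D ps"
  shows "t \<le> length ps \<Longrightarrow> c \<in> code_after letters (take t ps) \<Longrightarrow> c \<in> heavy_words r \<Longrightarrow> t \<le> length c * (D + 1)"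
proof (induction "length c" arbitrary: c t rule: less_induct)
  case less
  let ?C = "\<lambda>t. code_after letters (take t ps)"
  \<comment> \<open>The least such j is the start of the uninterrupted presence of c up to time t.
    As c survives no window of D steps, t < j + D.\<close>
  define Q where "Q j \<longleftrightarrow> j \<le> t \<and> (\<forall>i\<in>{j..t}. c \<in> ?C i)" for j
  define j where "j = (LEAST j. Q j)"
  have Qt: "Q t" using less.prems(2) by (simp add: Q_def)
  have Qj: "Q j" unfolding j_def by (rule LeastI[of Q, OF Qt])
  have len: "length c \<ge> 1" using less.prems(3) by (cases c) (auto simp: heavy_words_def)
  have "t < j + D"
  proof (rule ccontr)
    assume "\<not> t < j + D"
    then have "survives c j D ps" using Qj less.prems(1) by (auto simp: Q_def survives_def)
    then show False using no[OF less.prems(3)] by blast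
  qed
  show ?case
  proof (cases j)
    case 0
    then have "t \<le> 1 * (D + 1)" using \<open>t < j + D\<close> by simp
    also have "\<dots> \<le> length c * (D + 1)" using len by (intro mult_right_mono) auto
    finally show ?thesis .
  next
    case (Suc i)
    have jt: "j \<le> t" using Qj by (simp add: Q_def)
    have "\<not> Q i" using not_less_Least[of i Q] Suc unfolding j_def by simp
    then have ci: "c \<notin> ?C i"
      using Qj Suc unfolding Q_def by (metis atLeastAtMost_iff le_antisym not_less_eq_eq Suc_leD)
    have i: "i < length ps" using Suc jt less.prems(1) by simp
    define u k where "u = fst (ps ! i)" and "k = snd (ps ! i)"
    have uk: "u \<in> ?C i" "k \<ge> 1" "?C (Suc i) = T_augment (?C i) u k"
      using aug_path_nth[OF ps i] by (auto simp: u_def k_def)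
    have fin: "fin_code (?C i)" by (rule fin_code_reachable[OF reachable_code_after[OF ps]])
    have "c \<in> T_augment (?C i) u k" using Qj Suc uk(3) by (auto simp: Q_def)
    then obtain v where v: "c = u @ v" "v \<noteq> []"
    proof -
      assume a: "\<And>v. c = u @ v \<Longrightarrow> v \<noteq> [] \<Longrightarrow> thesis"
      assume "c \<in> T_augment (?C i) u k"
      then consider m s where "c = word_power u m @ s" "s \<in> ?C i - {u}" | "c = word_power u (k + 1)"
        by (auto simp: T_augment_def)
      then show thesis
      proof cases
        case 1
        have "m \<noteq> 0"
        proof
          assume "m = 0"
          then have "c = s" using 1 by (simp add: word_power_def)
          then show False using 1 ci by simp
        qed
        then obtain m' where "m = Suc m'" by (cases m) auto
        then have "c = u @ (word_power u m' @ s)" using 1 by (simp add: word_power_Suc)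
        moreover have "s \<noteq> []" using 1 fin_code_nonempty[OF fin] by blast
        ultimately show thesis using a by blast
      next
        case 2
        then have "c = u @ word_power u k" by (simp add: word_power_Suc)
        moreover have "word_power u k \<noteq> []"
          using uk fin_code_nonempty[OF fin uk(1)] by (cases k) (auto simp: word_power_Suc)
        ultimately show thesis using a by blast
      qed
    qed
    have "wt p c \<le> wt p u * 1" unfolding v wt_simps
      using wt_le_1 wt_pos by (intro mult_left_mono) (auto simp: less_imp_le)
    then have "u \<in> heavy_words r"
      using less.prems(3) fin_code_nonempty[OF fin uk(1)] by (auto simp: heavy_words_def)
    then have "i \<le> length u * (D + 1)" using less.hyps[of u i] v uk(1) i by simp
    moreover have "(length u + 1) * (D + 1) \<le> length c * (D + 1)"
      using v by (intro mult_right_mono) (auto simp: Suc_le_eq)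
    ultimately show ?thesis using \<open>t < j + D\<close> Suc by simp
  qed
qed

end

lemma sum_geometric_le:
  fixes y :: real
  assumes "0 \<le> y" "y < 1"
  shows "(\<Sum>k=1..K. y ^ (k - 1)) \<le> 1 / (1 - y)"
proof -
  have "(\<Sum>k=1..K. y ^ (k - 1)) = (\<Sum>j<K. y ^ j)"
    by (rule sum.reindex_bij_witness[where i = "\<lambda>j. j + 1" and j = "\<lambda>k. k - 1"]) auto
  also have "\<dots> = (1 - y ^ K) / (1 - y)" using assms by (simp add: sum_gp_strict)
  also have "\<dots> \<le> 1 / (1 - y)" using assms by (intro divide_right_mono) auto
  finally show ?thesis .
qed

context source
begin

text \<open>N divided by the asymptotic mean codeword length exp \<gamma> ln N / h.\<close>

definition typical_steps :: "nat \<Rightarrow> real" where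
  "typical_steps N = exp (- euler_mascheroni) * h * real N / ln (real N)"

section \<open>Lower bound for the number of steps\<close>

text \<open>The expansion grows along the path, so its final bound D serves in every factor 1 + (z -
  1) D.\<close>

lemma prod_code_sum_upper:
  assumes ps: "aug_path letters ps" and z: "z \<ge> 1" and D: "expansion z ps \<le> D"
  shows "(\<Prod>t<length ps. code_sum z (code_after letters (take t ps))) \<le> exp ((z - 1) * D * real (length ps))"
proof -
  have "(\<Prod>t<length ps. code_sum z (code_after letters (take t ps))) \<le> (\<Prod>t<length ps. exp ((z - 1) * D))"
  proof (intro prod_mono conjI)
    fix t
    show "0 \<le> code_sum z (code_after letters (take t ps))"
      using code_sum_pos[OF reachable_code_after[OF ps], of z t] z by simp
    have "code_sum z (code_after letters (take t ps)) = 1 + (z - 1) * expansion z (take t ps)"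
      by (simp add: code_sum_path[OF aug_path_take[OF ps]] algebra_simps)
    also have "\<dots> \<le> 1 + (z - 1) * D"
      using expansion_take_le[of z t ps] D z by (intro add_left_mono mult_left_mono) auto
    also have "\<dots> \<le> exp ((z - 1) * D)" by (rule exp_ge_add_one_self)
    finally show "code_sum z (code_after letters (take t ps)) \<le> exp ((z - 1) * D)" .
  qed
  also have "\<dots> = exp ((z - 1) * D * real (length ps))"
    by (simp add: exp_of_nat_mult[symmetric] mult.commute)
  finally show ?thesis .
qed

text \<open>A tilt with z > 1 gains z^N = exp (\<eta> N / ln N), and each step loses at most exp ((z
  - 1) D). With fewer than (1 - \<epsilon>) N / D steps the total loss is at most exp (\<eta> (1 -
  \<epsilon>/2) N / ln N), and the surplus beats the polynomial factor.\<close>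

lemma few_steps:
  assumes \<epsilon>: "0 < \<epsilon>" "\<epsilon> < 1"
  shows "(\<lambda>N. \<Sum>w | length w = N \<and> canonical_recovery w \<in> {ps. real (length ps) \<le> (1 - \<epsilon>) * typical_steps N}. wt p w)
    \<longlonglongrightarrow> 0"
proof -
  let ?S = "\<lambda>N. \<Sum>w | length w = N \<and> canonical_recovery w \<in> {ps. real (length ps) \<le> (1 - \<epsilon>) * typical_steps N}. wt p w"
  obtain \<eta> where \<eta>: "\<eta> > 0" and up: "\<forall>\<^sub>F N in sequentially. \<forall>ps. aug_path letters ps \<longrightarrow> length ps \<le> N \<longrightarrow>
    expansion (exp (\<eta> / ln (real N))) ps \<le> exp euler_mascheroni * (1 + \<epsilon> / 4) * ln (real N) / h"
    using expansion_upper[of "\<epsilon> / 4"] \<epsilon> by auto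
  obtain B' where B': "\<forall>\<^sub>F N in sequentially. \<forall>ps. aug_path letters ps \<longrightarrow> length ps \<le> N \<longrightarrow>
    (\<Prod>t<length ps. 1 / (1 - xwt (exp (\<eta> / ln (real N))) (fst (ps ! t)))) \<le> real N powr B'"
    using prod_inverse_polynomial[OF \<eta>] by blast
  \<comment> \<open>Raising the exponent to at least 1 fixes its sign for the asymptotic
    evaluation.\<close>
  define B where "B = max B' 1"
  have B: "B > 0" "B' \<le> B" by (auto simp: B_def)
  define M where "M N = real N powr B * exp (- (\<eta> / ln (real N)) * (\<epsilon> / 2 * real N - 1))" for N :: nat
  have "\<epsilon> / 8 > 0" using \<epsilon> by simp
  then have ev: "\<forall>\<^sub>F N in sequentially. exp (\<eta> / ln (real N)) - 1 \<le> (1 + \<epsilon> / 8) * (\<eta> / ln (real N))"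
    using \<eta> by real_asymp
  have upper: "\<forall>\<^sub>F N in sequentially. ?S N \<le> M N"
    using up B' ev eventually_pmax_mult_le[of \<eta>] eventually_gt_at_top[of 1]
  proof eventually_elim
    case (elim N)
    define z where "z = exp (\<eta> / ln (real N))"
    have N: "real N > 1" "N \<ge> 1" using elim(5) by simp_all
    have lnN: "ln (real N) > 0" using N by simp
    have z1: "z \<ge> 1" unfolding z_def using \<eta> lnN by simp
    have "sqrt pmax < 1" using pmax_less_1 by simp
    then have q: "pmax * z < 1" using elim(4) unfolding z_def by linarith
    define D where "D = exp euler_mascheroni * (1 + \<epsilon> / 4) * ln (real N) / h"
    have D0: "D > 0" using \<epsilon> lnN h_pos by (simp add: D_def)
    show ?case
    proof (rule sum_words_le_tilted[where z = z and b = "\<lambda>_ _. 1"])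
      show "z > 0" using z1 by simp
      show "pmax * z < 1" by (rule q)
      show "M N \<ge> 0" by (simp add: M_def)
      show "N \<ge> 1" by (rule N(2))
      fix u :: "'a list" and K :: nat assume u: "u \<noteq> []"
      have x: "0 < xwt z u" "xwt z u < 1" using xwt_pos[of z u] xwt_le[of z u] u z1 q by auto
      have "(\<Sum>k=1..K. xwt z u ^ (k - 1) * (1 - xwt z u) * 1) = (\<Sum>k=1..K. xwt z u ^ (k - 1)) * (1 - xwt z u)"
        by (simp add: sum_distrib_right)
      also have "\<dots> \<le> 1 / (1 - xwt z u) * (1 - xwt z u)"
        using x by (intro mult_right_mono sum_geometric_le) auto
      finally show "(\<Sum>k=1..K. xwt z u ^ (k - 1) * (1 - xwt z u) * 1) \<le> 1" using x by simp
    next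
      fix ps :: "('a list \<times> nat) list"
      assume ps: "aug_path letters ps" "path_length ps = N - 1"
        "ps \<in> {ps. real (length ps) \<le> (1 - \<epsilon>) * typical_steps N}"
      have len: "length ps \<le> N" using length_le_path_length[OF fin_code_letters ps(1)] ps(2) by simp
      let ?F = "\<Prod>t<length ps. code_sum z (code_after letters (take t ps))"
      let ?I = "\<Prod>t<length ps. 1 / (1 - xwt z (fst (ps ! t)))"
      have "?F \<le> exp ((z - 1) * D * real (length ps))"
        using elim(1) ps(1) len by (intro prod_code_sum_upper[OF ps(1) z1]) (auto simp: D_def z_def)
      moreover have "?I \<le> real N powr B"
      proof -
        have "?I \<le> real N powr B'" using elim(2) ps(1) len by (auto simp: z_def)
        also have "\<dots> \<le> real N powr B" using N B by (intro powr_mono) auto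
        finally show ?thesis .
      qed
      moreover have "?F \<ge> 0" "?I \<ge> 0"
        using code_sum_pos[OF reachable_code_after[OF ps(1)]] z1 prod_inverse_mono(2)[OF ps(1), of z z] q
        by (auto intro!: prod_nonneg simp: less_imp_le)
      ultimately have "?F * ?I \<le> exp ((z - 1) * D * real (length ps)) * real N powr B"
        by (intro mult_mono) auto
      also have "\<dots> \<le> exp (\<eta> / ln (real N) * (1 - \<epsilon> / 2) * real N) * real N powr B"
      proof -
        let ?l = "\<eta> / ln (real N)"
        have l0: "?l > 0" using \<eta> lnN by simp
        have "(z - 1) * D * real (length ps) \<le> ((1 + \<epsilon> / 8) * ?l) * D * ((1 - \<epsilon>) * typical_steps N)"
        proof (intro mult_mono)
          show "z - 1 \<le> (1 + \<epsilon> / 8) * ?l" using elim(3) by (simp add: z_def)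
          show "0 \<le> (1 + \<epsilon> / 8) * ?l" using l0 \<epsilon> by (intro mult_nonneg_nonneg) auto
          then show "0 \<le> (1 + \<epsilon> / 8) * ?l * D" by (rule mult_nonneg_nonneg) (use D0 in simp)
        qed (use ps(3) D0 in auto)
        also have "\<dots> = ?l * real N * ((1 + \<epsilon> / 8) * (1 + \<epsilon> / 4) * (1 - \<epsilon>))"
          unfolding D_def typical_steps_def using lnN h_pos by (simp add: field_simps exp_minus)
        also have "\<dots> \<le> ?l * real N * (1 - \<epsilon> / 2)"
        proof (intro mult_left_mono)
          have "(1 + \<epsilon> / 8) * (1 + \<epsilon> / 4) * (1 - \<epsilon>) = 1 - \<epsilon> / 2 - \<epsilon> / 8 - \<epsilon>\<^sup>2 * (11 / 32) - \<epsilon> ^ 3 / 32"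
            by (simp add: field_simps power2_eq_square power3_eq_cube)
          also have "\<dots> \<le> 1 - \<epsilon> / 2"
          proof -
            have "\<epsilon> ^ 3 \<ge> 0" "\<epsilon>\<^sup>2 \<ge> 0" using \<epsilon> by simp_all
            then show ?thesis using \<epsilon> by linarith
          qed
          finally show "(1 + \<epsilon> / 8) * (1 + \<epsilon> / 4) * (1 - \<epsilon>) \<le> 1 - \<epsilon> / 2" .
        qed (intro mult_nonneg_nonneg less_imp_le[OF l0] of_nat_0_le_iff)
        finally show ?thesis by (intro mult_right_mono) (auto simp: mult_ac)
      qed
      also have "\<dots> = M N * z ^ (N - 1)"
      proof -
        have zN: "z ^ (N - 1) = exp (\<eta> / ln (real N) * (real N - 1))"
          unfolding z_def using N(2) by (simp add: exp_of_nat_mult[symmetric] mult.commute of_nat_diff)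
        have split: "exp (l * (1 - \<epsilon> / 2) * real N)
            = exp (- l * (\<epsilon> / 2 * real N - 1)) * exp (l * (real N - 1))" for l
          unfolding exp_add[symmetric] by (simp add: algebra_simps)
        show ?thesis unfolding M_def zN split by (simp only: mult_ac)
      qed
      finally show "(\<Prod>t<length ps. code_sum z (code_after letters (take t ps)) * (1 / (1 - xwt z (fst (ps ! t)))) * (1 / 1))
          \<le> M N * z ^ (N - 1)" by (simp only: prod.distrib div_by_1 prod.neutral_const mult_1_right)
    qed auto
  qed
  have lim: "M \<longlonglongrightarrow> 0"
  proof -
    have "\<epsilon> / 2 > 0" using \<epsilon> by simp
    then have "filterlim (\<lambda>N. B * ln (real N) - \<eta> / ln (real N) * (\<epsilon> / 2 * real N - 1)) at_bot sequentially"
      using \<eta> B(1) by real_asymp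
    then have "(\<lambda>N. exp (B * ln (real N) - \<eta> / ln (real N) * (\<epsilon> / 2 * real N - 1))) \<longlonglongrightarrow> 0"
      by (rule filterlim_compose[OF exp_at_bot])
    moreover have "\<forall>\<^sub>F N in sequentially.
        exp (B * ln (real N) - \<eta> / ln (real N) * (\<epsilon> / 2 * real N - 1)) = M N"
      using eventually_gt_at_top[of 0]
      by eventually_elim (simp add: M_def powr_def exp_add[symmetric])
    ultimately show ?thesis by (rule Lim_transform_eventually)
  qed
  have lower: "\<forall>\<^sub>F N in sequentially. 0 \<le> ?S N"
    by (rule always_eventually, rule allI, rule sum_nonneg, rule less_imp_le[OF wt_pos])
  show ?thesis by (rule tendsto_sandwich[OF lower upper tendsto_const lim])
qed

section \<open>Upper bound for the complexity\<close>

lemma path_exponent_le: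
  fixes ps :: "('a list \<times> nat) list"
  assumes "aug_path letters ps" "t < length ps"
  shows "snd (ps ! t) * length (fst (ps ! t)) \<le> path_length ps" "snd (ps ! t) \<le> path_length ps"
proof -
  show 1: "snd (ps ! t) * length (fst (ps ! t)) \<le> path_length ps"
    unfolding path_length_eq_sum
    using assms(2) by (intro member_le_sum[of t "{..<length ps}" "\<lambda>t. snd (ps ! t) * length (fst (ps ! t))"]) auto
  have "length (fst (ps ! t)) \<ge> 1"
    using path_words_nonempty[OF fin_code_letters assms] by (cases "fst (ps ! t)") auto
  then have "snd (ps ! t) * 1 \<le> snd (ps ! t) * length (fst (ps ! t))" by (intro mult_left_mono) auto
  then show "snd (ps ! t) \<le> path_length ps" using 1 by linarith
qed

text \<open>Each heavy word is eliminated at most once, with exponent at most N, so its cost is at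
  most log2 (N + 1); heavy words are few.\<close>

lemma path_complexity_split:
  assumes ps: "aug_path letters ps" "path_length ps \<le> N" and r: "0 < r" "r \<le> 1"
  shows "path_complexity ps \<le>
    (\<Sum>t<length ps. if fst (ps ! t) \<in> heavy_words r then 0 else log 2 (real (snd (ps ! t)) + 1))
    + ln r / ln pmax / r * log 2 (real N + 1)"
proof -
  let ?u = "\<lambda>t. fst (ps ! t)" and ?k = "\<lambda>t. snd (ps ! t)" and ?H = "heavy_words r"
  have l0: "log 2 (real N + 1) \<ge> 0" by simp
  have "path_complexity ps \<le> (\<Sum>t<length ps. (if ?u t \<in> ?H then 0 else log 2 (real (?k t) + 1))
      + (if ?u t \<in> ?H then log 2 (real N + 1) else 0))"
    unfolding path_complexity_def
  proof (intro sum_mono)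
    fix t assume "t \<in> {..<length ps}"
    then have "real (?k t) + 1 \<le> real N + 1" using path_exponent_le(2)[OF ps(1), of t] ps(2) by simp
    then have "log 2 (real (?k t) + 1) \<le> log 2 (real N + 1)" by (subst log_le_cancel_iff) auto
    then show "log 2 (real (?k t) + 1) \<le> (if ?u t \<in> ?H then 0 else log 2 (real (?k t) + 1))
      + (if ?u t \<in> ?H then log 2 (real N + 1) else 0)" by auto
  qed
  also have "\<dots> = (\<Sum>t<length ps. if ?u t \<in> ?H then 0 else log 2 (real (?k t) + 1))
      + (\<Sum>u\<in>path_words ps. if u \<in> ?H then log 2 (real N + 1) else 0)"
    unfolding sum.distrib using sum_path_words[OF ps(1), of "\<lambda>u. if u \<in> ?H then log 2 (real N + 1) else 0"] by simp
  also have "(\<Sum>u\<in>path_words ps. if u \<in> ?H then log 2 (real N + 1) else 0)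
      = (\<Sum>u\<in>path_words ps \<inter> ?H. log 2 (real N + 1))"
    using path_words_props(1)[OF ps(1)] by (intro sum.mono_neutral_cong_right) auto
  also have "\<dots> \<le> (\<Sum>u\<in>?H. log 2 (real N + 1))"
    using heavy_words_card(1)[OF r] l0 by (intro sum_mono2) auto
  also have "\<dots> = real (card ?H) * log 2 (real N + 1)" by simp
  also have "\<dots> \<le> ln r / ln pmax / r * log 2 (real N + 1)"
    using heavy_words_card(2)[OF r] l0 by (intro mult_right_mono)
  finally show ?thesis by simp
qed

section \<open>A deterministic bound of order N / ln N\<close>

definition pmin :: real where "pmin = Min (range p)"

lemma pmin_pos: "0 < pmin" and pmin_less_1: "pmin < 1"
proof -
  have "pmin \<in> range p" unfolding pmin_def by (rule Min_in) auto
  then show "0 < pmin" "pmin < 1" using p_pos p_less_1 by auto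
qed

lemma wt_ge_pmin: "wt p w \<ge> pmin ^ length w"
proof (induction w)
  case (Cons a w)
  have "pmin \<le> p a" unfolding pmin_def by (rule Min_le) auto
  then show ?case using Cons p_pos[of a] pmin_pos by (auto intro!: mult_mono)
qed simp

lemma typical_steps_pos: "N \<ge> 2 \<Longrightarrow> typical_steps N > 0"
  using h_pos by (simp add: typical_steps_def)

text \<open>A word of probability at most N^(-1/2) has length at least ln N / (2 \<mu>), so its cost
  log2 (k + 1) \<le> k is at most a multiple of k |u| / ln N, and the numbers k |u| add up to N - 1.
  The heavier words cost only sqrt N times powers of ln N.\<close>

lemma T_complexity_deterministic_bound:
  "\<exists>K. \<forall>\<^sub>F N in sequentially. \<forall>w. length w = N \<longrightarrow> T_complexity (w :: 'a list) \<le> K * typical_steps N"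
proof -
  define \<mu> where "\<mu> = - ln pmin"
  define \<kappa> where "\<kappa> = - ln pmax"
  have \<mu>: "\<mu> > 0" using pmin_pos pmin_less_1 by (simp add: \<mu>_def)
  have \<kappa>: "\<kappa> > 0" using pmax_pos pmax_less_1 by (simp add: \<kappa>_def)
  define K where "K = (2 * \<mu> + 1) / (exp (- euler_mascheroni) * h)"
  have "\<forall>\<^sub>F N in sequentially. ln (real N) / (2 * \<kappa>) * real N powr (1/2) * log 2 (real N + 1) \<le> real N / ln (real N)"
    using \<kappa> by real_asymp
  then have "\<forall>\<^sub>F N in sequentially. \<forall>w. length w = N \<longrightarrow> T_complexity (w :: 'a list) \<le> K * typical_steps N"
    using eventually_gt_at_top[of 1]
  proof eventually_elim
    case (elim N)
    have N: "real N > 1" using elim(2) by simp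
    have lnN: "ln (real N) > 0" using N by simp
    define r where "r = real N powr (- (1/2))"
    have r: "0 < r" "r \<le> 1" using N using powr_mono[of "- (1/2)" 0 "real N"] by (auto simp: r_def)
    show ?case
    proof (intro allI impI)
      fix w :: "'a list" assume w: "length w = N"
      define ps where "ps = canonical_recovery w"
      have ne: "w \<noteq> []" using w elim(2) by auto
      have ps: "aug_path letters ps" using canonical_recovery_path[OF ne] by (simp add: ps_def)
      have "length w = path_length ps + 1"
        using canonical_recovery_path(2)[OF ne] unfolding ps_def[symmetric]
        by (metis length_append_singleton length_path_word Suc_eq_plus1)
      then have len: "path_length ps \<le> N" using w by simp
      have light: "(if fst (ps ! t) \<in> heavy_words r then 0 else log 2 (real (snd (ps ! t)) + 1))
          \<le> real (snd (ps ! t) * length (fst (ps ! t))) * (2 * \<mu> / ln (real N))" if t: "t < length ps" for t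
      proof (cases "fst (ps ! t) \<in> heavy_words r")
        case True
        then show ?thesis using \<mu> lnN by simp
      next
        case False
        let ?u = "fst (ps ! t)" and ?k = "snd (ps ! t)"
        have "pmin ^ length ?u \<le> r"
          using False wt_ge_pmin[of ?u] path_words_nonempty[OF fin_code_letters ps t] by (auto simp: heavy_words_def)
        then have "ln (pmin ^ length ?u) \<le> ln r" using pmin_pos r by (subst ln_le_cancel_iff) auto
        then have "real (length ?u) * ln pmin \<le> - (ln (real N) / 2)"
          using pmin_pos N by (simp add: ln_realpow r_def ln_powr)
        moreover have "2 * \<mu> * real (length ?u) = - 2 * (real (length ?u) * ln pmin)" by (simp add: \<mu>_def)
        ultimately have "ln (real N) \<le> 2 * \<mu> * real (length ?u)" by linarith
        then have "1 \<le> real (length ?u) * (2 * \<mu> / ln (real N))" using lnN by (simp add: field_simps)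
        then have "real ?k * 1 \<le> real ?k * (real (length ?u) * (2 * \<mu> / ln (real N)))" by (intro mult_left_mono) auto
        then show ?thesis using False log2_Suc_le[of ?k] by (simp add: mult.assoc)
      qed
      have "path_complexity ps \<le>
        (\<Sum>t<length ps. if fst (ps ! t) \<in> heavy_words r then 0 else log 2 (real (snd (ps ! t)) + 1))
        + ln r / ln pmax / r * log 2 (real N + 1)"
        by (rule path_complexity_split[OF ps len r])
      also have "(\<Sum>t<length ps. if fst (ps ! t) \<in> heavy_words r then 0 else log 2 (real (snd (ps ! t)) + 1))
        \<le> (\<Sum>t<length ps. real (snd (ps ! t) * length (fst (ps ! t))) * (2 * \<mu> / ln (real N)))"
        by (intro sum_mono light) auto
      also have "\<dots> = real (path_length ps) * (2 * \<mu> / ln (real N))"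
        unfolding path_length_eq_sum of_nat_sum sum_distrib_right ..
      also have "\<dots> \<le> real N * (2 * \<mu> / ln (real N))"
      proof (rule mult_right_mono)
        show "real (path_length ps) \<le> real N" using len by simp
        show "0 \<le> 2 * \<mu> / ln (real N)" using \<mu> lnN by (intro divide_nonneg_pos) auto
      qed
      also have "ln r / ln pmax / r * log 2 (real N + 1)
          = ln (real N) / (2 * \<kappa>) * real N powr (1/2) * log 2 (real N + 1)"
      proof -
        have "ln r = - (ln (real N) / 2)" using N by (simp add: r_def ln_powr)
        moreover have "1 / r = real N powr (1/2)" by (simp add: r_def powr_minus_divide)
        then have "ln r / ln pmax / r = ln r / ln pmax * real N powr (1/2)" by (metis times_divide_eq_right mult.right_neutral)
        ultimately show ?thesis by (simp add: \<kappa>_def)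
      qed
      also note elim(1)
      finally have "path_complexity ps \<le> real N * (2 * \<mu> / ln (real N)) + real N / ln (real N)" by simp
      also have "\<dots> = K * typical_steps N"
        unfolding K_def typical_steps_def using h_pos lnN by (simp add: field_simps)
      finally show "T_complexity w \<le> K * typical_steps N" by (simp add: T_complexity_eq ps_def)
    qed
  qed
  then show ?thesis by blast
qed

end

lemma ln_ratio: "a = - ((1 - e) * x) \<Longrightarrow> b = - k \<Longrightarrow> a / b = (1 - e) * (x / (k :: real))"
  by simp

lemma filterlim_at_bot_le:
  fixes f g :: "'b \<Rightarrow> real"
  assumes "\<forall>\<^sub>F x in F. f x \<le> g x" "filterlim g at_bot F"
  shows "filterlim f at_bot F"
  unfolding filterlim_at_bot
proof
  fix Z
  have "\<forall>\<^sub>F x in F. g x \<le> Z" using assms(2) by (simp add: filterlim_at_bot)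
  with assms(1) show "\<forall>\<^sub>F x in F. f x \<le> Z" by eventually_elim linarith
qed

lemma sum_UN_le:
  fixes f :: "'b \<Rightarrow> real"
  assumes "finite A" "\<And>a. a \<in> A \<Longrightarrow> finite (Z a)" "\<And>x. f x \<ge> 0"
  shows "(\<Sum>x\<in>(\<Union>a\<in>A. Z a). f x) \<le> (\<Sum>a\<in>A. \<Sum>x\<in>Z a. f x)"
  using assms
proof (induction A rule: finite_induct)
  case (insert a A)
  have "(\<Sum>x\<in>Z a \<union> (\<Union>a\<in>A. Z a). f x) \<le> (\<Sum>x\<in>Z a. f x) + (\<Sum>x\<in>(\<Union>a\<in>A. Z a). f x)"
    using insert by (subst sum_Un) (auto intro!: sum_nonneg)
  then show ?case using insert by force
qed simp

section \<open>Rarity of surviving heavy codewords and of large complexity\<close>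

context source
begin

text \<open>For z \<le> 1 a factor is 1 - (1 - z) times the expansion. A lower bound for the
  expansion is available only from time \<open>i0\<close> on; earlier factors are bounded by
  1.\<close>

lemma prod_code_sum_lower:
  assumes ps: "aug_path letters ps" and z: "0 < z" "z \<le> 1"
    and D: "\<And>t. t < length ps \<Longrightarrow> i0 \<le> t \<Longrightarrow> expansion z (take t ps) \<ge> D" and D0: "D \<ge> 0"
  shows "(\<Prod>t<length ps. code_sum z (code_after letters (take t ps)))
    \<le> exp (- (1 - z) * D * (real (length ps) - real i0))"
proof -
  have cs: "code_sum z (code_after letters (take t ps)) = 1 - (1 - z) * expansion z (take t ps)" for t
    by (rule code_sum_path[OF aug_path_take[OF ps]])
  have "(\<Prod>t<length ps. code_sum z (code_after letters (take t ps)))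
      \<le> (\<Prod>t<length ps. if i0 \<le> t then exp (- (1 - z) * D) else 1)"
  proof (intro prod_mono conjI)
    fix t assume t: "t \<in> {..<length ps}"
    show "0 \<le> code_sum z (code_after letters (take t ps))"
      using code_sum_pos[OF reachable_code_after[OF ps], of z t] z by simp
    show "code_sum z (code_after letters (take t ps)) \<le> (if i0 \<le> t then exp (- (1 - z) * D) else 1)"
    proof (cases "i0 \<le> t")
      case True
      have "(1 - z) * D \<le> (1 - z) * expansion z (take t ps)"
        using D[of t] t True z by (intro mult_left_mono) auto
      moreover have "- (1 - z) * D = - ((1 - z) * D)" by (rule mult_minus_left)
      ultimately have "code_sum z (code_after letters (take t ps)) \<le> 1 + - (1 - z) * D"
        unfolding cs by linarith
      also have "\<dots> \<le> exp (- (1 - z) * D)" by (rule exp_ge_add_one_self)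
      finally show ?thesis using True by simp
    next
      case False
      have "0 \<le> (1 - z) * expansion z (take t ps)"
        using z expansion_ge_1[OF z(1), of "take t ps"] by (intro mult_nonneg_nonneg) auto
      then show ?thesis using False unfolding cs by simp
    qed
  qed
  also have "\<dots> = (\<Prod>t\<in>{t\<in>{..<length ps}. i0 \<le> t}. exp (- (1 - z) * D))"
    by (intro prod.mono_neutral_cong_right) auto
  also have "{t\<in>{..<length ps}. i0 \<le> t} = {i0..<length ps}" by auto
  also have "(\<Prod>t\<in>{i0..<length ps}. exp (- (1 - z) * D)) = exp (- (1 - z) * D * real (length ps - i0))"
    by (simp add: exp_of_nat_mult[symmetric] mult.commute)
  \<comment> \<open>Passing from truncated to real subtraction only enlarges the right side, which
    may exceed 1 when the path is shorter than \<open>i0\<close>.\<close>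
  also have "\<dots> \<le> exp (- (1 - z) * D * (real (length ps) - real i0))"
  proof (intro exp_le_cancel_iff[THEN iffD2] mult_left_mono_neg)
    show "- (1 - z) * D \<le> 0" using z D0 by (simp add: mult_le_0_iff)
  qed auto
  finally show ?thesis .
qed

text \<open>A union bound over the O(N ln N) heavy words and N starting times. Each event has
  probability at most N^B exp (- \<rho> D), where \<rho> = N^(-1+e) and the window D of length
  N^(1-e/2) give \<rho> D \<ge> N^(e/2).\<close>

lemma survivors_rare:
  assumes e: "0 < e" "e < 1"
  shows "(\<lambda>N. \<Sum>c\<in>heavy_words (real N powr (- 1 + e)). \<Sum>j<N.
    \<Sum>w | length w = N \<and> canonical_recovery w \<in> Collect (survives c j (nat \<lceil>real N powr (1 - e / 2)\<rceil>)). wt p w)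
    \<longlonglongrightarrow> 0"
proof -
  define D where "D N = nat \<lceil>real N powr (1 - e / 2)\<rceil>" for N :: nat
  let ?S = "\<lambda>N. \<Sum>c\<in>heavy_words (real N powr (- 1 + e)). \<Sum>j<N.
    \<Sum>w | length w = N \<and> canonical_recovery w \<in> Collect (survives c j (D N)). wt p w"
  obtain B' where B': "\<forall>\<^sub>F N in sequentially. \<forall>ps. aug_path letters ps \<longrightarrow> length ps \<le> N \<longrightarrow>
    (\<Prod>t<length ps. 1 / (1 - xwt (exp (1 / ln (real N))) (fst (ps ! t)))) \<le> real N powr B'"
    using prod_inverse_polynomial[of 1] by auto
  define B where "B = max B' 1"
  have B: "B > 0" "B' \<le> B" by (auto simp: B_def)
  define \<kappa> where "\<kappa> = - ln pmax"
  have \<kappa>: "\<kappa> > 0" using pmax_pos pmax_less_1 by (simp add: \<kappa>_def)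
  define M where "M N = (ln (real N) / \<kappa> * real N) * (real N * (real N powr B * exp (- (real N powr (e / 2)))))" for N :: nat
  have upper: "\<forall>\<^sub>F N in sequentially. ?S N \<le> M N"
    using B' eventually_pmax_mult_le[of 1] eventually_gt_at_top[of 1]
  proof eventually_elim
    case (elim N)
    have N: "real N > 1" "N \<ge> 1" using elim(3) by simp_all
    have lnN: "ln (real N) > 0" using N by simp
    define z where "z = exp (1 / ln (real N))"
    have z1: "z \<ge> 1" using lnN by (simp add: z_def)
    have "sqrt pmax < 1" using pmax_less_1 by simp
    then have q: "pmax * z < 1" using elim(2) unfolding z_def by linarith
    define \<rho> where "\<rho> = real N powr (- 1 + e)"
    have \<rho>: "0 < \<rho>" "\<rho> \<le> 1" using N e powr_mono[of "- 1 + e" 0 "real N"] by (auto simp: \<rho>_def)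
    have one: "(\<Sum>w | length w = N \<and> canonical_recovery w \<in> Collect (survives c j (D N)). wt p w)
        \<le> real N powr B * exp (- (real N powr (e / 2)))" if c: "c \<in> heavy_words \<rho>" for c j
    proof -
      have "(\<Sum>w | length w = N \<and> canonical_recovery w \<in> Collect (survives c j (D N)). wt p w)
          \<le> real N powr B * (1 - wt p c) ^ D N"
      proof (rule sum_words_survives)
        show "c \<noteq> []" using c by (simp add: heavy_words_def)
        fix ps :: "('a list \<times> nat) list"
        assume ps: "aug_path letters ps" "path_length ps = N - 1"
        have len: "length ps \<le> N" using length_le_path_length[OF fin_code_letters ps(1)] ps(2) by simp
        have "(\<Prod>t<length ps. 1 / (1 - wt p (fst (ps ! t)))) = (\<Prod>t<length ps. 1 / (1 - xwt 1 (fst (ps ! t))))"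
          by (simp add: xwt_def)
        also have "\<dots> \<le> (\<Prod>t<length ps. 1 / (1 - xwt z (fst (ps ! t))))"
          using prod_inverse_mono(1)[OF ps(1), of 1 z] z1 q by simp
        also have "\<dots> \<le> real N powr B'" using elim(1) ps(1) len by (auto simp: z_def)
        also have "\<dots> \<le> real N powr B" using N B by (intro powr_mono) auto
        finally show "(\<Prod>t<length ps. 1 / (1 - wt p (fst (ps ! t)))) \<le> real N powr B" .
      qed (use N in auto)
      also have "(1 - wt p c) ^ D N \<le> exp (- \<rho>) ^ D N"
      proof (rule power_mono)
        have "1 - wt p c \<le> 1 - \<rho>" using c by (simp add: heavy_words_def)
        also have "\<dots> \<le> exp (- \<rho>)" using exp_ge_add_one_self[of "- \<rho>"] by simp
        finally show "1 - wt p c \<le> exp (- \<rho>)" .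
        show "0 \<le> 1 - wt p c" using wt_le_1[of c] by simp
      qed
      also have "exp (- \<rho>) ^ D N = exp (- (\<rho> * real (D N)))"
        by (simp add: exp_of_nat_mult[symmetric] mult.commute)
      also have "\<dots> \<le> exp (- (real N powr (e / 2)))"
      proof -
        have "real N powr (e / 2) = \<rho> * real N powr (1 - e / 2)"
          unfolding \<rho>_def powr_add[symmetric] by (simp add: field_simps)
        also have "\<dots> \<le> \<rho> * real (D N)" using \<rho> by (intro mult_left_mono) (auto simp: D_def real_nat_ceiling_ge)
        finally show ?thesis by simp
      qed
      finally show ?thesis by (simp add: mult_left_mono)
    qed
    have card: "real (card (heavy_words \<rho>)) \<le> ln (real N) / \<kappa> * real N"
    proof -
      have "real (card (heavy_words \<rho>)) \<le> ln \<rho> / ln pmax / \<rho>" by (rule heavy_words_card(2)[OF \<rho>])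
      also have "ln \<rho> / ln pmax = (1 - e) * (ln (real N) / \<kappa>)"
        using N by (intro ln_ratio) (simp_all add: \<rho>_def \<kappa>_def ln_powr algebra_simps)
      also have "(1 - e) * (ln (real N) / \<kappa>) / \<rho> \<le> 1 * (ln (real N) / \<kappa>) / \<rho>"
        using e \<rho> lnN \<kappa> by (intro divide_right_mono mult_right_mono) auto
      also have "1 / \<rho> \<le> real N"
      proof -
        have "1 / \<rho> = real N powr (1 - e)" by (simp add: \<rho>_def powr_minus_divide[symmetric])
        also have "\<dots> \<le> real N powr 1" using N e by (intro powr_mono) auto
        finally show ?thesis using N by simp
      qed
      then have "1 * (ln (real N) / \<kappa>) / \<rho> \<le> ln (real N) / \<kappa> * real N"
        using lnN \<kappa> mult_left_mono[of "1 / \<rho>" "real N" "ln (real N) / \<kappa>"] by simp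
      finally show ?thesis .
    qed
    have "?S N \<le> (\<Sum>c\<in>heavy_words \<rho>. \<Sum>j<N. real N powr B * exp (- (real N powr (e / 2))))"
      unfolding \<rho>_def[symmetric] by (intro sum_mono one)
    also have "\<dots> = real (card (heavy_words \<rho>)) * (real N * (real N powr B * exp (- (real N powr (e / 2)))))"
      by simp
    also have "\<dots> \<le> M N" unfolding M_def by (intro mult_right_mono[OF card]) auto
    finally show ?case .
  qed
  have lower: "\<forall>\<^sub>F N in sequentially. 0 \<le> ?S N"
    by (rule always_eventually, rule allI, intro sum_nonneg, rule less_imp_le[OF wt_pos])
  have "filterlim (\<lambda>N. (3 + B) * ln (real N) - real N powr (e / 2)) at_bot sequentially"
  proof -
    have "e / 2 > 0" "3 + B > 0" using e B by simp_all
    then show ?thesis by real_asymp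
  qed
  then have "(\<lambda>N. exp ((3 + B) * ln (real N) - real N powr (e / 2)) / \<kappa>) \<longlonglongrightarrow> 0 / \<kappa>"
    using \<kappa> by (intro tendsto_divide filterlim_compose[OF exp_at_bot] tendsto_const) auto
  then have lim': "(\<lambda>N. exp ((3 + B) * ln (real N) - real N powr (e / 2)) / \<kappa>) \<longlonglongrightarrow> 0" by simp
  have M_le: "\<forall>\<^sub>F N in sequentially. M N \<le> exp ((3 + B) * ln (real N) - real N powr (e / 2)) / \<kappa>"
    using eventually_gt_at_top[of 0]
  proof eventually_elim
    case (elim N)
    then have N: "real N > 0" by simp
    have "exp ((3 + B) * ln (real N) - real N powr (e / 2))
        = real N ^ 3 * (real N powr B * exp (- (real N powr (e / 2))))"
    proof -
      have "exp ((3 + B) * ln (real N)) = real N powr (3 + B)" using N by (simp add: powr_def)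
      also have "\<dots> = real N powr 3 * real N powr B" by (rule powr_add)
      also have "real N powr 3 = real N ^ 3" by (rule powr_numeral) (use N in simp)
      finally show ?thesis unfolding diff_conv_add_uminus exp_add by (simp only: mult.assoc)
    qed
    moreover have "M N = (ln (real N) * real N * real N) * (real N powr B * exp (- (real N powr (e / 2)))) / \<kappa>"
      by (simp add: M_def)
    moreover have "ln (real N) * real N * real N \<le> real N ^ 3"
      using N ln_bound[of "real N"] by (simp add: power3_eq_cube mult_right_mono)
    ultimately show ?case using \<kappa> by (simp add: divide_right_mono mult_right_mono)
  qed
  have lower': "\<forall>\<^sub>F N in sequentially. ?S N \<le> exp ((3 + B) * ln (real N) - real N powr (e / 2)) / \<kappa>"
    using upper M_le by eventually_elim linarith
  show ?thesis using tendsto_sandwich[OF lower lower' tendsto_const lim'] by (simp add: D_def)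
qed

text \<open>The paths of large complexity to which the lower bound for the expansion applies after
  an initial phase; those with a surviving heavy word are treated by
  \<open>survivors_rare\<close>.\<close>

definition large_paths :: "real \<Rightarrow> real \<Rightarrow> nat \<Rightarrow> ('a list \<times> nat) list set" where
  "large_paths \<epsilon> e N = {ps. path_complexity ps \<ge> (1 + \<epsilon>) * typical_steps N \<and>
    (\<forall>c\<in>heavy_words (real N powr (- 1 + e)). \<forall>j. \<not> survives c j (nat \<lceil>real N powr (1 - e / 2)\<rceil>) ps)}"

text \<open>The factor \<open>exp (\<beta> * (k - 1))\<close> for light codewords penalises exponents \<open>k > 1\<close>, which bounds
  the complexity together with the number of steps.\<close>

lemma bonus_sum_le:
  assumes x: "0 \<le> x" "x \<le> r" and \<delta>: "\<delta> = 2 * exp \<beta> * r" "\<delta> \<le> 1"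
  shows "(\<Sum>k=1..K. x ^ (k - 1) * (1 - x) * (exp (\<beta> * (real k - 1)) / (1 + \<delta>))) \<le> 1"
proof -
  define y where "y = x * exp \<beta>"
  have y: "0 \<le> y" "y \<le> \<delta> / 2" using x by (auto simp: y_def \<delta>(1))
  have \<delta>0: "0 \<le> \<delta>" using x \<delta>(1) by simp
  have y1: "y < 1" using y \<delta> by simp
  have "x ^ (k - 1) * (1 - x) * (exp (\<beta> * (real k - 1)) / (1 + \<delta>)) = (1 - x) / (1 + \<delta>) * y ^ (k - 1)"
    if "k \<in> {1..K}" for k
  proof -
    have "exp (\<beta> * (real k - 1)) = exp \<beta> ^ (k - 1)"
      using that by (simp add: exp_of_nat_mult[symmetric] of_nat_diff mult.commute)
    then show ?thesis by (simp add: y_def power_mult_distrib)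
  qed
  then have "(\<Sum>k=1..K. x ^ (k - 1) * (1 - x) * (exp (\<beta> * (real k - 1)) / (1 + \<delta>)))
      = (1 - x) / (1 + \<delta>) * (\<Sum>k=1..K. y ^ (k - 1))"
    unfolding sum_distrib_left by (rule sum.cong[OF refl])
  also have "\<dots> \<le> 1 / (1 + \<delta>) * (1 / (1 - y))"
  proof (cases "x \<le> 1")
    case True
    then show ?thesis using x y1 y \<delta>0
      by (intro mult_mono divide_right_mono sum_geometric_le sum_nonneg) auto
  next
    case False
    then have "(1 - x) / (1 + \<delta>) * (\<Sum>k=1..K. y ^ (k - 1)) \<le> 0"
      using \<delta>0 y by (intro mult_nonpos_nonneg divide_nonpos_nonneg sum_nonneg) auto
    also have "0 \<le> 1 / (1 + \<delta>) * (1 / (1 - y))" using \<delta>0 y1 by simp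
    finally show ?thesis .
  qed
  also have "\<dots> \<le> 1"
  proof -
    \<comment> \<open>(1 + \<delta>) (1 - \<delta>/2) = 1 + \<delta>/2 - \<delta>^2/2, which is at
      least 1 for \<delta> in [0, 1]; hence the factor 2 in the choice of \<delta>.\<close>
    have "\<delta> * \<delta> \<le> \<delta> * 1" using \<delta>0 \<delta>(2) by (intro mult_left_mono)
    then have "1 \<le> (1 + \<delta>) * (1 - \<delta> / 2)" by (simp add: algebra_simps)
    also have "\<dots> \<le> (1 + \<delta>) * (1 - y)" using y \<delta>0 by (intro mult_left_mono) auto
    finally show ?thesis using \<delta>0 y1 by (simp add: divide_le_eq)
  qed
  finally show ?thesis .
qed

text \<open>With z = exp (-\<eta> / ln N), each step after the initial phase costs exp (-a) with a
  close to \<beta>, and each extra unit of exponent of a light word costs exp (-\<beta>). Steps and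
  extra units together number at least (1 + \<epsilon>) \<open>typical_steps N\<close> up to the
  heavy part H, whereas z^(N-1) is no smaller than exp (-\<beta>
  \<open>typical_steps N\<close>).\<close>

lemma large_paths_rare:
  assumes \<epsilon>: "0 < \<epsilon>" "\<epsilon> < 1"
  shows "\<exists>e. 0 < e \<and> e < 1 \<and>
    (\<lambda>N. \<Sum>w | length w = N \<and> canonical_recovery w \<in> large_paths \<epsilon> e N. wt p w) \<longlonglongrightarrow> 0"
proof -
  obtain e \<eta> where e: "0 < e" "e < 1" and \<eta>: "\<eta> > 0"
    and low: "\<forall>\<^sub>F N in sequentially. \<forall>ps. aug_path letters ps \<longrightarrow>
    (\<forall>c\<in>code_after letters ps. wt p c \<le> real N powr (- 1 + e)) \<longrightarrow>
    expansion (exp (- \<eta> / ln (real N))) ps \<ge> exp euler_mascheroni * (1 - \<epsilon> / 8) * ln (real N) / h"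
    using expansion_lower[of "\<epsilon> / 8"] \<epsilon> by auto
  let ?S = "\<lambda>N. \<Sum>w | length w = N \<and> canonical_recovery w \<in> large_paths \<epsilon> e N. wt p w"
  obtain B' where B': "\<forall>\<^sub>F N in sequentially. \<forall>ps. aug_path letters ps \<longrightarrow> length ps \<le> N \<longrightarrow>
    (\<Prod>t<length ps. 1 / (1 - xwt (exp (1 / ln (real N))) (fst (ps ! t)))) \<le> real N powr B'"
    using prod_inverse_polynomial[of 1] by auto
  define B where "B = max B' 1"
  have B: "B > 0" "B' \<le> B" by (auto simp: B_def)
  define \<kappa> where "\<kappa> = - ln pmax"
  have \<kappa>: "\<kappa> > 0" using pmax_pos pmax_less_1 by (simp add: \<kappa>_def)
  \<comment> \<open>The tilt \<eta> / ln N times the mean length exp \<gamma> ln N / h, that is, the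
    decay rate per step; z^N is then exactly exp (-\<beta> \<open>typical_steps N\<close>).\<close>
  define \<beta> where "\<beta> = \<eta> * exp euler_mascheroni / h"
  have \<beta>: "\<beta> > 0" using \<eta> h_pos by (simp add: \<beta>_def)
  define D where "D N = nat \<lceil>real N powr (1 - e / 2)\<rceil>" for N :: nat
  \<comment> \<open>A codeword heavier than N^(-1+e) is shorter than ln N / \<kappa>, so by
    \<open>heavy_codeword_time\<close> it cannot be present at this time or later.\<close>
  define i0 where "i0 N = nat \<lceil>ln (real N) / \<kappa> * real (D N + 1)\<rceil>" for N :: nat
  define r where "r N = real N powr (- (1/2))" for N :: nat
  \<comment> \<open>Normalising the bonus costs 1 + \<delta> per step, at most exp (N \<delta>) in
    all. With r = N^(-1/2) both N \<delta> and the number of words heavier than r are of order sqrt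
    N, up to logarithms.\<close>
  define \<delta> where "\<delta> N = 2 * exp \<beta> * r N" for N :: nat
  define H where "H N = ln (r N) / ln pmax / r N * log 2 (real N + 1)" for N :: nat
  define E where "E N = B * ln (real N) + real N * \<delta> N + \<beta> * (H N + real (i0 N))
    - \<beta> * (\<epsilon> / 2) * typical_steps N" for N :: nat
  have ev: "\<forall>\<^sub>F N in sequentially. 1 - exp (- \<eta> / ln (real N)) \<ge> (1 - \<epsilon> / 8) * (\<eta> / ln (real N))"
  proof -
    have "\<epsilon> / 8 > 0" using \<epsilon> by simp
    then show ?thesis using \<eta> by real_asymp
  qed
  have ev_\<delta>: "\<forall>\<^sub>F N in sequentially. \<delta> N \<le> 1"
    unfolding \<delta>_def r_def by real_asymp
  \<comment> \<open>Makes (1 + \<epsilon>) \<open>typical_steps N\<close> - H N nonnegative, so that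
    the rate a multiplying it may be replaced by its lower bound.\<close>
  have ev_H: "\<forall>\<^sub>F N in sequentially. H N \<le> (1 + \<epsilon>) * typical_steps N"
  proof -
    define c where "c = (1 + \<epsilon>) * (exp (- euler_mascheroni) * h)"
    have c: "c > 0" using \<epsilon> h_pos by (simp add: c_def)
    have "\<forall>\<^sub>F N in sequentially. (ln (real N) / 2 / \<kappa>) * real N powr (1/2) * log 2 (real N + 1) \<le> c * (real N / ln (real N))"
      using c \<kappa> by real_asymp
    then show ?thesis using eventually_gt_at_top[of 1]
    proof eventually_elim
      case (elim N)
      have "1 / r N = real N powr (1/2)" by (simp add: r_def powr_minus_divide)
      then have "H N = ln (r N) / ln pmax * real N powr (1/2) * log 2 (real N + 1)"
        unfolding H_def by (metis times_divide_eq_right mult.right_neutral)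
      also have "ln (r N) / ln pmax = ln (real N) / 2 / \<kappa>" using elim(2) by (simp add: r_def \<kappa>_def ln_powr)
      finally show ?case using elim(1) by (simp add: c_def typical_steps_def mult_ac)
    qed
  qed
  have upper: "\<forall>\<^sub>F N in sequentially. ?S N \<le> exp (E N)"
    using low B' ev ev_\<delta> ev_H eventually_pmax_mult_le[of 1] eventually_gt_at_top[of 1]
  proof eventually_elim
    case (elim N)
    have N: "real N > 1" "N \<ge> 1" using elim(7) by simp_all
    have lnN: "ln (real N) > 0" using N by simp
    define l where "l = \<eta> / ln (real N)"
    have l: "l > 0" using \<eta> lnN by (simp add: l_def)
    define z where "z = exp (- l)"
    have z: "0 < z" "z \<le> 1" using l by (auto simp: z_def)
    have q: "pmax * z < 1" using z pmax_pos pmax_less_1 mult_left_le[of z pmax] by linarith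
    \<comment> \<open>A tilt above 1, for which \<open>prod_inverse_polynomial\<close> bounds the
      product of the geometric constants; that product increases with the tilt.\<close>
    define z1 where "z1 = exp (1 / ln (real N))"
    have "sqrt pmax < 1" using pmax_less_1 by simp
    then have q1: "pmax * z1 < 1" using elim(6) unfolding z1_def by linarith
    have z1: "z \<le> z1" using z lnN unfolding z1_def by (intro order_trans[OF z(2)]) simp
    have r: "0 < r N" "r N \<le> 1" using N powr_mono[of "- (1/2)" 0 "real N"] by (auto simp: r_def)
    have \<delta>0: "\<delta> N > 0" using r by (simp add: \<delta>_def)
    define \<rho> where "\<rho> = real N powr (- 1 + e)"
    have \<rho>: "0 < \<rho>" using N by (simp add: \<rho>_def)
    define Dm where "Dm = exp euler_mascheroni * (1 - \<epsilon> / 8) * ln (real N) / h"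
    have Dm: "Dm > 0" using \<epsilon> lnN h_pos by (simp add: Dm_def)
    define a where "a = (1 - z) * Dm"
    have lb: "l * (exp euler_mascheroni * ln (real N) / h) = \<beta>" using lnN by (simp add: l_def \<beta>_def)
    \<comment> \<open>Ensures that the penalty \<beta> per extra unit of exponent is no weaker than
      the rate a per step, so that both can be counted together at rate a.\<close>
    have a_up: "a \<le> \<beta>"
    proof -
      have "1 - z \<le> l" using exp_ge_add_one_self[of "- l"] by (simp add: z_def)
      then have "a \<le> l * Dm" unfolding a_def using Dm by (intro mult_right_mono) auto
      also have "\<dots> = (1 - \<epsilon> / 8) * \<beta>" unfolding lb[symmetric] Dm_def by simp
      also have "\<dots> \<le> 1 * \<beta>" using \<epsilon> \<beta> by (intro mult_right_mono) auto
      finally show ?thesis by simp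
    qed
    have a_low: "(1 - \<epsilon> / 4) * \<beta> \<le> a"
    proof -
      have "(1 - \<epsilon> / 8) * l \<le> 1 - z" using elim(3) by (simp add: z_def l_def)
      then have "((1 - \<epsilon> / 8) * l) * Dm \<le> a" unfolding a_def using Dm by (intro mult_right_mono) auto
      moreover have "((1 - \<epsilon> / 8) * l) * Dm = (1 - \<epsilon> / 8)\<^sup>2 * \<beta>"
        unfolding lb[symmetric] Dm_def by (simp add: power2_eq_square)
      moreover have "(1 - \<epsilon> / 4) * \<beta> \<le> (1 - \<epsilon> / 8)\<^sup>2 * \<beta>"
        using \<beta> by (intro mult_right_mono) (auto simp: power2_eq_square algebra_simps)
      ultimately show ?thesis by linarith
    qed
    have a0: "a \<ge> 0" using z Dm by (simp add: a_def)
    \<comment> \<open>Heavy words get no bonus, since exp \<beta> times their weight need not be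
      small; their exponents are charged to \<open>H N\<close> instead.\<close>
    define b where "b u k = (if u \<in> heavy_words (r N) then 1 else exp (\<beta> * (real k - 1)) / (1 + \<delta> N))" for u and k :: nat
    show ?case
    proof (rule sum_words_le_tilted[OF z(1) q _ N(2), where b = b])
      show "0 \<le> exp (E N)" by simp
      show "0 < b u k" for u k using \<delta>0 by (simp add: b_def)
    next
      fix u :: "'a list" and K :: nat assume u: "u \<noteq> []"
      have x: "0 < xwt z u" "xwt z u < 1" using xwt_pos[of z u] xwt_le[of z u] u z q by auto
      show "(\<Sum>k=1..K. xwt z u ^ (k - 1) * (1 - xwt z u) * b u k) \<le> 1"
      proof (cases "u \<in> heavy_words (r N)")
        case True
        then have "(\<Sum>k=1..K. xwt z u ^ (k - 1) * (1 - xwt z u) * b u k) = (\<Sum>k=1..K. xwt z u ^ (k - 1)) * (1 - xwt z u)"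
          by (simp add: sum_distrib_right b_def)
        also have "\<dots> \<le> 1 / (1 - xwt z u) * (1 - xwt z u)"
          using x by (intro mult_right_mono sum_geometric_le) auto
        finally show ?thesis using x by simp
      next
        case False
        have "xwt z u \<le> wt p u * 1"
          unfolding xwt_def using z wt_pos[of u] by (intro mult_left_mono power_le_one) (auto simp: less_imp_le)
        also have "\<dots> \<le> r N" using False u by (simp add: heavy_words_def)
        finally have "xwt z u \<le> r N" .
        then show ?thesis
          using bonus_sum_le[of "xwt z u" "r N" "\<delta> N" \<beta> K] False x elim(4) by (simp add: b_def \<delta>_def)
      qed
    next
      fix ps :: "('a list \<times> nat) list"
      assume ps: "aug_path letters ps" "path_length ps = N - 1" "ps \<in> large_paths \<epsilon> e N"
      let ?u = "\<lambda>t. fst (ps ! t)" and ?k = "\<lambda>t. snd (ps ! t)"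
      let ?F = "\<Prod>t<length ps. code_sum z (code_after letters (take t ps))"
      let ?I = "\<Prod>t<length ps. 1 / (1 - xwt z (?u t))"
      let ?J = "\<Prod>t<length ps. 1 / b (?u t) (?k t)"
      have len: "length ps \<le> N" using length_le_path_length[OF fin_code_letters ps(1)] ps(2) by simp
      define X where "X t = (if ?u t \<in> heavy_words (r N) then 0 else real (?k t) - 1)" for t
      have k1: "?k t \<ge> 1" if "t < length ps" for t using aug_path_nth(2)[OF ps(1) that] .
      define K where "K = (\<Sum>t<length ps. X t)"
      have no: "\<not> survives c j (D N) ps" if "c \<in> heavy_words \<rho>" for c j
        using ps(3) that by (auto simp: large_paths_def D_def \<rho>_def)
      have F: "?F \<le> exp (- a * (real (length ps) - real (i0 N)))"
      proof -
        have "expansion z (take t ps) \<ge> Dm" if t: "t < length ps" "i0 N \<le> t" for t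
        proof -
          have "wt p c \<le> \<rho>" if c: "c \<in> code_after letters (take t ps)" for c
          proof (rule ccontr)
            assume "\<not> wt p c \<le> \<rho>"
            then have ch: "c \<in> heavy_words \<rho>"
              using fin_code_nonempty[OF fin_code_reachable[OF reachable_code_after[OF ps(1)]] c]
              by (simp add: heavy_words_def)
            have "t \<le> length c * (D N + 1)"
              by (rule heavy_codeword_time[OF ps(1) no _ c ch]) (use t in auto)
            then have "real t \<le> real (length c) * real (D N + 1)" by (metis of_nat_le_iff of_nat_mult)
            also have "\<dots> < ln (real N) / \<kappa> * real (D N + 1)"
            proof (rule mult_strict_right_mono)
              have "real (length c) < ln \<rho> / ln pmax" by (rule heavy_word_length[OF ch \<rho>])
              also have "\<dots> = (1 - e) * (ln (real N) / \<kappa>)"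
                using N by (intro ln_ratio) (simp_all add: \<rho>_def \<kappa>_def ln_powr algebra_simps)
              also have "\<dots> \<le> 1 * (ln (real N) / \<kappa>)" using e lnN \<kappa> by (intro mult_right_mono) auto
              finally show "real (length c) < ln (real N) / \<kappa>" by simp
            qed simp
            also have "\<dots> \<le> real (i0 N)" unfolding i0_def by (rule real_nat_ceiling_ge)
            finally show False using t(2) by simp
          qed
          then show ?thesis
            using elim(1) aug_path_take[OF ps(1), of t] by (auto simp: Dm_def z_def l_def \<rho>_def)
        qed
        then have "?F \<le> exp (- (1 - z) * Dm * (real (length ps) - real (i0 N)))"
          using Dm by (intro prod_code_sum_lower[OF ps(1) z]) auto
        then show ?thesis unfolding a_def by (simp only: mult_minus_left)
      qed
      have I: "?I \<le> exp (B * ln (real N))" "?I \<ge> 0"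
      proof -
        have "?I \<le> (\<Prod>t<length ps. 1 / (1 - xwt z1 (?u t)))" by (rule prod_inverse_mono(1)[OF ps(1) z(1) z1 q1])
        also have "\<dots> \<le> real N powr B'" using elim(2) ps(1) len by (auto simp: z1_def)
        also have "\<dots> \<le> real N powr B" using N B by (intro powr_mono) auto
        also have "\<dots> = exp (B * ln (real N))" using N by (simp add: powr_def)
        finally show "?I \<le> exp (B * ln (real N))" .
        show "?I \<ge> 0" by (rule prod_inverse_mono(2)[OF ps(1) z(1) _ q]) simp
      qed
      have J: "?J \<le> exp (real N * \<delta> N - \<beta> * K)"
      proof -
        have "?J \<le> (\<Prod>t<length ps. exp (\<delta> N - \<beta> * X t))"
        proof (intro prod_mono conjI)
          fix t
          show "0 \<le> 1 / b (?u t) (?k t)" using \<delta>0 by (simp add: b_def)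
          show "1 / b (?u t) (?k t) \<le> exp (\<delta> N - \<beta> * X t)"
          proof (cases "?u t \<in> heavy_words (r N)")
            case True
            then show ?thesis using \<delta>0 by (simp add: b_def X_def)
          next
            case False
            then have "1 / b (?u t) (?k t) = (1 + \<delta> N) * exp (- (\<beta> * X t))"
              by (simp add: b_def X_def exp_minus divide_inverse)
            also have "\<dots> \<le> exp (\<delta> N) * exp (- (\<beta> * X t))"
              by (intro mult_right_mono exp_ge_add_one_self) auto
            finally show ?thesis by (simp add: exp_add[symmetric])
          qed
        qed
        also have "\<dots> = exp (real (length ps) * \<delta> N - \<beta> * K)"
          by (simp add: exp_sum[symmetric] sum_subtractf K_def sum_distrib_left)
        also have "\<dots> \<le> exp (real N * \<delta> N - \<beta> * K)" using len \<delta>0 by simp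
        finally show ?thesis .
      qed
      have J0: "?J \<ge> 0" using \<delta>0 by (intro prod_nonneg) (simp add: b_def)
      have K0: "K \<ge> 0" unfolding K_def X_def using k1 by (intro sum_nonneg) auto
      have mK: "real (length ps) + K \<ge> (1 + \<epsilon>) * typical_steps N - H N"
      proof -
        have "path_complexity ps \<le> (\<Sum>t<length ps. if ?u t \<in> heavy_words (r N) then 0 else log 2 (real (?k t) + 1)) + H N"
          unfolding H_def using ps(2) by (intro path_complexity_split[OF ps(1) _ r]) simp
        also have "(\<Sum>t<length ps. if ?u t \<in> heavy_words (r N) then 0 else log 2 (real (?k t) + 1)) \<le> (\<Sum>t<length ps. 1 + X t)"
          using log2_Suc_le by (intro sum_mono) (auto simp: X_def)
        also have "\<dots> = real (length ps) + K" by (simp add: sum.distrib K_def)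
        finally show ?thesis using ps(3) by (simp add: large_paths_def)
      qed
      have zN: "z ^ (N - 1) \<ge> exp (- (\<beta> * typical_steps N))"
      proof -
        have "z ^ (N - 1) = exp (- (l * (real N - 1)))"
          unfolding z_def using N(2) by (simp add: exp_of_nat_mult[symmetric] mult.commute of_nat_diff)
        moreover have "\<beta> * typical_steps N = l * real N"
          unfolding \<beta>_def typical_steps_def l_def using h_pos by (simp add: exp_minus)
        ultimately show ?thesis using l by simp
      qed
      have "?F * ?I * ?J \<le> exp (- a * (real (length ps) - real (i0 N))) * exp (B * ln (real N)) * exp (real N * \<delta> N - \<beta> * K)"
        using F I J J0 by (intro mult_mono) (auto intro!: mult_nonneg_nonneg prod_nonneg
          intro: less_imp_le[OF code_sum_pos[OF reachable_code_after[OF ps(1)] z(1)]])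
      also have "\<dots> = exp (- a * (real (length ps) - real (i0 N)) + B * ln (real N) + (real N * \<delta> N - \<beta> * K))"
        by (simp only: exp_add)
      also have "\<dots> \<le> exp (E N - \<beta> * typical_steps N)"
      proof -
        have "a * real (i0 N) \<le> \<beta> * real (i0 N)" using a_up by (intro mult_right_mono) auto
        moreover have "a * K \<le> \<beta> * K" using a_up K0 by (intro mult_right_mono) auto
        moreover have "a * ((1 + \<epsilon>) * typical_steps N - H N) \<le> a * (real (length ps) + K)"
          using mK a0 by (intro mult_left_mono)
        moreover have "((1 - \<epsilon> / 4) * \<beta>) * ((1 + \<epsilon>) * typical_steps N - H N) \<le> a * ((1 + \<epsilon>) * typical_steps N - H N)"
          using a_low elim(5) by (intro mult_right_mono) auto
        \<comment> \<open>(1 - \<epsilon>/4) (1 + \<epsilon>) is at least 1 + \<epsilon>/2 for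
          \<epsilon> \<le> 1, and the factor 1 - \<epsilon>/4 on H is dropped.\<close>
        moreover have "\<beta> * (1 + \<epsilon> / 2) * typical_steps N - \<beta> * H N
            \<le> ((1 - \<epsilon> / 4) * \<beta>) * ((1 + \<epsilon>) * typical_steps N - H N)"
        proof -
          have "1 + \<epsilon> / 2 \<le> (1 - \<epsilon> / 4) * (1 + \<epsilon>)"
          proof -
            have "\<epsilon> * \<epsilon> \<le> \<epsilon> * 1" using \<epsilon> by (intro mult_left_mono) auto
            moreover have "(1 - \<epsilon> / 4) * (1 + \<epsilon>) = 1 + 3 * \<epsilon> / 4 - \<epsilon> * \<epsilon> / 4"
              by (simp add: field_simps)
            ultimately show ?thesis by linarith
          qed
          then have "(\<beta> * typical_steps N) * (1 + \<epsilon> / 2) \<le> (\<beta> * typical_steps N) * ((1 - \<epsilon> / 4) * (1 + \<epsilon>))"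
            using \<beta> typical_steps_pos[of N] elim(7) by (intro mult_left_mono) auto
          moreover have "(1 - \<epsilon> / 4) * (\<beta> * H N) \<le> 1 * (\<beta> * H N)"
          proof (rule mult_right_mono)
            have "ln (r N) / ln pmax \<ge> 0" using r pmax_pos pmax_less_1 by (intro divide_nonpos_neg) auto
            moreover have "log 2 (real N + 1) \<ge> 0" by simp
            ultimately have "H N \<ge> 0" unfolding H_def using r
              by (intro mult_nonneg_nonneg divide_nonneg_pos[of "ln (r N) / ln pmax"]) auto
            then show "0 \<le> \<beta> * H N" using \<beta> by simp
          qed (use \<epsilon> in simp)
          moreover have "\<beta> * (1 + \<epsilon> / 2) * typical_steps N = (\<beta> * typical_steps N) * (1 + \<epsilon> / 2)"
            by (simp only: mult_ac)
          moreover have "((1 - \<epsilon> / 4) * \<beta>) * ((1 + \<epsilon>) * typical_steps N - H N)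
              = (\<beta> * typical_steps N) * ((1 - \<epsilon> / 4) * (1 + \<epsilon>)) - (1 - \<epsilon> / 4) * (\<beta> * H N)"
            unfolding right_diff_distrib by (simp only: mult_ac)
          ultimately show ?thesis by linarith
        qed
        ultimately have "- a * (real (length ps) - real (i0 N)) + B * ln (real N) + (real N * \<delta> N - \<beta> * K)
            \<le> E N - \<beta> * typical_steps N"
          unfolding E_def by (simp add: algebra_simps)
        then show ?thesis by simp
      qed
      also have "\<dots> = exp (E N) * exp (- (\<beta> * typical_steps N))" by (simp add: exp_add[symmetric])
      also have "\<dots> \<le> exp (E N) * z ^ (N - 1)" using zN by (intro mult_left_mono) auto
      finally show "(\<Prod>t<length ps. code_sum z (code_after letters (take t ps)) * (1 / (1 - xwt z (?u t)))
          * (1 / b (?u t) (?k t))) \<le> exp (E N) * z ^ (N - 1)" by (simp only: prod.distrib)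
    qed
  qed
  have lower: "\<forall>\<^sub>F N in sequentially. 0 \<le> ?S N"
    by (rule always_eventually, rule allI, rule sum_nonneg, rule less_imp_le[OF wt_pos])
  have "filterlim E at_bot sequentially"
  proof -
    define c where "c = \<beta> * (\<epsilon> / 2) * (exp (- euler_mascheroni) * h)"
    have c: "c > 0" using \<beta> \<epsilon> h_pos by (simp add: c_def)
    \<comment> \<open>A majorant of E in closed form: the ceilings in \<open>D\<close> and
      \<open>i0\<close> are replaced by additive constants.\<close>
    define g where "g N = B * ln (real N) + 2 * exp \<beta> * real N powr (1/2)
      + \<beta> * ((ln (real N) / 2 / \<kappa>) * real N powr (1/2) * log 2 (real N + 1)
        + (ln (real N) / \<kappa> * (real N powr (1 - e / 2) + 2) + 1)) - c * (real N / ln (real N))" for N :: nat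
    have "filterlim g at_bot sequentially"
    proof -
      define e2 where "e2 = e / 2"
      have e2: "0 < e2" "e2 < 1" using e by (auto simp: e2_def)
      have 1: "\<forall>\<^sub>F N in sequentially. B * ln (real N) + 2 * exp \<beta> * real N powr (1/2) \<le> c / 4 * (real N / ln (real N))"
        using B(1) c by real_asymp
      have 2: "\<forall>\<^sub>F N in sequentially. \<beta> * ((ln (real N) / 2 / \<kappa>) * real N powr (1/2) * log 2 (real N + 1))
          \<le> c / 4 * (real N / ln (real N))"
        using \<beta> \<kappa> c by real_asymp
      have 3: "\<forall>\<^sub>F N in sequentially. \<beta> * (ln (real N) / \<kappa> * (real N powr (1 - e / 2) + 2) + 1)
          \<le> c / 4 * (real N / ln (real N))"
        unfolding e2_def[symmetric] using \<beta> \<kappa> c e2 by real_asymp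
      have "\<forall>\<^sub>F N in sequentially. g N \<le> - (c / 4) * (real N / ln (real N))"
        using 1 2 3 by eventually_elim (simp add: g_def distrib_left)
      moreover have "filterlim (\<lambda>N. - (c / 4) * (real N / ln (real N))) at_bot sequentially"
        using c by real_asymp
      ultimately show ?thesis by (rule filterlim_at_bot_le)
    qed
    moreover have E_le: "\<forall>\<^sub>F N in sequentially. E N \<le> g N"
      using eventually_gt_at_top[of 1]
    proof eventually_elim
      case (elim N)
      have N: "real N > 1" using elim by simp
      have lnN: "ln (real N) > 0" using N by simp
      have "1 / r N = real N powr (1/2)" by (simp add: r_def powr_minus_divide)
      then have "H N = ln (r N) / ln pmax * real N powr (1/2) * log 2 (real N + 1)"
        unfolding H_def by (metis times_divide_eq_right mult.right_neutral)
      also have "ln (r N) / ln pmax = ln (real N) / 2 / \<kappa>" using N by (simp add: r_def \<kappa>_def ln_powr)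
      finally have HN: "H N = (ln (real N) / 2 / \<kappa>) * real N powr (1/2) * log 2 (real N + 1)" .
      have dN: "real N * \<delta> N = 2 * exp \<beta> * real N powr (1/2)"
      proof -
        have "real N * r N = real N powr 1 * real N powr (- (1/2))" using N by (simp add: r_def)
        also have "\<dots> = real N powr (1/2)" unfolding powr_add[symmetric] by simp
        finally show ?thesis by (simp add: \<delta>_def)
      qed
      have "real (D N) \<le> real N powr (1 - e / 2) + 1"
        unfolding D_def by (simp add: of_nat_ceiling)
      then have "ln (real N) / \<kappa> * real (D N + 1) \<le> ln (real N) / \<kappa> * (real N powr (1 - e / 2) + 2)"
        using lnN \<kappa> by (intro mult_left_mono) auto
      moreover have "real (i0 N) \<le> ln (real N) / \<kappa> * real (D N + 1) + 1"
      proof -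
        have "0 \<le> ln (real N) / \<kappa> * real (D N + 1)" using lnN \<kappa> by simp
        then show ?thesis unfolding i0_def by linarith
      qed
      ultimately have "real (i0 N) \<le> ln (real N) / \<kappa> * (real N powr (1 - e / 2) + 2) + 1" by linarith
      then have "\<beta> * (H N + real (i0 N)) \<le> \<beta> * (H N + (ln (real N) / \<kappa> * (real N powr (1 - e / 2) + 2) + 1))"
        using \<beta> by (intro mult_left_mono) auto
      moreover have "\<beta> * (\<epsilon> / 2) * typical_steps N = c * (real N / ln (real N))"
        by (simp add: c_def typical_steps_def)
      ultimately show ?case unfolding E_def g_def HN dN by linarith
    qed
    ultimately show ?thesis using filterlim_at_bot_le by blast
  qed
  then have lim: "(\<lambda>N. exp (E N)) \<longlonglongrightarrow> 0" by (rule filterlim_compose[OF exp_at_bot])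
  have "?S \<longlonglongrightarrow> 0" by (rule tendsto_sandwich[OF lower upper tendsto_const lim])
  then show ?thesis using e by blast
qed

lemma large_complexity:
  assumes \<epsilon>: "0 < \<epsilon>" "\<epsilon> < 1"
  shows "(\<lambda>N. \<Sum>w | length w = N \<and> T_complexity w \<ge> (1 + \<epsilon>) * typical_steps N. wt p w) \<longlonglongrightarrow> 0"
proof -
  obtain e where e: "0 < e" "e < 1" and
    L: "(\<lambda>N. \<Sum>w | length w = N \<and> canonical_recovery w \<in> large_paths \<epsilon> e N. wt p w) \<longlonglongrightarrow> 0"
    using large_paths_rare[OF \<epsilon>] by blast
  let ?\<rho> = "\<lambda>N::nat. real N powr (- 1 + e)" and ?D = "\<lambda>N::nat. nat \<lceil>real N powr (1 - e / 2)\<rceil>"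
  let ?A = "\<lambda>N. {w. length w = N \<and> canonical_recovery w \<in> large_paths \<epsilon> e N}"
  let ?Z = "\<lambda>N c j. {w. length w = N \<and> canonical_recovery w \<in> Collect (survives c j (?D N))}"
  let ?S = "\<lambda>N. \<Sum>w | length w = N \<and> T_complexity w \<ge> (1 + \<epsilon>) * typical_steps N. wt p w"
  let ?R = "\<lambda>N. \<Sum>c\<in>heavy_words (?\<rho> N). \<Sum>j<N. \<Sum>w\<in>?Z N c j. wt p w"
  have lim: "(\<lambda>N. (\<Sum>w\<in>?A N. wt p w) + ?R N) \<longlonglongrightarrow> 0"
    using tendsto_add[OF L survivors_rare[OF e]] by simp
  have fin: "finite {w :: 'a list. length w = N \<and> Q w}" for N Q
    by (rule finite_subset[of _ "{w. length w = N}"]) auto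
  have upper: "\<forall>\<^sub>F N in sequentially. ?S N \<le> (\<Sum>w\<in>?A N. wt p w) + ?R N"
    using eventually_gt_at_top[of 1]
  proof eventually_elim
    case (elim N)
    have N: "real N > 1" using elim by simp
    have \<rho>: "0 < ?\<rho> N" "?\<rho> N \<le> 1" using N e powr_mono[of "- 1 + e" 0 "real N"] by auto
    have sub: "{w. length w = N \<and> T_complexity w \<ge> (1 + \<epsilon>) * typical_steps N}
      \<subseteq> ?A N \<union> (\<Union>(c, j)\<in>heavy_words (?\<rho> N) \<times> {..<N}. ?Z N c j)"
    proof
      fix w :: "'a list" assume w: "w \<in> {w. length w = N \<and> T_complexity w \<ge> (1 + \<epsilon>) * typical_steps N}"
      let ?ps = "canonical_recovery w"
      show "w \<in> ?A N \<union> (\<Union>(c, j)\<in>heavy_words (?\<rho> N) \<times> {..<N}. ?Z N c j)"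
      proof (cases "?ps \<in> large_paths \<epsilon> e N")
        case True
        then show ?thesis using w by simp
      next
        case False
        then obtain c j where cj: "c \<in> heavy_words (?\<rho> N)" "survives c j (?D N) ?ps"
          using w by (auto simp: large_paths_def T_complexity_eq)
        have ne: "w \<noteq> []" using w elim by auto
        have "length w = path_length ?ps + 1"
          by (metis canonical_recovery_path(2)[OF ne] length_append_singleton length_path_word Suc_eq_plus1)
        then have "length ?ps < N"
          using length_le_path_length[OF fin_code_letters canonical_recovery_path(1)[OF ne]] w by simp
        \<comment> \<open>The window must fit into a path of fewer than N steps, which leaves at
          most N starting times for the union bound.\<close>
        then have "j < N" using cj(2) by (simp add: survives_def)
        then show ?thesis using cj w by auto
      qed
    qed
    have "?S N \<le> (\<Sum>w\<in>?A N \<union> (\<Union>(c, j)\<in>heavy_words (?\<rho> N) \<times> {..<N}. ?Z N c j). wt p w)"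
      using sub wt_pos heavy_words_card(1)[OF \<rho>]
      by (intro sum_mono2) (auto simp: less_imp_le intro!: fin)
    also have "\<dots> \<le> (\<Sum>w\<in>?A N. wt p w) + (\<Sum>w\<in>(\<Union>(c, j)\<in>heavy_words (?\<rho> N) \<times> {..<N}. ?Z N c j). wt p w)"
      using heavy_words_card(1)[OF \<rho>] wt_pos
      by (subst sum_Un) (auto simp: less_imp_le intro!: fin sum_nonneg)
    also have "(\<Sum>w\<in>(\<Union>(c, j)\<in>heavy_words (?\<rho> N) \<times> {..<N}. ?Z N c j). wt p w)
        \<le> (\<Sum>cj\<in>heavy_words (?\<rho> N) \<times> {..<N}. \<Sum>w\<in>(case cj of (c, j) \<Rightarrow> ?Z N c j). wt p w)"
      using heavy_words_card(1)[OF \<rho>] wt_pos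
      by (intro sum_UN_le) (auto simp: less_imp_le intro!: fin)
    also have "\<dots> = ?R N" by (simp add: sum.cartesian_product case_prod_unfold)
    finally show ?case by simp
  qed
  have lower: "\<forall>\<^sub>F N in sequentially. 0 \<le> ?S N"
    by (rule always_eventually, rule allI, rule sum_nonneg, rule less_imp_le[OF wt_pos])
  show ?thesis by (rule tendsto_sandwich[OF lower upper tendsto_const lim])
qed

end

section \<open>Convergence\<close>

text \<open>Two boundedness assumptions play different parts: \<open>bnd\<close> gives integrability
  at each single N, \<open>unif\<close> controls the contribution of the rare event for large
  N.\<close>

lemma converges_in_Lr_if_bounded:
  assumes prob: "\<And>N. prob_space (P N)"
    and conv: "converges_in_probability P X l"
    and bnd: "\<And>N. \<exists>b. \<forall>\<omega>\<in>space (P N). \<bar>X N \<omega>\<bar> \<le> b"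
    and unif: "\<forall>\<^sub>F N in sequentially. \<forall>\<omega>\<in>space (P N). \<bar>X N \<omega> - l\<bar> \<le> K"
    and r: "r \<ge> 1"
  shows "converges_in_Lr P X l r"
proof -
  have meas: "X N \<in> borel_measurable (P N)" for N
    using conv by (simp add: converges_in_probability_def)
  have integ: "integrable (P N) (\<lambda>\<omega>. \<bar>X N \<omega> - l\<bar> powr r)" for N
  proof -
    interpret prob_space "P N" by (rule prob)
    obtain b where b: "\<And>\<omega>. \<omega> \<in> space (P N) \<Longrightarrow> \<bar>X N \<omega>\<bar> \<le> b" using bnd[of N] by blast
    show ?thesis
    proof (rule integrable_const_bound[where B = "(b + \<bar>l\<bar>) powr r"])
      show "AE \<omega> in P N. norm (\<bar>X N \<omega> - l\<bar> powr r) \<le> (b + \<bar>l\<bar>) powr r"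
      proof (rule AE_I2)
        fix \<omega> assume "\<omega> \<in> space (P N)"
        then have "\<bar>X N \<omega> - l\<bar> \<le> b + \<bar>l\<bar>" using b[of \<omega>] by linarith
        then show "norm (\<bar>X N \<omega> - l\<bar> powr r) \<le> (b + \<bar>l\<bar>) powr r"
          using r by (simp add: powr_mono2)
      qed
      show "(\<lambda>\<omega>. \<bar>X N \<omega> - l\<bar> powr r) \<in> borel_measurable (P N)" using meas[of N] by measurable
    qed
  qed
  have "(\<lambda>N. integral\<^sup>L (P N) (\<lambda>\<omega>. \<bar>X N \<omega> - l\<bar> powr r)) \<longlonglongrightarrow> 0"
  proof (rule order_tendstoI)
    fix a :: real assume "a < 0"
    have "0 \<le> integral\<^sup>L (P N) (\<lambda>\<omega>. \<bar>X N \<omega> - l\<bar> powr r)" for N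
      by (rule Bochner_Integration.integral_nonneg) simp
    then show "\<forall>\<^sub>F N in sequentially. a < integral\<^sup>L (P N) (\<lambda>\<omega>. \<bar>X N \<omega> - l\<bar> powr r)"
      using \<open>a < 0\<close> by (intro always_eventually allI) (rule less_le_trans)
  next
    fix a :: real assume a: "0 < a"
    \<comment> \<open>With d^r = a/2 the part where the deviation is at most d contributes at most
      a/2.\<close>
    define d where "d = (a / 2) powr (1 / r)"
    have d: "d > 0" "d powr r = a / 2" using a r by (auto simp: d_def powr_powr)
    define C where "C = (max K 0) powr r"
    let ?B = "\<lambda>N. {\<omega> \<in> space (P N). \<bar>X N \<omega> - l\<bar> > d}"
    have "(\<lambda>N. C * measure (P N) (?B N)) \<longlonglongrightarrow> C * 0"
      using conv d(1) unfolding converges_in_probability_def by (intro tendsto_mult tendsto_const) auto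
    then have "\<forall>\<^sub>F N in sequentially. C * measure (P N) (?B N) < a / 2"
      using a by (intro order_tendstoD(2)[where a = "a / 2"]) auto
    then show "\<forall>\<^sub>F N in sequentially. integral\<^sup>L (P N) (\<lambda>\<omega>. \<bar>X N \<omega> - l\<bar> powr r) < a"
      using unif
    proof eventually_elim
      case (elim N)
      interpret prob_space "P N" by (rule prob)
      have B: "?B N \<in> sets (P N)" using meas[of N] by measurable
      have "integral\<^sup>L (P N) (\<lambda>\<omega>. \<bar>X N \<omega> - l\<bar> powr r)
          \<le> integral\<^sup>L (P N) (\<lambda>\<omega>. a / 2 + C * indicator (?B N) \<omega>)"
      proof (rule integral_mono[OF integ])
        show "integrable (P N) (\<lambda>\<omega>. a / 2 + C * indicator (?B N) \<omega>)"
          using B by (intro Bochner_Integration.integrable_add integrable_mult_right integrable_real_indicator)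
            (auto simp: emeasure_eq_measure)
        fix \<omega> assume \<omega>: "\<omega> \<in> space (P N)"
        show "\<bar>X N \<omega> - l\<bar> powr r \<le> a / 2 + C * indicator (?B N) \<omega>"
        proof (cases "\<omega> \<in> ?B N")
          case True
          have "\<bar>X N \<omega> - l\<bar> powr r \<le> C" unfolding C_def
            using elim(2) \<omega> r by (intro powr_mono2) (auto simp: max_def)
          then show ?thesis using True a by simp
        next
          case False
          then have "\<bar>X N \<omega> - l\<bar> powr r \<le> d powr r" using \<omega> r by (intro powr_mono2) auto
          then show ?thesis using False d by simp
        qed
      qed
      also have "\<dots> = a / 2 + C * measure (P N) (?B N)"
        using B by (subst Bochner_Integration.integral_add) (auto simp: emeasure_eq_measure prob_space)
      finally show ?case using elim(1) by linarith
    qed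
  qed
  then show ?thesis unfolding converges_in_Lr_def using meas integ by blast
qed

lemma wt_eq_prod_nth: "wt p w = (\<Prod>i<length w. p (w ! i))"
  by (induction w) (auto simp: prod.lessThan_Suc_shift simp del: prod.lessThan_Suc)

text \<open>Events about W are finite disjoint unions of the events W = w, so no particular
  probability space is needed to turn word sums into probabilities.\<close>

lemma measure_source_words:
  fixes p :: "'a::finite \<Rightarrow> real"
  assumes prob: "prob_space P"
    and word: "W \<in> measurable P (count_space {w. length w = N})"
    and law: "\<And>w. length w = N \<Longrightarrow> measure P {\<omega> \<in> space P. W \<omega> = w} = (\<Prod>i<N. p (w ! i))"
  shows "measure P {\<omega> \<in> space P. Q (W \<omega>)} = (\<Sum>w | length w = N \<and> Q w. wt p w)"
proof -
  interpret prob_space P by (rule prob)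
  let ?A = "{w. length w = N \<and> Q w}"
  have fin: "finite ?A" by (rule finite_subset[of _ "{w. length w = N}"]) auto
  have len: "length (W \<omega>) = N" if "\<omega> \<in> space P" for \<omega> using measurable_space[OF word that] by simp
  have sets: "{\<omega> \<in> space P. W \<omega> = w} \<in> sets P" if "length w = N" for w
  proof -
    have "W -` {w} \<inter> space P \<in> sets P" by (rule measurable_sets[OF word]) (use that in simp)
    moreover have "W -` {w} \<inter> space P = {\<omega> \<in> space P. W \<omega> = w}" by auto
    ultimately show ?thesis by simp
  qed
  have "{\<omega> \<in> space P. Q (W \<omega>)} = (\<Union>w\<in>?A. {\<omega> \<in> space P. W \<omega> = w})" using len by auto
  then have "measure P {\<omega> \<in> space P. Q (W \<omega>)} = measure P (\<Union>w\<in>?A. {\<omega> \<in> space P. W \<omega> = w})" by simp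
  also have "\<dots> = (\<Sum>w\<in>?A. measure P {\<omega> \<in> space P. W \<omega> = w})"
    by (rule finite_measure_finite_Union[OF fin]) (use sets in \<open>auto simp: disjoint_family_on_def\<close>)
  also have "\<dots> = (\<Sum>w\<in>?A. wt p w)" by (intro sum.cong) (auto simp: law wt_eq_prod_nth)
  finally show ?thesis .
qed

theorem theoremI1:
  fixes p :: "'a::finite \<Rightarrow> real"
    and P :: "nat \<Rightarrow> 'w measure"
    and W :: "nat \<Rightarrow> 'w \<Rightarrow> 'a list"
  assumes alphabet: "CARD('a) \<ge> 2"
    and p_pos: "\<And>a. p a > 0"
    and p_sum: "(\<Sum>a\<in>UNIV. p a) = 1"
    and prob: "\<And>N. prob_space (P N)"
    and word: "\<And>N. W N \<in> measurable (P N) (count_space {w. length w = N})"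
    and law: "\<And>N w. length w = N \<Longrightarrow>
      measure (P N) {\<omega> \<in> space (P N). W N \<omega> = w} = (\<Prod>i<N. p (w ! i))"
  shows "converges_in_probability P
           (\<lambda>N \<omega>. T_complexity (W N \<omega>) /
              (exp (- euler_mascheroni) * source_entropy p * real N / ln (real N))) 1 \<and>
         (\<forall>r\<ge>1. converges_in_Lr P
           (\<lambda>N \<omega>. T_complexity (W N \<omega>) /
              (exp (- euler_mascheroni) * source_entropy p * real N / ln (real N))) 1 r) \<and>
         (\<forall>r\<ge>1. \<exists>\<xi>. converges_in_Lr P \<xi> 0 r \<and>
           (\<forall>N\<ge>2. \<forall>\<omega>\<in>space (P N).
              T_complexity (W N \<omega>) =
                exp (- euler_mascheroni) * source_entropy2 p * (real N / log 2 (real N))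
                  * (1 + \<xi> N \<omega>)))"
proof -
  interpret source p by unfold_locales (use alphabet p_pos p_sum in auto)
  define Y where "Y N \<omega> = T_complexity (W N \<omega>) / typical_steps N" for N \<omega>
  have Y_eq: "Y = (\<lambda>N \<omega>. T_complexity (W N \<omega>) /
      (exp (- euler_mascheroni) * source_entropy p * real N / ln (real N)))"
    by (intro ext) (simp add: Y_def typical_steps_def)
  have len: "length (W N \<omega>) = N" if "\<omega> \<in> space (P N)" for N \<omega>
    using measurable_space[OF word that] by simp
  note P_eq = measure_source_words[OF prob word law]
  have meas: "Y N \<in> borel_measurable (P N)" for N
  proof -
    have "(\<lambda>w. T_complexity w / typical_steps N) \<in> borel_measurable (count_space {w. length w = N})" by simp
    from measurable_compose[OF word this] show ?thesis unfolding Y_def[abs_def] .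
  qed
  have conv: "converges_in_probability P Y 1"
    unfolding converges_in_probability_def
  proof (intro conjI allI impI meas)
    fix \<epsilon> :: real assume \<epsilon>: "\<epsilon> > 0"
    \<comment> \<open>The tail estimates are available for deviations below 1; shrinking the
      deviation only enlarges the event.\<close>
    define d where "d = min \<epsilon> (1 / 2)"
    have d: "0 < d" "d < 1" "d \<le> \<epsilon>" using \<epsilon> by (auto simp: d_def)
    let ?F = "\<lambda>N. {w :: 'a list. length w = N \<and> canonical_recovery w \<in> {ps. real (length ps) \<le> (1 - d) * typical_steps N}}"
    let ?L = "\<lambda>N. {w :: 'a list. length w = N \<and> T_complexity w \<ge> (1 + d) * typical_steps N}"
    have lim: "(\<lambda>N. (\<Sum>w\<in>?F N. wt p w) + (\<Sum>w\<in>?L N. wt p w)) \<longlonglongrightarrow> 0"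
      using tendsto_add[OF few_steps[OF d(1,2)] large_complexity[OF d(1,2)]] by simp
    have fin: "finite {w :: 'a list. length w = N \<and> Q w}" for N Q
      by (rule finite_subset[of _ "{w. length w = N}"]) auto
    have upper: "\<forall>\<^sub>F N in sequentially. measure (P N) {\<omega> \<in> space (P N). \<bar>Y N \<omega> - 1\<bar> > \<epsilon>}
        \<le> (\<Sum>w\<in>?F N. wt p w) + (\<Sum>w\<in>?L N. wt p w)"
      using eventually_ge_at_top[of 2]
    proof eventually_elim
      case (elim N)
      have t: "typical_steps N > 0" by (rule typical_steps_pos[OF elim])
      have "measure (P N) {\<omega> \<in> space (P N). \<bar>Y N \<omega> - 1\<bar> > \<epsilon>}
          = (\<Sum>w | length w = N \<and> \<bar>T_complexity w / typical_steps N - 1\<bar> > \<epsilon>. wt p w)"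
        unfolding Y_def by (rule P_eq)
      also have "\<dots> \<le> (\<Sum>w\<in>?F N \<union> ?L N. wt p w)"
      proof (rule sum_mono2)
        show "finite (?F N \<union> ?L N)" by (intro finite_UnI fin)
        show "{w. length w = N \<and> \<bar>T_complexity w / typical_steps N - 1\<bar> > \<epsilon>} \<subseteq> ?F N \<union> ?L N"
        proof
          fix w :: "'a list" assume w: "w \<in> {w. length w = N \<and> \<bar>T_complexity w / typical_steps N - 1\<bar> > \<epsilon>}"
          then have ne: "w \<noteq> []" using elim by auto
          \<comment> \<open>Every pair contributes at least log2 2 = 1, so a small complexity forces
            few steps and the lower tail reduces to \<open>few_steps\<close>.\<close>
          have steps: "real (length (canonical_recovery w)) \<le> T_complexity w"
            using length_le_path_complexity[OF canonical_recovery_path(1)[OF ne]] by (simp add: T_complexity_eq)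
          from w d have "T_complexity w / typical_steps N \<ge> 1 + d \<or> T_complexity w / typical_steps N \<le> 1 - d" by auto
          then have "T_complexity w \<ge> (1 + d) * typical_steps N \<or> T_complexity w \<le> (1 - d) * typical_steps N"
            using t by (simp add: pos_le_divide_eq pos_divide_le_eq)
          then show "w \<in> ?F N \<union> ?L N" using w steps by auto
        qed
      qed (rule less_imp_le[OF wt_pos])
      also have "\<dots> \<le> (\<Sum>w\<in>?F N. wt p w) + (\<Sum>w\<in>?L N. wt p w)"
        by (subst sum_Un) (use fin in \<open>auto intro!: sum_nonneg less_imp_le[OF wt_pos]\<close>)
      finally show ?case .
    qed
    show "(\<lambda>N. measure (P N) {\<omega> \<in> space (P N). \<bar>Y N \<omega> - 1\<bar> > \<epsilon>}) \<longlonglongrightarrow> 0"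
      by (rule tendsto_sandwich[OF _ upper tendsto_const lim]) simp
  qed
  have bnd: "\<exists>b. \<forall>\<omega>\<in>space (P N). \<bar>Y N \<omega>\<bar> \<le> b" for N
  proof -
    let ?f = "\<lambda>w :: 'a list. \<bar>T_complexity w / typical_steps N\<bar>"
    have "\<bar>Y N \<omega>\<bar> \<le> Max (?f ` {w. length w = N})" if "\<omega> \<in> space (P N)" for \<omega>
      unfolding Y_def using len[OF that] by (intro Max_ge) auto
    then show ?thesis by blast
  qed
  obtain K where K: "\<forall>\<^sub>F N in sequentially. \<forall>w. length w = N \<longrightarrow> T_complexity (w :: 'a list) \<le> K * typical_steps N"
    using T_complexity_deterministic_bound by blast
  have unif: "\<forall>\<^sub>F N in sequentially. \<forall>\<omega>\<in>space (P N). \<bar>Y N \<omega> - 1\<bar> \<le> \<bar>K\<bar> + 1"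
    using K eventually_ge_at_top[of 2]
  proof eventually_elim
    case (elim N)
    have t: "typical_steps N > 0" by (rule typical_steps_pos[OF elim(2)])
    show ?case
    proof
      fix \<omega> assume \<omega>: "\<omega> \<in> space (P N)"
      then have "W N \<omega> \<noteq> []" using len[OF \<omega>] elim(2) by auto
      then have "real (length (canonical_recovery (W N \<omega>))) \<le> T_complexity (W N \<omega>)"
        unfolding T_complexity_eq by (intro length_le_path_complexity[OF canonical_recovery_path(1)])
      then have "0 \<le> T_complexity (W N \<omega>)" by linarith
      then have "0 \<le> Y N \<omega>" using t by (simp add: Y_def)
      moreover have "Y N \<omega> \<le> K"
        using elim(1) len[OF \<omega>] t by (simp add: Y_def pos_divide_le_eq)
      ultimately show "\<bar>Y N \<omega> - 1\<bar> \<le> \<bar>K\<bar> + 1" by linarith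
    qed
  qed
  have Lr: "converges_in_Lr P Y 1 r" if "r \<ge> 1" for r
    by (rule converges_in_Lr_if_bounded[OF prob conv bnd unif that])
  have "converges_in_Lr P (\<lambda>N \<omega>. Y N \<omega> - 1) 0 r" if "r \<ge> 1" for r
    using Lr[OF that] unfolding converges_in_Lr_def by (auto intro: borel_measurable_diff)
  \<comment> \<open>The remainder is Y - 1. At N = 0 and N = 1 the normaliser is 0 by the
    conventions for logarithm and division, hence N \<ge> 2.\<close>
  moreover have "T_complexity (W N \<omega>) =
      exp (- euler_mascheroni) * source_entropy2 p * (real N / log 2 (real N)) * (1 + (Y N \<omega> - 1))"
    if "N \<ge> 2" for N \<omega>
  proof -
    have "exp (- euler_mascheroni) * source_entropy2 p * (real N / log 2 (real N)) = typical_steps N"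
      by (simp add: source_entropy2_def typical_steps_def log_def)
    then show ?thesis using typical_steps_pos[OF that] by (simp add: Y_def)
  qed
  ultimately show ?thesis using conv Lr unfolding Y_eq[symmetric] by blast
qed

end
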